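(* Let $G$ be a subgroup of $\widehat{\mathrm{Diff}}(\mathbb{C}^2,0)$. Then $G$ is finitely determined if and only if the action of $G$ on the topological space of formal irreducible curves has discrete orbits (i.e. for every formal irreducible curve $\gamma$ the orbit $\{\phi(\gamma):\phi\in G\}$ is a discrete subset).
   Context: Let $\hat{\mathcal O}_2=\mathbb{C}[[x,y]]$ with maximal ideal $\mathfrak m$. $\widehat{\mathrm{Diff}}(\mathbb{C}^2,0)$ is the group, under composition, of pairs $\phi=(\phi_1,\phi_2)\in\mathfrak m^2$ with invertible linear part; $j^k\phi$ denotes the componentwise truncation to degree $\le k$. A subgroup $G$ is finitely determined if there exists $k\ge1$ such that $\{\phi\in G:j^k\phi=\mathrm{Id}\}=\{\mathrm{Id}\}$. A formal irreducible curve $\gamma$ is an ideal $(f)$ of $\hat{\mathcal O}_2$ with $f\in\mathfrak m$ irreducible; $\phi(\gamma)$ is the ideal $(f\circ\phi^{-1})$. Its multiplicity $m_0(\gamma)$ is the $m$ with $f\in\mathfrak m^m\setminus\mathfrak m^{m+1}$; its tangent direction is the line $\{ax+by=0\}$ such that, for a suitable generator $f$, $f-(ax+by)^{m}\in\mathfrak m^{m+1}$. Infinitely near points: set $\mathcal X_0=\mathbb{C}^2$, $p_0=(0,0)$, $\gamma_0=\gamma$. Inductively $\pi_{k+1}:\mathcal X_{k+1}\to\mathcal X_k$ is the blow-up of $\mathcal X_k$ at $p_k(\gamma)$, $p_{k+1}(\gamma)\in\pi_{k+1}^{-1}(p_k(\gamma))$ is the point corresponding to the tangent direction of $\gamma_k$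 at $p_k(\gamma)$, and $\gamma_{k+1}$ is the strict transform of $\gamma_k$, a formal irreducible curve at $p_{k+1}(\gamma)$. (In coordinates $(x,y)$ centered at $p_k(\gamma)$ in which the tangent direction is $\{y=0\}$, and $\gamma_k=(f)$ has multiplicity $m$, the blow-up is $(x,t)\mapsto(x,xt)$, $p_{k+1}(\gamma)$ is $(x,t)=(0,0)$, and $\gamma_{k+1}=(f(x,xt)/x^m)\subset\mathbb{C}[[x,t]]$.) Topology on the set of formal irreducible curves: a base is given by the sets $\mathcal U_{\mathfrak s}=\{\gamma: p_k(\gamma)=p_k\ \text{for all } 0\le k\le n\}$, where $\mathfrak s=(p_k)_{0\le k\le n}$, $n\ge0$, runs over finite sequences of infinitely near points ($p_0$ the origin, each $p_{k+1}$ in the exceptional divisor of the blow-up at $p_k$). *)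

theory Defs
  imports
    "HOL-Computational_Algebra.Formal_Power_Series"
    "HOL-Computational_Algebra.Factorial_Ring"
    "HOL-Analysis.Abstract_Topology"
    "HOL-Algebra.Group"
begin

section \<open>The ring of formal power series in two variables\<close>

text \<open>
  \<open>\<complex>[[x,y]]\<close> is represented as \<open>\<complex>[[x]][[y]]\<close>: the outer series is in \<open>y\<close>, its coefficients are
  series in \<open>x\<close>.
\<close>

type_synonym ps2 = "complex fps fps"

definition coeff2 :: "ps2 \<Rightarrow> nat \<Rightarrow> nat \<Rightarrow> complex" where
  "coeff2 f i j = fps_nth (fps_nth f j) i"

definition mk_ps2 :: "(nat \<Rightarrow> nat \<Rightarrow> complex) \<Rightarrow> ps2" where
  "mk_ps2 c = Abs_fps (\<lambda>j. Abs_fps (\<lambda>i. c i j))"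

definition const2 :: "complex \<Rightarrow> ps2" where
  "const2 c = fps_const (fps_const c)"

definition X2 :: ps2 where
  "X2 = fps_const fps_X"

definition Y2 :: ps2 where
  "Y2 = fps_X"

definition max_ideal :: "ps2 set" where
  "max_ideal = {f. coeff2 f 0 0 = 0}"

text \<open>
  With the ring regarded as a module over itself, \<^const>\<open>module.span\<close> is the ideal generated by a
  set, so this is the usual power of an ideal.
\<close>

primrec max_ideal_pow :: "nat \<Rightarrow> ps2 set" where
  "max_ideal_pow 0 = UNIV"
| "max_ideal_pow (Suc k) = module.span (*) {f * g |f g. f \<in> max_ideal \<and> g \<in> max_ideal_pow k}"

definition principal :: "ps2 \<Rightarrow> ps2 set" where
  "principal f = {f * g |g. True}"

text \<open>
  \<open>subst2 f (\<phi>\<^sub>1, \<phi>\<^sub>2)\<close> is \<open>f(\<phi>\<^sub>1, \<phi>\<^sub>2)\<close>. It is only used for \<open>\<phi>\<^sub>1\<close> and \<open>\<phi>\<^sub>2\<close> in the maximal ideal, where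
  \<open>\<phi>\<^sub>1\<^sup>a \<phi>\<^sub>2\<^sup>b\<close> does not contribute to the coefficients of total degree less than \<open>a + b\<close>; this is why the
  sum can be cut off at \<open>a + b \<le> i + j\<close>.
\<close>

definition subst2 :: "ps2 \<Rightarrow> ps2 \<times> ps2 \<Rightarrow> ps2" where
  "subst2 f \<phi> = mk_ps2 (\<lambda>i j. \<Sum>(a, b) \<in> {(a, b). a + b \<le> i + j}.
     coeff2 f a b * coeff2 (fst \<phi> ^ a * snd \<phi> ^ b) i j)"

definition trunc2 :: "nat \<Rightarrow> ps2 \<Rightarrow> ps2" where
  "trunc2 k f = mk_ps2 (\<lambda>i j. if i + j \<le> k then coeff2 f i j else 0)"


section \<open>Formal diffeomorphisms\<close>

definition formal_Diff :: "(ps2 \<times> ps2) monoid" where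
  "formal_Diff =
    \<lparr> carrier = {(f, g). f \<in> max_ideal \<and> g \<in> max_ideal \<and>
                  coeff2 f 1 0 * coeff2 g 0 1 - coeff2 f 0 1 * coeff2 g 1 0 \<noteq> 0},
      mult = (\<lambda>\<phi> \<psi>. (subst2 (fst \<phi>) \<psi>, subst2 (snd \<phi>) \<psi>)),
      one = (X2, Y2) \<rparr>"

definition jet :: "nat \<Rightarrow> ps2 \<times> ps2 \<Rightarrow> ps2 \<times> ps2" where
  "jet k \<phi> = (trunc2 k (fst \<phi>), trunc2 k (snd \<phi>))"

definition finitely_determined :: "(ps2 \<times> ps2) set \<Rightarrow> bool" where
  "finitely_determined G \<longleftrightarrow>
     (\<exists>k\<ge>1. {\<phi> \<in> G. jet k \<phi> = \<one>\<^bsub>formal_Diff\<^esub>} = {\<one>\<^bsub>formal_Diff\<^esub>})"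


section \<open>Formal irreducible curves\<close>

definition formal_curves :: "ps2 set set" where
  "formal_curves = {principal f |f. f \<in> max_ideal \<and> irreducible f}"

text \<open>
  Since \<open>f \<mapsto> f \<circ> \<phi>\<^sup>-\<^sup>1\<close> is a ring automorphism, the image of the ideal \<open>(f)\<close> is the ideal
  \<open>(f \<circ> \<phi>\<^sup>-\<^sup>1)\<close>.
\<close>

definition curve_image :: "ps2 \<times> ps2 \<Rightarrow> ps2 set \<Rightarrow> ps2 set" where
  "curve_image \<phi> \<gamma> = (\<lambda>f. subst2 f (inv\<^bsub>formal_Diff\<^esub> \<phi>)) ` \<gamma>"

definition curve_orbit :: "(ps2 \<times> ps2) set \<Rightarrow> ps2 set \<Rightarrow> ps2 set set" where
  "curve_orbit G \<gamma> = {curve_image \<phi> \<gamma> |\<phi>. \<phi> \<in> G}"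

definition multiplicity_at_0 :: "ps2 set \<Rightarrow> nat" where
  "multiplicity_at_0 \<gamma> =
     (THE m. \<exists>f. \<gamma> = principal f \<and> f \<in> max_ideal_pow m - max_ideal_pow (Suc m))"

definition line :: "complex \<Rightarrow> complex \<Rightarrow> (complex \<times> complex) set" where
  "line a b = {(u, v). a * u + b * v = 0}"

definition tangent_direction :: "ps2 set \<Rightarrow> (complex \<times> complex) set" where
  "tangent_direction \<gamma> =
     (THE L. \<exists>f a b. \<gamma> = principal f \<and> (a, b) \<noteq> (0, 0) \<and> L = line a b \<and>
        f - (const2 a * X2 + const2 b * Y2) ^ multiplicity_at_0 \<gamma>
          \<in> max_ideal_pow (Suc (multiplicity_at_0 \<gamma>)))"


section \<open>Blow-ups and infinitely near points\<close>

text \<open>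
  The exceptional divisor of the blow-up of a point is the projective line of tangent directions
  there. Fix the following coordinates on the blow-up near the point of the exceptional divisor
  given by a line \<open>L\<close>. If \<open>L = {y = c x}\<close>, apply \<open>(x,t) \<mapsto> (x, x t)\<close> in the coordinates \<open>(x, y - c x)\<close>,
  in which \<open>L\<close> is the horizontal axis; if \<open>L = {x = 0}\<close>, apply it in the coordinates \<open>(y, x)\<close>. The
  value of \<open>blowup_chart\<close> is the blow-down map in these coordinates, the point \<open>L\<close> being their origin
  and the exceptional divisor being the vanishing locus of the first coordinate.
\<close>

definition blowup_chart :: "(complex \<times> complex) set \<Rightarrow> ps2 \<times> ps2" where
  "blowup_chart L =
     (if (0, 1) \<in> L then (X2 * Y2, X2)
      else (X2, X2 * (Y2 + const2 (THE c. (1, c) \<in> L))))"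

definition strict_transform :: "ps2 set \<Rightarrow> ps2 set" where
  "strict_transform \<gamma> =
     (THE \<delta>. \<exists>f g. \<gamma> = principal f \<and> \<delta> = principal g \<and>
        subst2 f (blowup_chart (tangent_direction \<gamma>)) = X2 ^ multiplicity_at_0 \<gamma> * g)"

text \<open>
  In the fixed coordinates every tangent direction at an infinitely near point is a line in
  \<open>\<complex>\<^sup>2\<close>. A point infinitely near to the origin, of order \<open>k\<close>, is encoded as the list
  \<open>[L\<^sub>1, \<dots>, L\<^sub>k]\<close> of the directions successively blown up to reach it; the origin is \<open>[]\<close>. Two such
  points are equal if and only if the lists are.
\<close>

type_synonym inf_near_point = "(complex \<times> complex) set list"

definition exceptional_divisor :: "inf_near_point \<Rightarrow> inf_near_point set" where
  "exceptional_divisor p = {p @ [line a b] |a b. (a, b) \<noteq> (0, 0)}"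

primrec curve_at :: "ps2 set \<Rightarrow> nat \<Rightarrow> ps2 set" where
  "curve_at \<gamma> 0 = \<gamma>"
| "curve_at \<gamma> (Suc k) = strict_transform (curve_at \<gamma> k)"

primrec point_at :: "ps2 set \<Rightarrow> nat \<Rightarrow> inf_near_point" where
  "point_at \<gamma> 0 = []"
| "point_at \<gamma> (Suc k) = point_at \<gamma> k @ [tangent_direction (curve_at \<gamma> k)]"

definition inf_near_seq :: "(nat \<Rightarrow> inf_near_point) \<Rightarrow> nat \<Rightarrow> bool" where
  "inf_near_seq p n \<longleftrightarrow> p 0 = [] \<and> (\<forall>k<n. p (Suc k) \<in> exceptional_divisor (p k))"

definition curves_through :: "(nat \<Rightarrow> inf_near_point) \<Rightarrow> nat \<Rightarrow> ps2 set set" where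
  "curves_through p n = {\<gamma> \<in> formal_curves. \<forall>k\<le>n. point_at \<gamma> k = p k}"

text \<open>
  The generating sets form a base: they cover \<^const>\<open>formal_curves\<close>, and two of them are either
  disjoint or nested (\<open>curves_through_Int\<close> below).
\<close>

definition curve_topology :: "ps2 set topology" where
  "curve_topology = topology_generated_by {curves_through p n |p n. inf_near_seq p n}"

lemma curves_through_Int:
  assumes "m \<le> n"
  shows "curves_through p m \<inter> curves_through q n \<in> {{}, curves_through q n}"
proof (cases "\<forall>k\<le>m. p k = q k")
  case True
  then show ?thesis using assms by (auto simp: curves_through_def)
next
  case False
  then show ?thesis using assms
    by (auto simp: curves_through_def)
qed

lemma topspace_curve_topology [simp]: "topspace curve_topology = formal_curves"
proof -
  have "curves_through (\<lambda>_. []) 0 = formal_curves" "inf_near_seq (\<lambda>_. []) 0"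
    by (auto simp: curves_through_def inf_near_seq_def)
  moreover have "curves_through p n \<subseteq> formal_curves" for p n
    by (auto simp: curves_through_def)
  ultimately have "\<Union>{curves_through p n |p n. inf_near_seq p n} = formal_curves"
    by blast
  then show ?thesis
    by (simp add: curve_topology_def)
qed

lemma coeff2_mult:
  "coeff2 (f * g) i j = (\<Sum>b\<le>j. \<Sum>a\<le>i. coeff2 f a b * coeff2 g (i - a) (j - b))"
  by (simp add: coeff2_def fps_mult_nth fps_sum_nth atLeast0AtMost)

lemma mem_max_ideal_pow_iff:
  "f \<in> max_ideal_pow k \<longleftrightarrow> (\<forall>i j. i + j < k \<longrightarrow> coeff2 f i j = 0)"
proof (induction k arbitrary: f)
  case 0
  then show ?case by simp
next
  case (Suc k)
  let ?S = "{f * g |f g. f \<in> max_ideal \<and> g \<in> max_ideal_pow k}"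
  have mod: "module ((*) :: ps2 \<Rightarrow> _)"
    by unfold_locales (auto simp: algebra_simps)
  show ?case
  proof
    assume "f \<in> max_ideal_pow (Suc k)"
    then have "f \<in> module.span (*) ?S" by simp
    then obtain t r where t: "finite t" "t \<subseteq> ?S" and f: "f = (\<Sum>a\<in>t. r a * a)"
      unfolding module.span_explicit[OF mod] by blast
    have *: "coeff2 (r * (g * h)) i j = 0"
      if "g \<in> max_ideal" "h \<in> max_ideal_pow k" "i + j < Suc k" for g h r i j
    proof -
      have gh: "coeff2 (g * h) i j = 0" if "i + j < Suc k" for i j
        unfolding coeff2_mult
      proof (intro sum.neutral ballI)
        fix b a assume "b \<in> {..j}" "a \<in> {..i}"
        then show "coeff2 g a b * coeff2 h (i - a) (j - b) = 0"
          using \<open>g \<in> max_ideal\<close> \<open>h \<in> max_ideal_pow k\<close> Suc[of h] \<open>i + j < Suc k\<close>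
          by (cases "a = 0 \<and> b = 0") (auto simp: max_ideal_def)
      qed
      show ?thesis
        unfolding coeff2_mult[of r]
        by (intro sum.neutral ballI) (use gh that in auto)
    qed
    have "coeff2 f i j = (\<Sum>a\<in>t. coeff2 (r a * a) i j)" for i j
      by (simp add: f coeff2_def fps_sum_nth)
    then show "\<forall>i j. i + j < Suc k \<longrightarrow> coeff2 f i j = 0"
      using t(2) * by (auto intro!: sum.neutral)
  next
    assume f: "\<forall>i j. i + j < Suc k \<longrightarrow> coeff2 f i j = 0"
    define g where "g = mk_ps2 (\<lambda>i j. if j = 0 then coeff2 f (Suc i) 0 else 0)"
    define h where "h = mk_ps2 (\<lambda>i j. coeff2 f i (Suc j))"
    have "f = X2 * g + Y2 * h"
    proof (intro fps_ext)
      fix j i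
      show "fps_nth (fps_nth f j) i = fps_nth (fps_nth (X2 * g + Y2 * h) j) i"
        using f by (cases i; cases j)
          (auto simp: X2_def Y2_def g_def h_def mk_ps2_def coeff2_def)
    qed
    moreover have "g \<in> max_ideal_pow k" "h \<in> max_ideal_pow k"
      using f unfolding Suc by (auto simp: g_def h_def mk_ps2_def coeff2_def)
    moreover have "X2 \<in> max_ideal" "Y2 \<in> max_ideal"
      by (auto simp: max_ideal_def coeff2_def X2_def Y2_def)
    ultimately show "f \<in> max_ideal_pow (Suc k)"
      unfolding max_ideal_pow.simps
      using module.span_add[OF mod] module.span_base[OF mod] by (metis (mono_tags, lifting) mem_Collect_eq)
  qed
qed

end

theory Submission
  imports Defs
    "HOL-Computational_Algebra.Fundamental_Theorem_Algebra"
    "HOL-Library.Product_Plus"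
    "HOL-Analysis.Continuum_Not_Denumerable"
begin

text \<open>
  \<^bold>\<open>Discrete orbits imply finite determination.\<close> If the orbit of a smooth curve \<open>\<gamma>\<close> is discrete, then
  there is a \<open>k\<close> such that every element of \<open>G\<close> with trivial \<open>k\<close>-jet fixes \<open>\<gamma>\<close>, since it moves \<open>\<gamma>\<close> to
  a curve through the same infinitely near points up to a high order. Apply this to all lines
  \<open>y = c x\<close> and all parabolas \<open>y = c x\<^sup>2\<close>. As \<open>\<complex>\<close> is uncountable, a single \<open>k\<close> serves for infinitely
  many \<open>c\<close>. A diffeomorphism that fixes infinitely many lines has the form \<open>(x u, y u)\<close>, and fixing
  infinitely many of the parabolas forces \<open>u = 1\<close> (\<open>fixes_lines_and_parabolas\<close>). So the \<open>k\<close>-jet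
  determines the elements of \<open>G\<close>.

  \<^bold>\<open>Finite determination implies discrete orbits.\<close> After finitely many blow-ups an irreducible
  curve \<open>\<gamma>\<close> becomes the graph of a series, and a change of coordinates makes it the axis \<open>y = 0\<close>
  (\<open>blow_seq_resolution\<close>). The elements of \<open>G\<close> that fix the infinitely near point reached in this way
  lift to diffeomorphisms of the blown up plane, and the lifts again form a finitely determined group
  (\<open>lift_to_blow_up\<close>, \<open>jet_faithful_lift_group\<close>). It remains to show that in a finitely determined
  group \<open>G\<close> the orders of the series \<open>\<phi>\<^sub>2(x,0)\<close>, that is, the orders of contact of the axis with its
  images, are bounded as long as they are finite (\<open>contact_bounded\<close>).

  Suppose first that \<open>G\<close> is unipotent (\<open>unipotent_contact_bounded\<close>). Then \<open>G\<close> is nilpotent and has a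
  central element \<open>\<zeta> \<noteq> 1\<close>. Elements \<open>\<phi>\<close> of \<open>G\<close> have logarithms \<open>X\<close>, which are formal vector fields, and the
  logarithm \<open>Z\<close> of \<open>\<zeta>\<close> commutes with all of them. Here dimension two enters.

    \<^item> If all \<open>X\<close> are parallel to \<open>Z\<close>, they are multiples of \<open>Z\<close> by first integrals of \<open>Z\<close>. Either all of
      them are tangent to the axis, or \<open>Z\<close> is transverse to it at its generic point. In the second case
      a first integral is determined by its restriction to the axis, and so a high order of contact of
      \<open>\<phi>\<close> forces a high order of vanishing of \<open>X\<close>; thus \<open>\<phi>\<close> has trivial \<open>k\<close>-jet and \<open>\<phi> = 1\<close>.
    \<^item> If the logarithm \<open>Y\<close> of some \<open>a \<in> G\<close> is independent of \<open>Z\<close>, then the fields that commute with both \<open>Y\<close>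
      and \<open>Z\<close> are \<open>\<complex>Y + \<complex>Z\<close>, because there are no nonconstant common first integrals. By nilpotency of \<open>G\<close> some
      power of \<open>Ad a - 1\<close> kills all logarithms \<open>X\<close>, and so these lie in a space of finite dimension. The
      orders of the nonzero elements of a space of series of finite dimension are bounded.

  For general \<open>G\<close>, let \<open>\<lambda>\<close> and \<open>\<mu>\<close> be the eigenvalues of the linear part of \<open>\<phi>\<close>, where \<open>\<phi>\<close> has high contact with
  the axis. By the unipotent case, commutators of such elements preserve the axis. If \<open>\<psi>\<close> has contact of
  finite order \<open>d\<close>, and \<open>\<phi>\<close> of an order larger than \<open>d\<close>, then comparing \<open>\<psi> \<circ> \<phi>\<close> with \<open>\<phi> \<circ> \<psi>\<close> gives \<open>\<lambda>\<^sup>d = \<mu>\<close>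
  (\<open>eigenvalue_relation\<close>). Two different orders \<open>d\<close> make \<open>\<lambda>\<close> and \<open>\<mu>\<close> roots of unity of bounded order. Since the order
  of contact of such \<open>\<phi>\<close> depends on \<open>\<lambda>\<close> and \<open>\<mu>\<close> only, it takes finitely many values.
\<close>

unbundle fps_syntax

section \<open>Coefficients\<close>

(* Powers of the maximal ideal are described by coefficients throughout, and the index 1 of a
   coefficient has to survive simplification. *)
declare max_ideal_pow.simps(2) [simp del] One_nat_def [simp del]

lemma ps2_eqI: "(\<And>i j. coeff2 f i j = coeff2 g i j) \<Longrightarrow> f = g"
  by (intro fps_ext) (auto simp: coeff2_def)

lemma coeff2_linear [simp]:
  "coeff2 0 i j = 0"
  "coeff2 (f + g) i j = coeff2 f i j + coeff2 g i j"
  "coeff2 (f - g) i j = coeff2 f i j - coeff2 g i j"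
  "coeff2 (- f) i j = - coeff2 f i j"
  "coeff2 (const2 c * f) i j = c * coeff2 f i j"
  by (auto simp: coeff2_def const2_def)

lemma coeff2_sum [simp]: "coeff2 (sum f S) i j = (\<Sum>s\<in>S. coeff2 (f s) i j)"
  by (simp add: coeff2_def fps_sum_nth)

lemma coeff2_mk_ps2 [simp]: "coeff2 (mk_ps2 c) i j = c i j"
  by (simp add: coeff2_def mk_ps2_def)

lemma coeff2_const2: "coeff2 (const2 c) i j = (if i = 0 \<and> j = 0 then c else 0)"
  by (auto simp: coeff2_def const2_def)

lemma const2_0 [simp]: "const2 0 = 0" and const2_1 [simp]: "const2 1 = 1"
  by (auto simp: const2_def)

lemma const2_hom:
  "const2 (a + b) = const2 a + const2 b" "const2 (a - b) = const2 a - const2 b"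
  "const2 (a * b) = const2 a * const2 b" "const2 (- a) = - const2 a"
  by (auto intro!: ps2_eqI simp: coeff2_const2)

lemma const2_eq_0_iff [simp]: "const2 c = 0 \<longleftrightarrow> c = 0"
  by (auto simp: const2_def)

lemma coeff2_1: "coeff2 1 i j = (if i = 0 \<and> j = 0 then 1 else 0)"
  using coeff2_const2[of 1] by simp

lemma coeff2_X2_mult: "coeff2 (X2 * f) i j = (if i = 0 then 0 else coeff2 f (i - 1) j)"
  by (auto simp: coeff2_def X2_def)

lemma coeff2_Y2_mult: "coeff2 (Y2 * f) i j = (if j = 0 then 0 else coeff2 f i (j - 1))"
  by (auto simp: coeff2_def Y2_def)

lemma coeff2_X2_power_mult: "coeff2 (X2 ^ a * f) i j = (if i < a then 0 else coeff2 f (i - a) j)"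
  by (induction a arbitrary: i) (auto simp: coeff2_X2_mult mult.assoc less_Suc_eq One_nat_def)

lemma coeff2_Y2_power_mult: "coeff2 (Y2 ^ b * f) i j = (if j < b then 0 else coeff2 f i (j - b))"
  by (induction b arbitrary: j) (auto simp: coeff2_Y2_mult mult.assoc less_Suc_eq One_nat_def)

lemma coeff2_monom: "coeff2 (X2 ^ a * Y2 ^ b) i j = (if i = a \<and> j = b then 1 else 0)"
  using coeff2_X2_power_mult[of a "Y2 ^ b" i j] coeff2_Y2_power_mult[of b 1 "i - a" j]
  by (auto simp: coeff2_1 split: if_splits)

lemma coeff2_X2: "coeff2 X2 i j = (if i = 1 \<and> j = 0 then 1 else 0)"
  using coeff2_monom[of 1 0] by simp

lemma coeff2_Y2: "coeff2 Y2 i j = (if i = 0 \<and> j = 1 then 1 else 0)"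
  using coeff2_monom[of 0 1] by simp

lemma X2_neq_0 [simp]: "X2 \<noteq> 0" and Y2_neq_0 [simp]: "Y2 \<noteq> 0"
  using coeff2_X2[of 1 0] coeff2_Y2[of 0 1] by auto

lemma coeff2_mult_00 [simp]: "coeff2 (f * g) 0 0 = coeff2 f 0 0 * coeff2 g 0 0"
  by (simp add: coeff2_mult)

lemma coeff2_mult_10: "coeff2 (f * g) 1 0 = coeff2 f 0 0 * coeff2 g 1 0 + coeff2 f 1 0 * coeff2 g 0 0"
  by (simp add: coeff2_mult One_nat_def)

lemma coeff2_mult_01: "coeff2 (f * g) 0 1 = coeff2 f 0 0 * coeff2 g 0 1 + coeff2 f 0 1 * coeff2 g 0 0"
  by (simp add: coeff2_mult One_nat_def)

lemma ps2_dvd_1_iff: "(f :: ps2) dvd 1 \<longleftrightarrow> coeff2 f 0 0 \<noteq> 0"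
proof
  assume "f dvd 1"
  then obtain g where "1 = f * g" by (rule dvdE)
  then have "coeff2 f 0 0 * coeff2 g 0 0 = 1"
    using coeff2_mult_00[of f g] by (simp add: coeff2_1)
  then show "coeff2 f 0 0 \<noteq> 0" by auto
next
  assume "coeff2 f 0 0 \<noteq> 0"
  then have "fps_nth f 0 * inverse (fps_nth f 0) = 1"
    by (intro inverse_mult_eq_1') (simp add: coeff2_def)
  then have "f * fps_right_inverse f (inverse (fps_nth f 0)) = 1"
    by (rule fps_right_inverse)
  then show "f dvd 1" by (metis dvd_triv_left)
qed

section \<open>Filtrations by weighted order\<close>

text \<open>
  All monomials \<open>x\<^sup>i y\<^sup>j\<close> of \<open>f\<close> have weight \<open>p i + q j \<ge> n\<close>. The weights \<open>(1,1)\<close> give the powers of the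
  maximal ideal, \<open>(0,1)\<close> and \<open>(1,0)\<close> those of \<open>(y)\<close> and \<open>(x)\<close>, and \<open>wt 1 r r\<close> is the ideal \<open>(x\<^sup>r, y)\<close>. The
  weights \<open>(2,3)\<close> are used for unipotent diffeomorphisms.
\<close>

definition wt :: "nat \<Rightarrow> nat \<Rightarrow> nat \<Rightarrow> ps2 \<Rightarrow> bool" where
  "wt p q n f \<longleftrightarrow> (\<forall>i j. p * i + q * j < n \<longrightarrow> coeff2 f i j = 0)"

lemma mem_max_ideal_pow_wt: "f \<in> max_ideal_pow n \<longleftrightarrow> wt 1 1 n f"
  by (simp add: mem_max_ideal_pow_iff wt_def)

lemma wtD: "wt p q n f \<Longrightarrow> p * i + q * j < n \<Longrightarrow> coeff2 f i j = 0"
  by (auto simp: wt_def)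

lemma wt_0 [simp]: "wt p q n 0" and wt_zero [simp]: "wt p q 0 f"
  by (auto simp: wt_def)

lemma wt_add: "wt p q n f \<Longrightarrow> wt p q n g \<Longrightarrow> wt p q n (f + g)"
  and wt_diff: "wt p q n f \<Longrightarrow> wt p q n g \<Longrightarrow> wt p q n (f - g)"
  and wt_minus: "wt p q n f \<Longrightarrow> wt p q n (- f)"
  by (auto simp: wt_def)

lemma wt_mono: "wt p q n f \<Longrightarrow> m \<le> n \<Longrightarrow> wt p q m f"
  by (auto simp: wt_def)

lemma wt_mult: assumes "wt p q m f" "wt p q n g" shows "wt p q (m + n) (f * g)"
  unfolding wt_def
proof (intro allI impI)
  fix i j assume ij: "p * i + q * j < m + n"
  have "coeff2 f a b * coeff2 g (i - a) (j - b) = 0" if "b \<le> j" "a \<le> i" for a b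
  proof (cases "p * a + q * b < m")
    case True then show ?thesis using assms(1) by (simp add: wt_def)
  next
    case False
    have "i = a + (i - a)" "j = b + (j - b)" using that by auto
    then have "p * i + q * j = (p * a + q * b) + (p * (i - a) + q * (j - b))"
      by (metis add.assoc add.commute add_mult_distrib2)
    then have "p * (i - a) + q * (j - b) < n" using ij False by linarith
    then show ?thesis using assms(2) by (simp add: wt_def)
  qed
  then show "coeff2 (f * g) i j = 0" by (auto simp: coeff2_mult intro!: sum.neutral)
qed

lemma wt_mult_left: "wt p q n f \<Longrightarrow> wt p q n (g * f)"
  using wt_mult[of p q 0 g n f] by simp

lemma wt_mult_right: "wt p q n f \<Longrightarrow> wt p q n (f * g)"
  using wt_mult[of p q n f 0 g] by simp

lemma wt_power: "wt p q n f \<Longrightarrow> wt p q (a * n) (f ^ a)"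
  by (induction a) (auto intro: wt_mult)

lemma wt_all_0: assumes "\<And>n. wt p q n f" shows "f = 0"
proof (rule ps2_eqI)
  fix i j show "coeff2 f i j = coeff2 0 i j"
    using wtD[OF assms[of "Suc (p * i + q * j)"], of i j] by simp
qed

lemma wt_eqI: assumes "\<And>n. wt p q n (f - g)" shows "f = g"
  using wt_all_0[OF assms] by simp

lemma wt_cong: "wt p q n (f - g) \<Longrightarrow> wt p q n f \<longleftrightarrow> wt p q n g"
  by (auto simp: wt_def)

lemma wt_11_iff_00: "wt 1 1 1 f \<longleftrightarrow> coeff2 f 0 0 = 0"
  by (auto simp: wt_def)

lemma max_ideal_wt: "f \<in> max_ideal \<longleftrightarrow> wt 1 1 1 f"
  by (simp add: max_ideal_def wt_def)

lemma finite_tri [simp]: "finite {(a, b). a + b \<le> (n::nat)}"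
  by (rule finite_subset[of _ "{..n} \<times> {..n}"]) auto

lemma wt_trunc2: "wt 1 1 (Suc n) (f - trunc2 n f)"
  by (auto simp: wt_def trunc2_def)

lemma trunc2_sum: "trunc2 n f = (\<Sum>(a, b) \<in> {(a, b). a + b \<le> n}. const2 (coeff2 f a b) * (X2 ^ a * Y2 ^ b))"
proof (rule ps2_eqI)
  fix i j
  have "(\<Sum>x \<in> {(a, b). a + b \<le> n}. coeff2 (case x of (a, b) \<Rightarrow> const2 (coeff2 f a b) * (X2 ^ a * Y2 ^ b)) i j)
     = (\<Sum>x \<in> {(a, b). a + b \<le> n}. if x = (i, j) then coeff2 f i j else 0)"
    by (rule sum.cong) (auto simp: coeff2_monom split: if_splits)
  then show "coeff2 (trunc2 n f) i j = coeff2 (\<Sum>(a, b) \<in> {(a, b). a + b \<le> n}. const2 (coeff2 f a b) * (X2 ^ a * Y2 ^ b)) i j"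
    by (simp add: trunc2_def)
qed

text \<open>Additive maps that lower the order by at most one are determined by their values on monomials,
  because every series is a polynomial up to high order.\<close>

lemma continuous_additive_ext':
  assumes S: "\<And>f g. S (f + g) = S f + S g" "\<And>n f. wt 1 1 (Suc n) f \<Longrightarrow> wt 1 1 n (S f)"
    and T: "\<And>f g. T (f + g) = T f + T g" "\<And>n f. wt 1 1 (Suc n) f \<Longrightarrow> wt 1 1 n (T f)"
    and eq: "\<And>c a b. S (const2 c * (X2 ^ a * Y2 ^ b)) = T (const2 c * (X2 ^ a * Y2 ^ b))"
  shows "S f = T f"
proof (rule wt_eqI)
  fix n
  have zero: "S 0 = 0" "T 0 = 0" using S(1)[of 0 0] T(1)[of 0 0] by auto
  have sums: "S (sum h A) = T (sum h A)" if "\<And>a. a \<in> A \<Longrightarrow> S (h a) = T (h a)" for h and A :: "(nat \<times> nat) set"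
    using that by (induction A rule: infinite_finite_induct) (auto simp: zero S(1) T(1))
  have "S f = S (trunc2 n f) + S (f - trunc2 n f)" "T f = T (trunc2 n f) + T (f - trunc2 n f)"
    using S(1)[symmetric] T(1)[symmetric] by simp_all
  moreover have "S (trunc2 n f) = T (trunc2 n f)"
    unfolding trunc2_sum by (rule sums) (auto simp: eq)
  ultimately have "S f - T f = S (f - trunc2 n f) - T (f - trunc2 n f)" by simp
  moreover have "wt 1 1 n (S (f - trunc2 n f) - T (f - trunc2 n f))"
    by (intro wt_diff S(2) T(2) wt_trunc2)
  ultimately show "wt 1 1 n (S f - T f)" by simp
qed

lemma continuous_additive_ext:
  assumes "\<And>f g. S (f + g) = S f + S g" "\<And>n f. wt 1 1 n f \<Longrightarrow> wt 1 1 n (S f)"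
    and "\<And>f g. T (f + g) = T f + T g" "\<And>n f. wt 1 1 n f \<Longrightarrow> wt 1 1 n (T f)"
    and "\<And>c a b. S (const2 c * (X2 ^ a * Y2 ^ b)) = T (const2 c * (X2 ^ a * Y2 ^ b))"
  shows "S f = T f"
  by (rule continuous_additive_ext'[of S T]) (use assms in \<open>auto intro: wt_mono[of 1 1 "Suc n" _ n for n]\<close>)

section \<open>Substitution\<close>

text \<open>Substitution is well behaved for pairs of series that vanish at the origin.\<close>

definition fixes0 :: "ps2 \<times> ps2 \<Rightarrow> bool" where
  "fixes0 \<phi> \<longleftrightarrow> fst \<phi> \<in> max_ideal \<and> snd \<phi> \<in> max_ideal"

lemma subst2_add [simp]: "subst2 (f + g) \<phi> = subst2 f \<phi> + subst2 g \<phi>"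
  by (rule ps2_eqI) (simp add: subst2_def distrib_right sum.distrib case_prod_unfold)

lemma subst2_0 [simp]: "subst2 0 \<phi> = 0"
  by (rule ps2_eqI) (simp add: subst2_def case_prod_unfold)

lemma subst2_minus [simp]: "subst2 (- f) \<phi> = - subst2 f \<phi>"
  by (rule ps2_eqI) (simp add: subst2_def sum_negf case_prod_unfold)

lemma subst2_diff [simp]: "subst2 (f - g) \<phi> = subst2 f \<phi> - subst2 g \<phi>"
  using subst2_add[of f "- g" \<phi>] by simp

lemma subst2_sum [simp]: "subst2 (sum f A) \<phi> = (\<Sum>a\<in>A. subst2 (f a) \<phi>)"
  by (induction A rule: infinite_finite_induct) auto

lemma subst2_scale [simp]: "subst2 (const2 c * f) \<phi> = const2 c * subst2 f \<phi>"
  by (rule ps2_eqI) (simp add: subst2_def sum_distrib_left mult.assoc case_prod_unfold)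

lemma wt_monom_image:
  assumes "wt p q u (fst \<phi>)" "wt p q v (snd \<phi>)"
  shows "wt p q (u * a + v * b) (fst \<phi> ^ a * snd \<phi> ^ b)"
  using wt_mult[OF wt_power[OF assms(1), of a] wt_power[OF assms(2), of b]] by (simp add: mult.commute)

lemma wt_subst2:
  assumes "wt p q u (fst \<phi>)" "wt p q v (snd \<phi>)" "wt u v n f"
  shows "wt p q n (subst2 f \<phi>)"
  unfolding wt_def
proof (intro allI impI)
  fix i j assume ij: "p * i + q * j < n"
  have "coeff2 f a b * coeff2 (fst \<phi> ^ a * snd \<phi> ^ b) i j = 0" for a b
    using wtD[OF assms(3), of a b] wtD[OF wt_monom_image[OF assms(1,2), of a b], of i j] ij
    by (cases "u * a + v * b < n") auto
  then show "coeff2 (subst2 f \<phi>) i j = 0" by (auto simp: subst2_def intro!: sum.neutral)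
qed

lemma wt_subst2_11: "fixes0 \<phi> \<Longrightarrow> wt 1 1 n f \<Longrightarrow> wt 1 1 n (subst2 f \<phi>)"
  by (rule wt_subst2[where u = 1 and v = 1]) (auto simp: fixes0_def max_ideal_wt)

lemma subst2_monom:
  assumes "fixes0 \<phi>" shows "subst2 (X2 ^ a * Y2 ^ b) \<phi> = fst \<phi> ^ a * snd \<phi> ^ b"
proof (rule ps2_eqI)
  fix i j
  have "(\<Sum>x\<in>{(a, b). a + b \<le> i + j}. (case x of (a', b') \<Rightarrow> coeff2 (X2 ^ a * Y2 ^ b) a' b' * coeff2 (fst \<phi> ^ a' * snd \<phi> ^ b') i j))
    = (\<Sum>x\<in>{(a, b). a + b \<le> i + j}. if x = (a, b) then coeff2 (fst \<phi> ^ a * snd \<phi> ^ b) i j else 0)"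
    by (rule sum.cong) (auto simp: coeff2_monom split: if_splits)
  also have "\<dots> = (if a + b \<le> i + j then coeff2 (fst \<phi> ^ a * snd \<phi> ^ b) i j else 0)"
    by simp
  also have "\<dots> = coeff2 (fst \<phi> ^ a * snd \<phi> ^ b) i j"
    using wtD[OF wt_monom_image[of 1 1 1 \<phi> 1 a b], of i j] assms by (auto simp: fixes0_def max_ideal_wt)
  finally show "coeff2 (subst2 (X2 ^ a * Y2 ^ b) \<phi>) i j = coeff2 (fst \<phi> ^ a * snd \<phi> ^ b) i j"
    by (simp add: subst2_def)
qed

lemma subst2_X2 [simp]: "fixes0 \<phi> \<Longrightarrow> subst2 X2 \<phi> = fst \<phi>"
  and subst2_Y2 [simp]: "fixes0 \<phi> \<Longrightarrow> subst2 Y2 \<phi> = snd \<phi>"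
  and subst2_1 [simp]: "fixes0 \<phi> \<Longrightarrow> subst2 1 \<phi> = 1"
  using subst2_monom[of \<phi> 1 0] subst2_monom[of \<phi> 0 1] subst2_monom[of \<phi> 0 0] by auto

lemma subst2_const2 [simp]: "fixes0 \<phi> \<Longrightarrow> subst2 (const2 c) \<phi> = const2 c"
  using subst2_scale[of c 1 \<phi>] by simp

lemma subst2_mult [simp]:
  assumes "fixes0 \<phi>" shows "subst2 (f * g) \<phi> = subst2 f \<phi> * subst2 g \<phi>"
proof -
  \<comment> \<open>Both sides are additive in each factor, so one factor at a time can be reduced to a monomial.\<close>
  have mono: "subst2 (f * (const2 c * (X2 ^ a * Y2 ^ b))) \<phi> = subst2 f \<phi> * subst2 (const2 c * (X2 ^ a * Y2 ^ b)) \<phi>" for f c a b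
  proof (rule continuous_additive_ext[where S = "\<lambda>f. subst2 (f * (const2 c * (X2 ^ a * Y2 ^ b))) \<phi>"
        and T = "\<lambda>f. subst2 f \<phi> * subst2 (const2 c * (X2 ^ a * Y2 ^ b)) \<phi>"])
    fix c' a' b'
    have "const2 c' * (X2 ^ a' * Y2 ^ b') * (const2 c * (X2 ^ a * Y2 ^ b)) = const2 (c' * c) * (X2 ^ (a' + a) * Y2 ^ (b' + b))"
      by (simp add: const2_hom power_add)
    then have "subst2 (const2 c' * (X2 ^ a' * Y2 ^ b') * (const2 c * (X2 ^ a * Y2 ^ b))) \<phi>
      = const2 (c' * c) * (fst \<phi> ^ (a' + a) * snd \<phi> ^ (b' + b))"
      using assms by (simp only: subst2_monom subst2_scale)
    then show "subst2 (const2 c' * (X2 ^ a' * Y2 ^ b') * (const2 c * (X2 ^ a * Y2 ^ b))) \<phi>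
      = subst2 (const2 c' * (X2 ^ a' * Y2 ^ b')) \<phi> * subst2 (const2 c * (X2 ^ a * Y2 ^ b)) \<phi>"
      using assms by (simp only: subst2_monom subst2_scale const2_hom power_add mult_ac)
  qed (auto simp: distrib_right intro!: wt_mult_right wt_subst2_11 assms)
  show ?thesis
    by (rule continuous_additive_ext[where S = "\<lambda>g. subst2 (f * g) \<phi>" and T = "\<lambda>g. subst2 f \<phi> * subst2 g \<phi>"])
      (auto simp: distrib_left mono intro!: wt_mult_left wt_subst2_11 assms)
qed

lemma subst2_power [simp]: "fixes0 \<phi> \<Longrightarrow> subst2 (f ^ n) \<phi> = subst2 f \<phi> ^ n"
  by (induction n) auto

lemma coeff2_subst2_00 [simp]: "fixes0 \<phi> \<Longrightarrow> coeff2 (subst2 f \<phi>) 0 0 = coeff2 f 0 0"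
proof -
  assume "fixes0 \<phi>"
  have "{(a, b). a + b = (0::nat)} = {(0, 0)}" by auto
  then show ?thesis by (simp add: subst2_def coeff2_1)
qed

lemma fixes0_subst2: "fixes0 \<phi> \<Longrightarrow> fixes0 \<psi> \<Longrightarrow> fixes0 (subst2 (fst \<phi>) \<psi>, subst2 (snd \<phi>) \<psi>)"
  using coeff2_subst2_00[of \<psi>] by (simp add: fixes0_def max_ideal_def)

definition comp2 :: "ps2 \<times> ps2 \<Rightarrow> ps2 \<times> ps2 \<Rightarrow> ps2 \<times> ps2" where
  "comp2 \<phi> \<psi> = (subst2 (fst \<phi>) \<psi>, subst2 (snd \<phi>) \<psi>)"

lemma fixes0_comp2 [simp]: "fixes0 \<phi> \<Longrightarrow> fixes0 \<psi> \<Longrightarrow> fixes0 (comp2 \<phi> \<psi>)"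
  by (simp add: comp2_def fixes0_subst2)

lemma subst2_comp2:
  assumes "fixes0 \<phi>" "fixes0 \<psi>" shows "subst2 f (comp2 \<phi> \<psi>) = subst2 (subst2 f \<phi>) \<psi>"
  by (rule continuous_additive_ext[where S = "\<lambda>f. subst2 f (comp2 \<phi> \<psi>)"])
    (use assms in \<open>auto simp: subst2_monom comp2_def fixes0_subst2 intro!: wt_subst2_11\<close>)

lemma comp2_assoc: "fixes0 \<psi> \<Longrightarrow> fixes0 \<chi> \<Longrightarrow> comp2 (comp2 \<phi> \<psi>) \<chi> = comp2 \<phi> (comp2 \<psi> \<chi>)"
  by (simp add: comp2_def subst2_comp2[unfolded comp2_def])

definition id2 :: "ps2 \<times> ps2" where "id2 = (X2, Y2)"

lemma fixes0_id2 [simp]: "fixes0 id2"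
  by (simp add: fixes0_def id2_def max_ideal_def coeff2_X2 coeff2_Y2)

lemma fst_id2 [simp]: "fst id2 = X2" and snd_id2 [simp]: "snd id2 = Y2"
  by (auto simp: id2_def)

lemma subst2_id2 [simp]: "subst2 f id2 = f"
  by (rule continuous_additive_ext[where S = "\<lambda>f. subst2 f id2" and T = "\<lambda>f. f"])
    (auto simp: subst2_monom intro!: wt_subst2_11)

lemma comp2_id2 [simp]: "comp2 \<phi> id2 = \<phi>" "fixes0 \<phi> \<Longrightarrow> comp2 id2 \<phi> = \<phi>"
  by (auto simp: comp2_def)

text \<open>
  If \<open>\<phi>\<close> and \<open>\<psi>\<close> agree up to terms of weight \<open>k\<close> more than expected, then so do \<open>f \<circ> \<phi>\<close> and \<open>f \<circ> \<psi>\<close>: on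
  monomials this follows by telescoping.
\<close>

lemma wt_subst2_diff_wt:
  assumes \<phi>: "wt p q u (fst \<phi>)" "wt p q v (snd \<phi>)" and \<psi>: "wt p q u (fst \<psi>)" "wt p q v (snd \<psi>)"
    and d: "wt p q (u + k) (fst \<phi> - fst \<psi>)" "wt p q (v + k) (snd \<phi> - snd \<psi>)" and f: "wt u v n f"
  shows "wt p q (n + k) (subst2 f \<phi> - subst2 f \<psi>)"
proof -
  have pw: "wt p q (u * a + k) (g ^ a - h ^ a)" if "wt p q u g" "wt p q u h" "wt p q (u + k) (g - h)" for g h a u
  proof (induction a)
    case (Suc a)
    have eq: "g ^ Suc a - h ^ Suc a = g * (g ^ a - h ^ a) + (g - h) * h ^ a" by (simp add: algebra_simps)
    have "wt p q (u + (u * a + k)) (g * (g ^ a - h ^ a))" by (intro wt_mult that Suc)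
    moreover have "wt p q ((u + k) + a * u) ((g - h) * h ^ a)" by (intro wt_mult wt_power that)
    moreover have "u + (u * a + k) = u * Suc a + k" "(u + k) + a * u = u * Suc a + k" by (simp_all add: algebra_simps)
    ultimately show ?case unfolding eq by (metis wt_add)
  qed auto
  have mon: "wt p q ((u * a + v * b) + k) (fst \<phi> ^ a * snd \<phi> ^ b - fst \<psi> ^ a * snd \<psi> ^ b)" for a b
  proof -
    have eq: "fst \<phi> ^ a * snd \<phi> ^ b - fst \<psi> ^ a * snd \<psi> ^ b
       = fst \<phi> ^ a * (snd \<phi> ^ b - snd \<psi> ^ b) + (fst \<phi> ^ a - fst \<psi> ^ a) * snd \<psi> ^ b" by (simp add: algebra_simps)
    have "wt p q (a * u + (v * b + k)) (fst \<phi> ^ a * (snd \<phi> ^ b - snd \<psi> ^ b))"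
      by (intro wt_mult wt_power pw \<phi> \<psi> d)
    moreover have "wt p q ((u * a + k) + b * v) ((fst \<phi> ^ a - fst \<psi> ^ a) * snd \<psi> ^ b)"
      by (intro wt_mult wt_power pw \<phi> \<psi> d)
    moreover have "a * u + (v * b + k) = (u * a + v * b) + k" "(u * a + k) + b * v = (u * a + v * b) + k"
      by (simp_all add: algebra_simps)
    ultimately show ?thesis unfolding eq by (metis wt_add)
  qed
  show ?thesis unfolding wt_def
  proof (intro allI impI)
    fix i j assume ij: "p * i + q * j < n + k"
    have "coeff2 f a b * coeff2 (fst \<phi> ^ a * snd \<phi> ^ b) i j = coeff2 f a b * coeff2 (fst \<psi> ^ a * snd \<psi> ^ b) i j" for a b
      using wtD[OF f, of a b] wtD[OF mon[of a b], of i j] ij by (cases "u * a + v * b < n") auto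
    then show "coeff2 (subst2 f \<phi> - subst2 f \<psi>) i j = 0" by (simp only: subst2_def coeff2_linear coeff2_mk_ps2 diff_self)
  qed
qed

lemma wt_subst2_diff:
  assumes "fixes0 \<phi>" "fixes0 \<psi>" "wt 1 1 n (fst \<phi> - fst \<psi>)" "wt 1 1 n (snd \<phi> - snd \<psi>)"
  shows "wt 1 1 n (subst2 f \<phi> - subst2 f \<psi>)"
proof (cases n)
  case (Suc k)
  let ?f = "f - const2 (coeff2 f 0 0)"
  have "wt 1 1 1 ?f" by (simp add: wt_11_iff_00 coeff2_const2)
  then have "wt 1 1 (1 + k) (subst2 ?f \<phi> - subst2 ?f \<psi>)"
    using assms Suc by (intro wt_subst2_diff_wt[where u = 1 and v = 1]) (auto simp: fixes0_def max_ideal_wt plus_1_eq_Suc)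
  then show ?thesis using assms(1,2) Suc by (simp add: plus_1_eq_Suc)
qed simp

section \<open>Formal diffeomorphisms form a group\<close>

text \<open>
  Iterating \<open>T\<close> fixes the values at indices of weight \<open>n\<close> after \<open>n + 1\<close> steps, whatever the starting
  point, and the limit is a fixed point.
\<close>

lemma contraction_fixpoint:
  fixes T :: "('i \<Rightarrow> 'v) \<Rightarrow> 'i \<Rightarrow> 'v" and w :: "'i \<Rightarrow> nat"
  assumes T: "\<And>n a b. (\<And>i. w i < n \<Longrightarrow> a i = b i) \<Longrightarrow> (\<And>i. w i < Suc n \<Longrightarrow> T a i = T b i)"
  obtains a where "T a = a"
proof -
  define s where "s n = (T ^^ n) (\<lambda>_. undefined)" for n
  have step: "s (Suc m) i = s m i" if "w i < m" for m i
    using that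
  proof (induction m arbitrary: i)
    case (Suc m)
    have "T (s (Suc m)) i = T (s m) i" by (rule T[of m]) (use Suc in auto)
    then show ?case by (simp add: s_def)
  qed auto
  have stable: "s m i = s (Suc (w i)) i" if "Suc (w i) \<le> m" for m i
    using that by (induction m rule: dec_induct) (auto simp: step)
  define a where "a i = s (Suc (w i)) i" for i
  have "T a i = a i" for i
  proof -
    have "T a i = T (s (Suc (w i))) i"
    proof (rule T[of "w i"])
      fix j assume "w j < w i"
      then show "a j = s (Suc (w i)) j" using stable[of j "Suc (w i)"] by (simp add: a_def)
    qed simp
    also have "\<dots> = s (Suc (Suc (w i))) i" by (simp add: s_def)
    also have "\<dots> = a i" unfolding a_def by (rule stable) simp
    finally show ?thesis .
  qed
  then show ?thesis using that by blast
qed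

lemma ps2_split:
  obtains g h where "f = const2 (coeff2 f 0 0) + X2 * g + Y2 * h"
    "\<And>n. wt 1 1 (Suc n) f \<Longrightarrow> wt 1 1 n g \<and> wt 1 1 n h"
    "coeff2 g 0 0 = coeff2 f 1 0" "coeff2 h 0 0 = coeff2 f 0 1"
proof
  define g where "g = mk_ps2 (\<lambda>i j. if j = 0 then coeff2 f (Suc i) 0 else 0)"
  define h where "h = mk_ps2 (\<lambda>i j. coeff2 f i (Suc j))"
  show "f = const2 (coeff2 f 0 0) + X2 * g + Y2 * h"
    by (rule ps2_eqI) (auto simp: g_def h_def coeff2_X2_mult coeff2_Y2_mult coeff2_const2)
  show "wt 1 1 n g \<and> wt 1 1 n h" if "wt 1 1 (Suc n) f" for n
    using that by (auto simp: wt_def g_def h_def)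
  show "coeff2 g 0 0 = coeff2 f 1 0" "coeff2 h 0 0 = coeff2 f 0 1"
    by (auto simp: g_def h_def One_nat_def)
qed

lemma wt_2I:
  assumes "coeff2 f 0 0 = 0" "coeff2 f 1 0 = 0" "coeff2 f 0 1 = 0" shows "wt 1 1 2 f"
  unfolding wt_def
proof (intro allI impI)
  fix i j :: nat assume "1 * i + 1 * j < 2"
  then have "(i = 0 \<and> j = 0) \<or> (i = 1 \<and> j = 0) \<or> (i = 0 \<and> j = 1)" by auto
  then show "coeff2 f i j = 0" using assms by auto
qed

lemma coeff2_subst2_linear:
  assumes "fixes0 \<phi>"
  shows "coeff2 (subst2 f \<phi>) 1 0 = coeff2 f 1 0 * coeff2 (fst \<phi>) 1 0 + coeff2 f 0 1 * coeff2 (snd \<phi>) 1 0"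
    and "coeff2 (subst2 f \<phi>) 0 1 = coeff2 f 1 0 * coeff2 (fst \<phi>) 0 1 + coeff2 f 0 1 * coeff2 (snd \<phi>) 0 1"
proof -
  obtain g h where f: "f = const2 (coeff2 f 0 0) + X2 * g + Y2 * h"
    and c: "coeff2 g 0 0 = coeff2 f 1 0" "coeff2 h 0 0 = coeff2 f 0 1"
    using ps2_split[of f] by metis
  have *: "subst2 f \<phi> = const2 (coeff2 f 0 0) + fst \<phi> * subst2 g \<phi> + snd \<phi> * subst2 h \<phi>"
    by (subst f) (simp add: assms)
  have p: "coeff2 (fst \<phi>) 0 0 = 0" "coeff2 (snd \<phi>) 0 0 = 0" using assms by (auto simp: fixes0_def max_ideal_def)
  show "coeff2 (subst2 f \<phi>) 1 0 = coeff2 f 1 0 * coeff2 (fst \<phi>) 1 0 + coeff2 f 0 1 * coeff2 (snd \<phi>) 1 0"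
    "coeff2 (subst2 f \<phi>) 0 1 = coeff2 f 1 0 * coeff2 (fst \<phi>) 0 1 + coeff2 f 0 1 * coeff2 (snd \<phi>) 0 1"
    unfolding * using assms by (simp_all add: coeff2_mult_10 coeff2_mult_01 p c coeff2_const2)
qed

definition jac :: "ps2 \<times> ps2 \<Rightarrow> complex" where
  "jac \<phi> = coeff2 (fst \<phi>) 1 0 * coeff2 (snd \<phi>) 0 1 - coeff2 (fst \<phi>) 0 1 * coeff2 (snd \<phi>) 1 0"

definition diff2 :: "ps2 \<times> ps2 \<Rightarrow> bool" where
  "diff2 \<phi> \<longleftrightarrow> fixes0 \<phi> \<and> jac \<phi> \<noteq> 0"

lemma diff2_fixes0 [simp]: "diff2 \<phi> \<Longrightarrow> fixes0 \<phi>"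
  by (simp add: diff2_def)

lemma carrier_formal_Diff [simp]: "\<phi> \<in> carrier formal_Diff \<longleftrightarrow> diff2 \<phi>"
  by (auto simp: formal_Diff_def diff2_def fixes0_def jac_def split: prod.splits)

lemma mult_formal_Diff [simp]: "\<phi> \<otimes>\<^bsub>formal_Diff\<^esub> \<psi> = comp2 \<phi> \<psi>"
  by (simp add: formal_Diff_def comp2_def)

lemma one_formal_Diff [simp]: "\<one>\<^bsub>formal_Diff\<^esub> = id2"
  by (simp add: formal_Diff_def id2_def)

lemma jac_comp2: "fixes0 \<psi> \<Longrightarrow> jac (comp2 \<phi> \<psi>) = jac \<phi> * jac \<psi>"
  by (simp add: jac_def comp2_def coeff2_subst2_linear algebra_simps)

lemma jac_id2 [simp]: "jac id2 = 1"
  by (simp add: jac_def coeff2_X2 coeff2_Y2)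

lemma diff2_comp2 [simp]: "diff2 \<phi> \<Longrightarrow> diff2 \<psi> \<Longrightarrow> diff2 (comp2 \<phi> \<psi>)"
  by (simp add: diff2_def jac_comp2)

lemma diff2_id2 [simp]: "diff2 id2"
  by (simp add: diff2_def)

lemma wt_subst2_diff_Suc:
  assumes "fixes0 \<phi>" "fixes0 \<psi>" "wt 1 1 n (fst \<phi> - fst \<psi>)" "wt 1 1 n (snd \<phi> - snd \<psi>)" "wt 1 1 2 h"
  shows "wt 1 1 (Suc n) (subst2 h \<phi> - subst2 h \<psi>)"
proof (cases n)
  case 0
  have "wt 1 1 2 (subst2 h \<phi> - subst2 h \<psi>)" by (intro wt_diff wt_subst2_11 assms)
  then show ?thesis using 0 by (auto elim: wt_mono)
next
  case (Suc k)
  then have "wt 1 1 (2 + k) (subst2 h \<phi> - subst2 h \<psi>)"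
    using assms by (intro wt_subst2_diff_wt[where u = 1 and v = 1]) (auto simp: fixes0_def max_ideal_wt plus_1_eq_Suc)
  then show ?thesis using Suc by simp
qed

text \<open>
  Write \<open>\<phi> = A + h\<close> with \<open>A\<close> linear and \<open>h\<close> of order at least 2. The equation \<open>\<phi> \<circ> \<psi> = id\<close> becomes
  \<open>\<psi> = A\<^sup>-\<^sup>1 (id - h \<circ> \<psi>)\<close>, whose right-hand side is a contraction in \<open>\<psi>\<close> for the order.
\<close>

lemma right_inverse_exists:
  assumes "diff2 \<phi>"
  obtains \<psi> where "diff2 \<psi>" "comp2 \<phi> \<psi> = id2"
proof -
  define a b c d D where "a = coeff2 (fst \<phi>) 1 0" and "b = coeff2 (fst \<phi>) 0 1" and "c = coeff2 (snd \<phi>) 1 0"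
    and "d = coeff2 (snd \<phi>) 0 1" and "D = a * d - b * c"
  have D: "D \<noteq> 0" using assms by (simp add: diff2_def jac_def D_def a_def b_def c_def d_def)
  have p0: "coeff2 (fst \<phi>) 0 0 = 0" "coeff2 (snd \<phi>) 0 0 = 0" using assms by (auto simp: diff2_def fixes0_def max_ideal_def)
  define h1 h2 where "h1 = fst \<phi> - (const2 a * X2 + const2 b * Y2)" and "h2 = snd \<phi> - (const2 c * X2 + const2 d * Y2)"
  have h: "wt 1 1 2 h1" "wt 1 1 2 h2"
    by (rule wt_2I; simp add: p0 h1_def h2_def coeff2_X2 coeff2_Y2 a_def b_def c_def d_def)+
  \<comment> \<open>The constant terms are forced to be zero, so that \<open>T\<close> is a contraction on all coefficient families.\<close>
  define P :: "(bool \<times> nat \<times> nat \<Rightarrow> complex) \<Rightarrow> ps2 \<times> ps2" where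
    "P s = (mk_ps2 (\<lambda>i j. if i = 0 \<and> j = 0 then 0 else s (True, i, j)), mk_ps2 (\<lambda>i j. if i = 0 \<and> j = 0 then 0 else s (False, i, j)))" for s
  have P: "fixes0 (P s)" for s by (simp add: P_def fixes0_def max_ideal_def)
  define U V where "U \<psi> = const2 (d / D) * (X2 - subst2 h1 \<psi>) - const2 (b / D) * (Y2 - subst2 h2 \<psi>)"
    and "V \<psi> = const2 (a / D) * (Y2 - subst2 h2 \<psi>) - const2 (c / D) * (X2 - subst2 h1 \<psi>)" for \<psi>
  define T where "T s = (\<lambda>(t, i, j). coeff2 (if t then U (P s) else V (P s)) i j)" for s
  obtain s where s: "T s = s"
  proof (rule contraction_fixpoint[where w = "\<lambda>(t, i, j). i + j" and T = T])
    fix n and i :: "bool \<times> nat \<times> nat" and r s :: "bool \<times> nat \<times> nat \<Rightarrow> complex" assume eq: "\<And>i. (case i of (t, i, j) \<Rightarrow> i + j) < n \<Longrightarrow> r i = s i"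
      and i: "(case i of (t, i, j) \<Rightarrow> i + j) < Suc n"
    have w: "wt 1 1 n (fst (P r) - fst (P s))" "wt 1 1 n (snd (P r) - snd (P s))"
      using eq[of "(True, _, _)"] eq[of "(False, _, _)"] by (auto simp: wt_def P_def)
    note * = wt_subst2_diff_Suc[OF P P w h(1)] wt_subst2_diff_Suc[OF P P w h(2)]
    obtain t k l where i_eq: "i = (t, k, l)" by (cases i)
    show "T r i = T s i"
      using wtD[OF *(1), of k l] wtD[OF *(2), of k l] i by (auto simp: i_eq T_def U_def V_def)
  qed
  let ?\<psi> = "P s"
  have sTF: "s (True, i, j) = coeff2 (U ?\<psi>) i j" "s (False, i, j) = coeff2 (V ?\<psi>) i j" for i j
    using fun_cong[OF s, of "(True, i, j)"] fun_cong[OF s, of "(False, i, j)"] by (auto simp: T_def)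
  have UV0: "coeff2 (U ?\<psi>) 0 0 = 0" "coeff2 (V ?\<psi>) 0 0 = 0"
    using P[of s] wtD[OF h(1), of 0 0] wtD[OF h(2), of 0 0] by (auto simp: U_def V_def coeff2_X2 coeff2_Y2)
  have UV: "fst ?\<psi> = U ?\<psi>" "snd ?\<psi> = V ?\<psi>"
    by (rule ps2_eqI, use sTF UV0 in \<open>auto simp: P_def\<close>)+
  have cD: "const2 (d / D) * const2 a - const2 (c / D) * const2 b = 1" "const2 (a / D) * const2 d - const2 (b / D) * const2 c = 1"
    "const2 (d / D) * const2 c = const2 (c / D) * const2 d" "const2 (b / D) * const2 a = const2 (a / D) * const2 b"
  proof -
    have "d / D * a - c / D * b = D / D" "a / D * d - b / D * c = D / D"
      unfolding times_divide_eq_left diff_divide_distrib[symmetric] by (simp_all add: D_def mult.commute)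
    then show "const2 (d / D) * const2 a - const2 (c / D) * const2 b = 1" "const2 (a / D) * const2 d - const2 (b / D) * const2 c = 1"
      using D by (simp_all flip: const2_hom)
  qed (simp_all add: mult.commute flip: const2_hom)
  have lin: "const2 a * fst ?\<psi> + const2 b * snd ?\<psi> = X2 - subst2 h1 ?\<psi>" 
    "const2 c * fst ?\<psi> + const2 d * snd ?\<psi> = Y2 - subst2 h2 ?\<psi>"
    unfolding UV(1)[unfolded U_def] UV(2)[unfolded V_def] using cD by algebra+
  have \<phi>: "fst \<phi> = const2 a * X2 + const2 b * Y2 + h1" "snd \<phi> = const2 c * X2 + const2 d * Y2 + h2"
    by (auto simp: h1_def h2_def)
  have comp: "comp2 \<phi> ?\<psi> = id2"
    unfolding comp2_def \<phi> using lin by (simp add: P id2_def)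
  then have "jac \<phi> * jac ?\<psi> = 1" using jac_comp2[OF P, of \<phi> s] by simp
  then have "diff2 ?\<psi>" using P by (auto simp: diff2_def)
  then show ?thesis using comp that by blast
qed

lemma group_formal_Diff: "group formal_Diff"
proof (rule groupI)
  fix \<phi> assume \<phi>: "\<phi> \<in> carrier formal_Diff"
  then obtain \<psi> where \<psi>: "diff2 \<psi>" "comp2 \<phi> \<psi> = id2" by (metis carrier_formal_Diff right_inverse_exists)
  obtain \<chi> where \<chi>: "diff2 \<chi>" "comp2 \<psi> \<chi> = id2" using right_inverse_exists[OF \<psi>(1)] .
  have "\<chi> = comp2 (comp2 \<phi> \<psi>) \<chi>" using \<psi> \<chi> by simp
  also have "\<dots> = comp2 \<phi> (comp2 \<psi> \<chi>)" by (rule comp2_assoc) (use \<psi> \<chi> in auto)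
  finally have "\<phi> = \<chi>" using \<chi> by simp
  then show "\<exists>\<psi>\<in>carrier formal_Diff. \<psi> \<otimes>\<^bsub>formal_Diff\<^esub> \<phi> = \<one>\<^bsub>formal_Diff\<^esub>"
    using \<chi> \<psi> by auto
qed (auto simp: comp2_assoc)

definition inv2 :: "ps2 \<times> ps2 \<Rightarrow> ps2 \<times> ps2" where "inv2 \<phi> = inv\<^bsub>formal_Diff\<^esub> \<phi>"

lemma diff2_inv2 [simp]: "diff2 \<phi> \<Longrightarrow> diff2 (inv2 \<phi>)"
  using group.inv_closed[OF group_formal_Diff, of \<phi>] by (simp add: inv2_def)

lemma comp2_inv2 [simp]: "diff2 \<phi> \<Longrightarrow> comp2 \<phi> (inv2 \<phi>) = id2" "diff2 \<phi> \<Longrightarrow> comp2 (inv2 \<phi>) \<phi> = id2"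
  using group.r_inv[OF group_formal_Diff, of \<phi>] group.l_inv[OF group_formal_Diff, of \<phi>] by (auto simp: inv2_def)

lemma inv2_inv2 [simp]: "diff2 \<phi> \<Longrightarrow> inv2 (inv2 \<phi>) = \<phi>"
  using group.inv_inv[OF group_formal_Diff, of \<phi>] by (simp add: inv2_def)

lemma subst2_inv2 [simp]:
  assumes "diff2 \<phi>"
  shows "subst2 (subst2 f \<phi>) (inv2 \<phi>) = f" "subst2 (subst2 f (inv2 \<phi>)) \<phi> = f"
  using assms by (simp_all flip: subst2_comp2)

lemma inv2_unique: "diff2 \<phi> \<Longrightarrow> diff2 \<psi> \<Longrightarrow> comp2 \<phi> \<psi> = id2 \<Longrightarrow> inv2 \<psi> = \<phi>"
  using group.inv_equality[OF group_formal_Diff, of \<phi> \<psi>] by (simp add: inv2_def)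

lemma ps2_unit_inverse:
  assumes "coeff2 u 0 0 \<noteq> 0" obtains v where "u * v = (1 :: ps2)" "coeff2 v 0 0 * coeff2 u 0 0 = 1"
proof -
  have "u dvd 1" using assms by (simp add: ps2_dvd_1_iff)
  then obtain v where v: "1 = u * v" by (rule dvdE)
  show ?thesis by (rule that[of v]) (use v coeff2_mult_00[of u v] in \<open>auto simp: coeff2_1 mult.commute\<close>)
qed

section \<open>Vector fields\<close>

definition dx :: "ps2 \<Rightarrow> ps2" where
  "dx f = mk_ps2 (\<lambda>i j. of_nat (Suc i) * coeff2 f (Suc i) j)"

definition dy :: "ps2 \<Rightarrow> ps2" where
  "dy f = mk_ps2 (\<lambda>i j. of_nat (Suc j) * coeff2 f i (Suc j))"

lemma coeff2_dx [simp]: "coeff2 (dx f) i j = of_nat (Suc i) * coeff2 f (Suc i) j"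
  and coeff2_dy [simp]: "coeff2 (dy f) i j = of_nat (Suc j) * coeff2 f i (Suc j)"
  by (auto simp: dx_def dy_def)

lemma dx_add [simp]: "dx (f + g) = dx f + dx g" and dy_add [simp]: "dy (f + g) = dy f + dy g"
  and dx_diff [simp]: "dx (f - g) = dx f - dx g" and dy_diff [simp]: "dy (f - g) = dy f - dy g"
  by (rule ps2_eqI; simp add: algebra_simps)+

lemma dy_scale [simp]: "dy (const2 c * f) = const2 c * dy f"
  by (rule ps2_eqI) (simp add: mult.left_commute del: of_nat_Suc)

lemma dy_fps_deriv: "dy f = fps_deriv f"
proof (intro fps_ext)
  fix j i
  have "fps_nth (of_nat (Suc j) * fps_nth f (Suc j)) i = of_nat (Suc j) * fps_nth (fps_nth f (Suc j)) i"
    by (metis fps_mult_left_const_nth fps_of_nat)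
  then show "fps_nth (fps_nth (dy f) j) i = fps_nth (fps_nth (fps_deriv f) j) i"
    by (simp add: dy_def mk_ps2_def coeff2_def One_nat_def del: of_nat_Suc)
qed

lemma dx_fps_deriv: "dx f = Abs_fps (\<lambda>j. fps_deriv (fps_nth f j))"
  by (intro fps_ext) (simp add: dx_def mk_ps2_def coeff2_def One_nat_def del: of_nat_Suc)

lemma dy_mult [simp]: "dy (f * g) = dy f * g + f * dy g"
  by (simp add: dy_fps_deriv)

lemma dx_mult [simp]: "dx (f * g) = dx f * g + f * dx g"
proof (rule fps_ext)
  fix n
  have "fps_deriv (sum h A) = (\<Sum>a\<in>A. fps_deriv (h a))" for h :: "nat \<Rightarrow> complex fps" and A
    by (induction A rule: infinite_finite_induct) auto
  then show "fps_nth (dx (f * g)) n = fps_nth (dx f * g + f * dx g) n"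
    by (simp add: dx_fps_deriv fps_mult_nth sum.distrib)
qed

lemma dx_X2 [simp]: "dx X2 = 1" and dy_X2 [simp]: "dy X2 = 0" and dx_Y2 [simp]: "dx Y2 = 0" and dy_Y2 [simp]: "dy Y2 = 1"
  and dx_const2 [simp]: "dx (const2 c) = 0" and dy_const2 [simp]: "dy (const2 c) = 0"
  by (rule ps2_eqI; auto simp: coeff2_X2 coeff2_Y2 coeff2_1 coeff2_const2 One_nat_def)+

lemma wt_dx: "wt 1 1 (Suc n) f \<Longrightarrow> wt 1 1 n (dx f)" and wt_dy: "wt 1 1 (Suc n) f \<Longrightarrow> wt 1 1 n (dy f)"
  by (auto simp: wt_def)

text \<open>A pair \<open>(A, B)\<close> stands for the vector field \<open>A \<partial>\<^sub>x + B \<partial>\<^sub>y\<close>.\<close>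

definition der :: "ps2 \<times> ps2 \<Rightarrow> ps2 \<Rightarrow> ps2" where
  "der v h = fst v * dx h + snd v * dy h"

lemma der_add [simp]: "der v (f + g) = der v f + der v g" and der_diff [simp]: "der v (f - g) = der v f - der v g"
  and der_scale [simp]: "der v (const2 c * f) = const2 c * der v f"
  and der_mult [simp]: "der v (f * g) = der v f * g + f * der v g"
  and der_X2 [simp]: "der v X2 = fst v" and der_Y2 [simp]: "der v Y2 = snd v"
  and der_const2 [simp]: "der v (const2 c) = 0"
  by (simp_all add: der_def algebra_simps)

lemma wt_der: "wt 1 1 (Suc n) f \<Longrightarrow> wt 1 1 n (der v f)"
  unfolding der_def by (intro wt_add wt_mult_left wt_dx wt_dy)

text \<open>A continuous derivation is a vector field.\<close>

lemma derivation_eq_der: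
  assumes add: "\<And>f g. D (f + g) = D f + D g" and wt: "\<And>n f. wt 1 1 (Suc n) f \<Longrightarrow> wt 1 1 n (D f)"
    and mult: "\<And>f g. D (f * g) = D f * g + f * D g" and const: "\<And>c. D (const2 c) = 0"
  shows "D h = der (D X2, D Y2) h"
proof (rule continuous_additive_ext'[of D "der (D X2, D Y2)"])
  let ?v = "(D X2, D Y2)"
  fix c a b
  have 1: "D 1 = 0" "der ?v 1 = 0" using const[of 1] der_const2[of ?v 1] by simp_all
  have "D (X2 ^ a) = der ?v (X2 ^ a)" for a
    by (induction a) (simp_all add: 1 mult)
  moreover have "D (Y2 ^ b) = der ?v (Y2 ^ b)" for b
    by (induction b) (simp_all add: 1 mult)
  ultimately show "D (const2 c * (X2 ^ a * Y2 ^ b)) = der ?v (const2 c * (X2 ^ a * Y2 ^ b))"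
    by (simp add: mult const)
qed (auto simp: add intro: wt wt_der)

lemma chain_rule: 
  assumes "fixes0 \<phi>"
  shows "der v (subst2 h \<phi>) = subst2 (dx h) \<phi> * der v (fst \<phi>) + subst2 (dy h) \<phi> * der v (snd \<phi>)"
proof (rule continuous_additive_ext'[of "\<lambda>h. der v (subst2 h \<phi>)" "\<lambda>h. subst2 (dx h) \<phi> * der v (fst \<phi>) + subst2 (dy h) \<phi> * der v (snd \<phi>)"])
  let ?S = "\<lambda>h. der v (subst2 h \<phi>)" and ?T = "\<lambda>h. subst2 (dx h) \<phi> * der v (fst \<phi>) + subst2 (dy h) \<phi> * der v (snd \<phi>)"
  have mult: "?S (f * g) = ?T (f * g)" if "?S f = ?T f" "?S g = ?T g" for f g
    using that assms by (simp add: algebra_simps)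
  have 1: "?S (const2 c) = ?T (const2 c)" for c using assms by simp
  have "?S (X2 ^ a) = ?T (X2 ^ a)" for a
  proof (induction a)
    case 0 then show ?case using 1[of 1] by simp
  next
    case (Suc a) show ?case unfolding power_Suc by (rule mult[OF _ Suc]) (use assms in simp)
  qed
  moreover have "?S (Y2 ^ a) = ?T (Y2 ^ a)" for a
  proof (induction a)
    case 0 then show ?case using 1[of 1] by simp
  next
    case (Suc a) show ?case unfolding power_Suc by (rule mult[OF _ Suc]) (use assms in simp)
  qed
  ultimately show "?S (const2 c * (X2 ^ a * Y2 ^ b)) = ?T (const2 c * (X2 ^ a * Y2 ^ b))" for c a b
    by (intro mult 1) auto
qed (auto simp: algebra_simps intro!: wt_add wt_mult_left wt_mult_right wt_subst2_11 wt_dx wt_dy wt_der assms)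

section \<open>Linear terms of polynomial families\<close>

text \<open>
  Only the powers \<open>\<phi>\<^sup>t\<close> with \<open>t \<in> \<nat>\<close> are at hand to define the logarithm of \<open>\<phi>\<close>. Their coefficients will be
  polynomials in \<open>t\<close>, and \<open>c\<close> is the derivative of the polynomial at \<open>0\<close>. It determines a calculus of
  derivatives because a polynomial is determined by its values on \<open>\<nat>\<close>.
\<close>

definition has_lin :: "(nat \<Rightarrow> complex) \<Rightarrow> complex \<Rightarrow> bool" where
  "has_lin f c \<longleftrightarrow> (\<exists>p. (\<forall>t. f t = poly p (of_nat t)) \<and> coeff p 1 = c)"

lemma poly_eqI_nat:
  fixes p q :: "complex poly" assumes "\<And>t::nat. poly p (of_nat t) = poly q (of_nat t)" shows "p = q"
proof (rule ccontr)
  assume "p \<noteq> q"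
  then have "finite {x. poly (p - q) x = 0}" by (intro poly_roots_finite) auto
  moreover have "range (of_nat :: nat \<Rightarrow> complex) \<subseteq> {x. poly (p - q) x = 0}" using assms by auto
  ultimately have "finite (range (of_nat :: nat \<Rightarrow> complex))" by (rule rev_finite_subset)
  then show False using finite_imageD[of "of_nat :: nat \<Rightarrow> complex" UNIV] inj_of_nat infinite_UNIV_nat by auto
qed

lemma has_lin_unique: "has_lin f c \<Longrightarrow> has_lin f d \<Longrightarrow> c = d"
  unfolding has_lin_def by (metis poly_eqI_nat)

lemma has_lin_const: "has_lin (\<lambda>_. c) 0"
  unfolding has_lin_def by (rule exI[of _ "[:c:]"]) (simp add: One_nat_def)

lemma has_lin_add: "has_lin f c \<Longrightarrow> has_lin g d \<Longrightarrow> has_lin (\<lambda>t. f t + g t) (c + d)"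
  unfolding has_lin_def by (metis coeff_add poly_add)

lemma has_lin_mult: "has_lin f c \<Longrightarrow> has_lin g d \<Longrightarrow> has_lin (\<lambda>t. f t * g t) (c * g 0 + f 0 * d)"
  unfolding has_lin_def
proof (elim exE conjE)
  fix p q assume pq: "\<forall>t. f t = poly p (of_nat t)" "\<forall>t. g t = poly q (of_nat t)" "coeff p 1 = c" "coeff q 1 = d"
  then have "f 0 = coeff p 0" "g 0 = coeff q 0" by (simp_all add: poly_0_coeff_0)
  then show "\<exists>p. (\<forall>t. f t * g t = poly p (of_nat t)) \<and> coeff p 1 = c * g 0 + f 0 * d"
    using pq by (intro exI[of _ "p * q"]) (simp add: coeff_mult One_nat_def mult.commute)
qed

lemma has_lin_cmult: "has_lin f c \<Longrightarrow> has_lin (\<lambda>t. k * f t) (k * c)"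
  using has_lin_mult[OF has_lin_const[of k], of f c] by simp

lemma has_lin_multc: "has_lin f c \<Longrightarrow> has_lin (\<lambda>t. f t * k) (c * k)"
  using has_lin_cmult[of f c k] by (simp add: mult.commute)

lemma has_lin_sum: "(\<And>s. s \<in> S \<Longrightarrow> has_lin (f s) (c s)) \<Longrightarrow> has_lin (\<lambda>t. \<Sum>s\<in>S. f s t) (\<Sum>s\<in>S. c s)"
  by (induction S rule: infinite_finite_induct) (auto intro: has_lin_const has_lin_add)

lemma has_lin_choose: "\<exists>c. has_lin (\<lambda>t. of_nat (t choose k)) c"
proof -
  have "of_nat (t choose k) = poly (smult (1 / fact k) (\<Prod>i=0..<k. [:- of_nat i, 1:])) (of_nat t :: complex)" for t
    by (simp add: binomial_gbinomial gbinomial_prod_rev poly_prod)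
  then show ?thesis unfolding has_lin_def by blast
qed

text \<open>A function with vanishing iterated differences is a combination of binomial coefficients.\<close>

definition binomial_comb :: "(nat \<Rightarrow> complex) \<Rightarrow> bool" where
  "binomial_comb f \<longleftrightarrow> (\<exists>c K. \<forall>t. f t = (\<Sum>k<K. c k * of_nat (t choose k)))"

lemma binomial_comb_antidiff:
  assumes "binomial_comb (\<lambda>t. f (Suc t) - f t)" shows "binomial_comb f"
proof -
  obtain c K where c: "\<And>t. f (Suc t) - f t = (\<Sum>k<K. c k * of_nat (t choose k))"
    using assms by (auto simp: binomial_comb_def)
  have "f t = f 0 + (\<Sum>k<K. c k * of_nat (t choose Suc k))" for t
  proof (induction t)
    case (Suc t)
    have "f (Suc t) = f t + (\<Sum>k<K. c k * of_nat (t choose k))" using c[of t] by (simp add: algebra_simps)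
    then show ?case using Suc by (simp add: algebra_simps sum.distrib)
  qed simp
  moreover have "f 0 + (\<Sum>k<K. c k * of_nat (t choose Suc k)) = (\<Sum>k<Suc K. (case k of 0 \<Rightarrow> f 0 | Suc k \<Rightarrow> c k) * of_nat (t choose k))" for t
    unfolding sum.lessThan_Suc_shift by simp
  ultimately show ?thesis unfolding binomial_comb_def by metis
qed

lemma binomial_comb_has_lin: "binomial_comb f \<Longrightarrow> \<exists>c. has_lin f c"
proof -
  assume "binomial_comb f"
  then obtain c K where f: "f = (\<lambda>t. \<Sum>k<K. c k * of_nat (t choose k))" by (auto simp: binomial_comb_def)
  obtain d where d: "\<And>k. has_lin (\<lambda>t. of_nat (t choose k)) (d k)" using has_lin_choose by metis
  have "has_lin f (\<Sum>k<K. c k * d k)" unfolding f by (intro has_lin_sum has_lin_cmult d)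
  then show ?thesis ..
qed

text \<open>\<open>g'\<close> is the coefficientwise derivative of the family \<open>g\<close> at \<open>t = 0\<close>.\<close>

definition slin :: "(nat \<Rightarrow> ps2) \<Rightarrow> ps2 \<Rightarrow> bool" where
  "slin g g' \<longleftrightarrow> (\<forall>i j. has_lin (\<lambda>t. coeff2 (g t) i j) (coeff2 g' i j))"

lemma slin_unique: "slin g a \<Longrightarrow> slin g b \<Longrightarrow> a = b"
  unfolding slin_def by (metis has_lin_unique ps2_eqI)

lemma slin_const: "slin (\<lambda>_. g) 0"
  by (simp add: slin_def has_lin_const)

lemma slin_add: "slin g a \<Longrightarrow> slin h b \<Longrightarrow> slin (\<lambda>t. g t + h t) (a + b)"
  by (simp add: slin_def has_lin_add)

lemma slin_mult: "slin g a \<Longrightarrow> slin h b \<Longrightarrow> slin (\<lambda>t. g t * h t) (a * h 0 + g 0 * b)"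
  unfolding slin_def coeff2_mult coeff2_linear sum.distrib[symmetric] by (auto intro!: has_lin_sum has_lin_mult)

lemma slin_mult_const: "slin g a \<Longrightarrow> slin (\<lambda>t. h * g t) (h * a)"
  using slin_mult[OF slin_const[of h]] by simp

lemma slin_der: "slin g a \<Longrightarrow> slin (\<lambda>t. der v (g t)) (der v a)"
  unfolding der_def by (intro slin_add slin_mult_const) (auto simp: slin_def intro: has_lin_cmult)

lemma slin_subst2: "slin g a \<Longrightarrow> slin (\<lambda>t. subst2 (g t) \<phi>) (subst2 a \<phi>)"
  unfolding slin_def subst2_def coeff2_mk_ps2
  by (auto simp: case_prod_unfold intro!: has_lin_sum has_lin_multc)

lemma slin_wt: "slin g a \<Longrightarrow> (\<And>t. wt p q n (g t)) \<Longrightarrow> wt p q n a"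
  unfolding slin_def wt_def
proof (intro allI impI)
  fix i j assume *: "\<forall>i j. has_lin (\<lambda>t. coeff2 (g t) i j) (coeff2 a i j)"
    "\<And>t. \<forall>i j. p * i + q * j < n \<longrightarrow> coeff2 (g t) i j = 0" "p * i + q * j < n"
  then have "has_lin (\<lambda>_. 0) (coeff2 a i j)" by (metis (no_types, lifting) ext)
  then show "coeff2 a i j = 0" using has_lin_unique has_lin_const by blast
qed

text \<open>
  The family \<open>F\<close> of diffeomorphisms starts at the identity, and its tangent vector at \<open>t = 0\<close> is the
  vector field \<open>v\<close>.
\<close>

definition has_der :: "(nat \<Rightarrow> ps2 \<times> ps2) \<Rightarrow> ps2 \<times> ps2 \<Rightarrow> bool" where
  "has_der F v \<longleftrightarrow> F 0 = id2 \<and> (\<forall>t. fixes0 (F t)) \<and> (\<forall>h. slin (\<lambda>t. subst2 h (F t)) (der v h))"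

text \<open>The derivative of ring homomorphisms is a derivation, by the product rule.\<close>

lemma has_derI:
  assumes "F 0 = id2" "\<And>t. fixes0 (F t)" "\<And>h. slin (\<lambda>t. subst2 h (F t)) (D h)"
  shows "has_der F (D X2, D Y2)"
proof -
  have "D h = der (D X2, D Y2) h" for h
  proof (rule derivation_eq_der)
    show "D (f + g) = D f + D g" for f g
      using slin_unique[OF assms(3), of "f + g"] slin_add[OF assms(3,3), of f g] by simp
    show "D (f * g) = D f * g + f * D g" for f g
      using slin_unique[OF assms(3), of "f * g"] slin_mult[OF assms(3,3), of f g] assms(1,2) by simp
    show "D (const2 c) = 0" for c
      using slin_unique[OF assms(3), of "const2 c"] slin_const[of "const2 c"] assms(2) by simp
    show "wt 1 1 n (D f)" if "wt 1 1 (Suc n) f" for n f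
      using assms(2) wt_mono[OF that, of n] by (intro slin_wt[OF assms(3)] wt_subst2_11) auto
  qed
  then have "der (D X2, D Y2) = D" by (metis ext)
  then show ?thesis unfolding has_der_def using assms by metis
qed

lemma has_der_fixes0: "has_der F v \<Longrightarrow> fixes0 (F t)" by (simp add: has_der_def)

lemma has_derD: "has_der F v \<Longrightarrow> slin (\<lambda>t. subst2 h (F t)) (der v h)" by (simp add: has_der_def)

lemma has_der_0: "has_der F v \<Longrightarrow> F 0 = id2" by (simp add: has_der_def)

lemma der_eqD: assumes "\<And>h. der v h = der w h" shows "v = w"
  using assms[of X2] assms[of Y2] by (simp add: prod_eq_iff)

lemma has_der_unique: assumes "has_der F v" "has_der F w" shows "v = w"
  by (rule der_eqD) (rule slin_unique[OF has_derD has_derD, OF assms])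

lemma slin_subst2_family:
  assumes g: "slin g a" and F: "has_der F v"
  shows "slin (\<lambda>t. subst2 (g t) (F t)) (a + der v (g 0))"
  unfolding slin_def
proof (intro allI)
  fix i j :: nat
  define S where "S = {(a, b). a + b \<le> i + j}"
  define m where "m t a b = coeff2 (subst2 (X2 ^ a * Y2 ^ b) (F t)) i j" for t a b
  define m' where "m' a b = coeff2 (der v (X2 ^ a * Y2 ^ b)) i j" for a b
  \<comment> \<open>A coefficient of \<open>h \<circ> F t\<close> is bilinear in finitely many coefficients of \<open>h\<close> and of the images of monomials.\<close>
  have E: "coeff2 (subst2 h (F t)) i j = (\<Sum>(a, b)\<in>S. coeff2 h a b * m t a b)" for h t
    using F by (simp add: subst2_def[of h] subst2_monom has_der_fixes0 m_def S_def del: subst2_mult subst2_power)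
  have m: "has_lin (\<lambda>t. m t a b) (m' a b)" for a b
    using has_derD[OF F, of "X2 ^ a * Y2 ^ b"] unfolding slin_def m_def m'_def by blast
  have "has_lin (\<lambda>t. \<Sum>(a, b)\<in>S. coeff2 h a b * m t a b) (\<Sum>(a, b)\<in>S. coeff2 h a b * m' a b)" for h
    unfolding case_prod_unfold by (intro has_lin_sum has_lin_cmult m)
  moreover have "has_lin (\<lambda>t. coeff2 (subst2 h (F t)) i j) (coeff2 (der v h) i j)" for h
    using has_derD[OF F] by (simp add: slin_def)
  ultimately have E': "coeff2 (der v h) i j = (\<Sum>(a, b)\<in>S. coeff2 h a b * m' a b)" for h
    unfolding E by (rule has_lin_unique[rotated])
  have "has_lin (\<lambda>t. \<Sum>(p, q)\<in>S. coeff2 (g t) p q * m t p q)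
     (\<Sum>(p, q)\<in>S. coeff2 a p q * m 0 p q + coeff2 (g 0) p q * m' p q)"
    unfolding case_prod_unfold using g by (intro has_lin_sum has_lin_mult m) (auto simp: slin_def)
  also have "(\<Sum>(p, q)\<in>S. coeff2 a p q * m 0 p q + coeff2 (g 0) p q * m' p q)
     = coeff2 (subst2 a (F 0)) i j + coeff2 (der v (g 0)) i j"
    unfolding E E' by (simp add: case_prod_unfold sum.distrib)
  finally have "has_lin (\<lambda>t. coeff2 (subst2 (g t) (F t)) i j) (coeff2 (subst2 a (F 0)) i j + coeff2 (der v (g 0)) i j)"
    by (simp only: E)
  then show "has_lin (\<lambda>t. coeff2 (subst2 (g t) (F t)) i j) (coeff2 (a + der v (g 0)) i j)"
    using F by (simp add: has_der_0)
qed

lemma der_add_field: "der (v + w) h = der v h + der w h" and der_minus_field: "der (- v) h = - der v h"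
  and der_diff_field: "der (v - w) h = der v h - der w h"
  by (simp_all add: der_def algebra_simps)

lemma has_der_comp2:
  assumes "has_der F v" "has_der G w"
  shows "has_der (\<lambda>t. comp2 (F t) (G t)) (v + w)"
  unfolding has_der_def
proof (intro conjI allI)
  fix h
  show "slin (\<lambda>t. subst2 h (comp2 (F t) (G t))) (der (v + w) h)"
    using slin_subst2_family[OF has_derD[OF assms(1)] assms(2), of h] assms
    by (simp add: subst2_comp2 has_der_fixes0 has_der_0 der_add_field)
qed (use assms in \<open>auto simp: has_der_def\<close>)

definition conj2 :: "ps2 \<times> ps2 \<Rightarrow> ps2 \<times> ps2 \<Rightarrow> ps2 \<times> ps2" where
  "conj2 a \<phi> = comp2 (comp2 a \<phi>) (inv2 a)"

definition Ad :: "ps2 \<times> ps2 \<Rightarrow> ps2 \<times> ps2 \<Rightarrow> ps2 \<times> ps2" where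
  "Ad a v = (subst2 (der v (fst a)) (inv2 a), subst2 (der v (snd a)) (inv2 a))"

lemma der_Ad:
  assumes "diff2 a" shows "der (Ad a v) h = subst2 (der v (subst2 h a)) (inv2 a)"
  using assms by (simp add: Ad_def chain_rule[of a] der_def[of "(_, _)"] mult.commute)

lemma has_der_conj2:
  assumes a: "diff2 a" and F: "has_der F v"
  shows "has_der (\<lambda>t. conj2 a (F t)) (Ad a v)"
  unfolding has_der_def
proof (intro conjI allI)
  fix h
  show "slin (\<lambda>t. subst2 h (conj2 a (F t))) (der (Ad a v) h)"
    using slin_subst2[OF has_derD[OF F, of "subst2 h a"], of "inv2 a"] a F
    by (simp add: der_Ad conj2_def subst2_comp2 has_der_fixes0)
qed (use assms in \<open>auto simp: has_der_def conj2_def\<close>)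

section \<open>Unipotent diffeomorphisms and their logarithms\<close>

text \<open>
  The linear part of a unipotent \<open>\<phi>\<close> may contain a term \<open>\<alpha> y\<close> in the first component. With \<open>x\<close> of weight \<open>2\<close>
  and \<open>y\<close> of weight \<open>3\<close>, the map \<open>h \<mapsto> h \<circ> \<phi> - h\<close> nevertheless raises all weights by at least \<open>1\<close>, and
  \<open>ufilt i\<close> says that it raises them by at least \<open>i\<close>.
\<close>

definition ufilt :: "nat \<Rightarrow> ps2 \<times> ps2 \<Rightarrow> bool" where
  "ufilt i \<phi> \<longleftrightarrow> wt 2 3 (2 + i) (fst \<phi> - X2) \<and> wt 2 3 (3 + i) (snd \<phi> - Y2)"

lemma wt_X2_Y2: "wt 2 3 2 X2" "wt 2 3 3 Y2"
  by (auto simp: wt_def coeff2_X2 coeff2_Y2)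

lemma ufilt_wt: "ufilt i \<phi> \<Longrightarrow> wt 2 3 2 (fst \<phi>)" "ufilt i \<phi> \<Longrightarrow> wt 2 3 3 (snd \<phi>)"
  unfolding ufilt_def using wt_cong[of 2 3 2 "fst \<phi>" X2] wt_cong[of 2 3 3 "snd \<phi>" Y2] wt_X2_Y2
    wt_mono[of 2 3 "2 + i" "fst \<phi> - X2" 2] wt_mono[of 2 3 "3 + i" "snd \<phi> - Y2" 3] by auto

lemma ufilt_subst2: "ufilt i \<phi> \<Longrightarrow> wt 2 3 n h \<Longrightarrow> wt 2 3 (n + i) (subst2 h \<phi> - h)"
  using wt_subst2_diff_wt[of 2 3 2 \<phi> 3 id2 i n h] ufilt_wt[of i \<phi>] wt_X2_Y2 by (simp add: ufilt_def)

lemma ufiltI: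
  assumes "fixes0 \<phi>" "\<And>n h. wt 2 3 n h \<Longrightarrow> wt 2 3 (n + i) (subst2 h \<phi> - h)" shows "ufilt i \<phi>"
  using assms(2)[OF wt_X2_Y2(1)] assms(2)[OF wt_X2_Y2(2)] assms(1) by (simp add: ufilt_def)

lemma ufilt_mono: "ufilt i \<phi> \<Longrightarrow> j \<le> i \<Longrightarrow> ufilt j \<phi>"
  by (auto simp: ufilt_def intro: wt_mono)

lemma unip_coeffs:
  assumes "ufilt 1 \<phi>"
  shows "coeff2 (fst \<phi>) 0 0 = 0" "coeff2 (snd \<phi>) 0 0 = 0" "coeff2 (fst \<phi>) 1 0 = 1" "coeff2 (snd \<phi>) 1 0 = 0" "coeff2 (snd \<phi>) 0 1 = 1"
proof -
  have *: "wt 2 3 3 (fst \<phi> - X2)" "wt 2 3 4 (snd \<phi> - Y2)" using assms by (auto simp: ufilt_def)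
  show "coeff2 (fst \<phi>) 0 0 = 0" "coeff2 (snd \<phi>) 0 0 = 0" "coeff2 (fst \<phi>) 1 0 = 1" "coeff2 (snd \<phi>) 1 0 = 0" "coeff2 (snd \<phi>) 0 1 = 1"
    using wtD[OF *(1), of 0 0] wtD[OF *(2), of 0 0] wtD[OF *(1), of 1 0] wtD[OF *(2), of 1 0] wtD[OF *(2), of 0 1]
    by (simp_all add: coeff2_X2 coeff2_Y2)
qed

lemma unip_diff2: "ufilt 1 \<phi> \<Longrightarrow> diff2 \<phi>"
  using unip_coeffs[of \<phi>] by (simp add: diff2_def fixes0_def max_ideal_def jac_def)

lemma unip_iff:
  assumes "fixes0 \<phi>" shows "ufilt 1 \<phi> \<longleftrightarrow> coeff2 (fst \<phi>) 1 0 = 1 \<and> coeff2 (snd \<phi>) 1 0 = 0 \<and> coeff2 (snd \<phi>) 0 1 = 1"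
proof
  assume *: "coeff2 (fst \<phi>) 1 0 = 1 \<and> coeff2 (snd \<phi>) 1 0 = 0 \<and> coeff2 (snd \<phi>) 0 1 = 1"
  have c: "(2::nat) * i + 3 * j < 3 \<longleftrightarrow> (i = 0 \<and> j = 0) \<or> (i = 1 \<and> j = 0)"
    "(2::nat) * i + 3 * j < 4 \<longleftrightarrow> (i = 0 \<and> j = 0) \<or> (i = 1 \<and> j = 0) \<or> (i = 0 \<and> j = 1)" for i j :: nat
    by presburger+
  show "ufilt 1 \<phi>" using * assms by (auto simp: ufilt_def wt_def c coeff2_X2 coeff2_Y2 fixes0_def max_ideal_def)
qed (use unip_coeffs in auto)

lemma ufilt_diff2: "ufilt i \<phi> \<Longrightarrow> 1 \<le> i \<Longrightarrow> diff2 \<phi>"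
  using ufilt_mono unip_diff2 by blast

lemma ufilt_id2 [simp]: "ufilt i id2" by (simp add: ufilt_def)

lemma ufilt_comp2:
  assumes "ufilt i \<phi>" "ufilt i \<psi>" "1 \<le> i" shows "ufilt i (comp2 \<phi> \<psi>)"
proof (rule ufiltI)
  fix n h assume h: "wt 2 3 n h"
  have "subst2 h (comp2 \<phi> \<psi>) - h = subst2 (subst2 h \<phi> - h) \<psi> + (subst2 h \<psi> - h)"
    using assms ufilt_diff2 by (simp add: subst2_comp2)
  moreover have "wt 2 3 (n + i) (subst2 (subst2 h \<phi> - h) \<psi>)"
    by (rule wt_subst2[OF ufilt_wt[OF assms(2)] ufilt_subst2[OF assms(1) h]])
  ultimately show "wt 2 3 (n + i) (subst2 h (comp2 \<phi> \<psi>) - h)"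
    using ufilt_subst2[OF assms(2) h] by (simp only: wt_add)
qed (use assms ufilt_diff2 in auto)

text \<open>
  If \<open>g = h \<circ> \<phi>\<^sup>-\<^sup>1\<close> has weight \<open>m\<close>, then \<open>g = h - (g \<circ> \<phi> - g)\<close> has weight \<open>m + 1\<close>, as long as \<open>m\<close> is less than
  the weight of \<open>h\<close>.
\<close>

lemma wt_subst2_inv2:
  assumes "ufilt 1 \<phi>" "wt 2 3 n h" shows "wt 2 3 n (subst2 h (inv2 \<phi>))"
proof -
  let ?g = "subst2 h (inv2 \<phi>)"
  have "wt 2 3 m ?g" if "m \<le> n" for m
    using that
  proof (induction m)
    case (Suc m)
    have "wt 2 3 (m + 1) (subst2 ?g \<phi> - ?g)" by (rule ufilt_subst2[OF assms(1)]) (use Suc in simp)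
    moreover have "wt 2 3 (m + 1) h" using assms(2) Suc.prems by (auto intro: wt_mono)
    ultimately have "wt 2 3 (m + 1) (h - (subst2 ?g \<phi> - ?g))" by (rule wt_diff[rotated])
    then show ?case using unip_diff2[OF assms(1)] by (simp add: One_nat_def)
  qed simp
  then show ?thesis by simp
qed

lemma ufilt_inv2:
  assumes "ufilt i \<phi>" "1 \<le> i" shows "ufilt i (inv2 \<phi>)"
proof (rule ufiltI)
  fix n h assume h: "wt 2 3 n h"
  have \<phi>: "ufilt 1 \<phi>" "diff2 \<phi>" using ufilt_mono assms ufilt_diff2 by blast+
  have "wt 2 3 (n + i) (subst2 (subst2 h (inv2 \<phi>)) \<phi> - subst2 h (inv2 \<phi>))"
    by (intro ufilt_subst2[OF assms(1)] wt_subst2_inv2 \<phi> h)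
  then show "wt 2 3 (n + i) (subst2 h (inv2 \<phi>) - h)" using wt_minus \<phi> by fastforce
qed (use assms ufilt_diff2 in auto)

definition comm2 :: "ps2 \<times> ps2 \<Rightarrow> ps2 \<times> ps2 \<Rightarrow> ps2 \<times> ps2" where
  "comm2 \<phi> \<psi> = comp2 (conj2 \<phi> \<psi>) (inv2 \<psi>)"

lemma diff2_conj2 [simp]: "diff2 a \<Longrightarrow> diff2 \<phi> \<Longrightarrow> diff2 (conj2 a \<phi>)"
  and diff2_comm2 [simp]: "diff2 a \<Longrightarrow> diff2 \<phi> \<Longrightarrow> diff2 (comm2 a \<phi>)"
  by (auto simp: conj2_def comm2_def)

lemma subst2_comm2:
  assumes "diff2 \<phi>" "diff2 \<psi>"
  shows "subst2 h (comm2 \<phi> \<psi>) = subst2 (subst2 (subst2 (subst2 h \<phi>) \<psi>) (inv2 \<phi>)) (inv2 \<psi>)"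
  using assms by (simp add: comm2_def conj2_def subst2_comp2)

lemma comp2_eqI: assumes "fixes0 \<phi>" "fixes0 \<psi>" "\<And>h. subst2 h \<phi> = subst2 h \<psi>" shows "\<phi> = \<psi>"
  using assms(3)[of X2] assms(3)[of Y2] assms(1,2) by (simp add: prod_eq_iff)

lemma comm2_eq_id2_iff:
  assumes "diff2 \<phi>" "diff2 \<psi>" shows "comm2 \<phi> \<psi> = id2 \<longleftrightarrow> comp2 \<phi> \<psi> = comp2 \<psi> \<phi>"
proof
  assume c: "comm2 \<phi> \<psi> = id2"
  have "subst2 h (comp2 \<phi> \<psi>) = subst2 h (comp2 \<psi> \<phi>)" for h
  proof -
    have "subst2 (subst2 (subst2 h (comm2 \<phi> \<psi>)) \<psi>) \<phi> = subst2 (subst2 h \<phi>) \<psi>"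
      using assms by (simp add: subst2_comm2)
    then show ?thesis using assms by (simp add: subst2_comp2 c)
  qed
  then show "comp2 \<phi> \<psi> = comp2 \<psi> \<phi>" using assms by (intro comp2_eqI) auto
next
  assume c: "comp2 \<phi> \<psi> = comp2 \<psi> \<phi>"
  show "comm2 \<phi> \<psi> = id2"
  proof (rule comp2_eqI)
    fix h
    have "subst2 (subst2 h \<phi>) \<psi> = subst2 (subst2 h \<psi>) \<phi>"
      using c assms by (metis diff2_fixes0 subst2_comp2)
    then show "subst2 h (comm2 \<phi> \<psi>) = subst2 h id2" using assms by (simp add: subst2_comm2)
  qed (use assms in auto)
qed

text \<open>
  With \<open>\<phi>\<^sup>* = 1 + U\<close> and \<open>\<psi>\<^sup>* = 1 + V\<close>, the operator of the commutator is \<open>1 + [V, U]\<close> up to composition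
  with inverses, and \<open>U\<close> and \<open>V\<close> raise weights by \<open>i\<close> and \<open>j\<close>.
\<close>

lemma ufilt_comm2:
  assumes \<phi>: "ufilt i \<phi>" "1 \<le> i" and \<psi>: "ufilt j \<psi>" "1 \<le> j"
  shows "ufilt (i + j) (comm2 \<phi> \<psi>)"
proof (rule ufiltI)
  have u: "ufilt 1 \<phi>" "ufilt 1 \<psi>" using assms ufilt_mono by blast+
  have d: "diff2 \<phi>" "diff2 \<psi>" using u unip_diff2 by auto
  show "fixes0 (comm2 \<phi> \<psi>)" using d by simp
  fix n h assume h: "wt 2 3 n h"
  define U V where "U g = subst2 g \<phi> - g" and "V g = subst2 g \<psi> - g" for g
  have "subst2 (subst2 h \<phi>) \<psi> - subst2 (subst2 h \<psi>) \<phi> = V (U h) - U (V h)"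
    by (simp add: U_def V_def)
  moreover have "wt 2 3 (n + i + j) (V (U h))" "wt 2 3 (n + j + i) (U (V h))"
    unfolding U_def V_def by (intro ufilt_subst2 \<phi> \<psi> h)+
  moreover have "n + i + j = n + (i + j)" "n + j + i = n + (i + j)" by simp_all
  ultimately have "wt 2 3 (n + (i + j)) (subst2 (subst2 h \<phi>) \<psi> - subst2 (subst2 h \<psi>) \<phi>)"
    by (metis wt_diff)
  then have "wt 2 3 (n + (i + j)) (subst2 (subst2 (subst2 (subst2 h \<phi>) \<psi> - subst2 (subst2 h \<psi>) \<phi>) (inv2 \<phi>)) (inv2 \<psi>))"
    by (intro wt_subst2_inv2 u)
  then show "wt 2 3 (n + (i + j)) (subst2 h (comm2 \<phi> \<psi>) - h)"
    using d by (simp add: subst2_comm2)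
qed

definition pw :: "ps2 \<times> ps2 \<Rightarrow> nat \<Rightarrow> ps2 \<times> ps2" where
  "pw \<phi> t = (comp2 \<phi> ^^ t) id2"

lemma pw_0 [simp]: "pw \<phi> 0 = id2" and pw_Suc [simp]: "pw \<phi> (Suc t) = comp2 \<phi> (pw \<phi> t)"
  by (simp_all add: pw_def)

lemma fixes0_pw [simp]: "fixes0 \<phi> \<Longrightarrow> fixes0 (pw \<phi> t)" and diff2_pw [simp]: "diff2 \<phi> \<Longrightarrow> diff2 (pw \<phi> t)"
  by (induction t) auto

lemma ufilt_pw: "ufilt i \<phi> \<Longrightarrow> 1 \<le> i \<Longrightarrow> ufilt i (pw \<phi> t)"
  by (induction t) (auto intro: ufilt_comp2)

lemma subst2_pw_commute:
  assumes "fixes0 \<phi>" "fixes0 a" "\<And>h. subst2 (subst2 h \<phi>) a = subst2 (subst2 h a) \<phi>"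
  shows "subst2 (subst2 h (pw \<phi> t)) a = subst2 (subst2 h a) (pw \<phi> t)"
  by (induction t arbitrary: h) (simp_all add: assms subst2_comp2)

lemma pw_inv2: assumes "diff2 \<phi>" shows "comp2 (pw \<phi> t) (pw (inv2 \<phi>) t) = id2"
proof -
  have "subst2 (subst2 h (pw \<phi> t)) (pw (inv2 \<phi>) t) = h" for h
  proof (induction t arbitrary: h)
    case (Suc t)
    have c: "subst2 (subst2 g (pw (inv2 \<phi>) t)) (inv2 \<phi>) = subst2 (subst2 g (inv2 \<phi>)) (pw (inv2 \<phi>) t)" for g
      by (rule subst2_pw_commute) (use assms in auto)
    have "subst2 (subst2 h (pw \<phi> (Suc t))) (pw (inv2 \<phi>) (Suc t))
        = subst2 (subst2 (subst2 (subst2 h \<phi>) (pw \<phi> t)) (pw (inv2 \<phi>) t)) (inv2 \<phi>)"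
      using assms by (simp add: subst2_comp2 c)
    then show ?case using Suc assms by simp
  qed simp
  then show ?thesis using assms by (intro comp2_eqI) (simp_all add: subst2_comp2)
qed

lemma inv2_pw: assumes "diff2 \<phi>" shows "pw (inv2 \<phi>) t = inv2 (pw \<phi> t)"
  using inv2_unique[of "pw (inv2 \<phi>) t" "pw \<phi> t"] pw_inv2[of "inv2 \<phi>" t] assms by simp

text \<open>
  Differences in \<open>t\<close> of the coefficients of \<open>h \<circ> \<phi>\<^sup>t\<close> are coefficients of \<open>(h \<circ> \<phi> - h) \<circ> \<phi>\<^sup>t\<close>, where
  \<open>h \<circ> \<phi> - h\<close> has larger weight. So iterated differences vanish and the coefficients are polynomials in \<open>t\<close>.
\<close>

lemma ufilt_has_der:
  assumes "ufilt 1 \<phi>" shows "\<exists>v. has_der (pw \<phi>) v"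
proof -
  have p: "fixes0 \<phi>" using assms unip_diff2 by simp
  have bc: "binomial_comb (\<lambda>t. coeff2 (subst2 h (pw \<phi> t)) i j)" if "wt 2 3 (2 * i + 3 * j + 1 - m) h" for h i j m
    using that
  proof (induction m arbitrary: h)
    case 0
    then have "coeff2 (subst2 h (pw \<phi> t)) i j = 0" for t
      using wtD[OF wt_subst2[OF ufilt_wt[OF ufilt_pw[OF assms, of t]]], of "2 * i + 3 * j + 1" h i j] by simp
    then show ?case unfolding binomial_comb_def by (intro exI[of _ "\<lambda>_. 0"]) auto
  next
    case (Suc m)
    show ?case
    proof (rule binomial_comb_antidiff)
      have "wt 2 3 (2 * i + 3 * j + 1 - Suc m + 1) (subst2 h \<phi> - h)"
        by (rule ufilt_subst2[OF assms Suc.prems])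
      then have "binomial_comb (\<lambda>t. coeff2 (subst2 (subst2 h \<phi> - h) (pw \<phi> t)) i j)"
        by (intro Suc.IH) (auto elim: wt_mono)
      then show "binomial_comb (\<lambda>t. coeff2 (subst2 h (pw \<phi> (Suc t))) i j - coeff2 (subst2 h (pw \<phi> t)) i j)"
        using p by (simp add: subst2_comp2)
    qed
  qed
  have "\<exists>c. has_lin (\<lambda>t. coeff2 (subst2 h (pw \<phi> t)) i j) c" for h i j
    using bc[of i j "2 * i + 3 * j + 1" h] binomial_comb_has_lin by simp
  then obtain c where c: "\<And>h i j. has_lin (\<lambda>t. coeff2 (subst2 h (pw \<phi> t)) i j) (c h i j)" by metis
  have "has_der (pw \<phi>) (mk_ps2 (c X2), mk_ps2 (c Y2))"
    by (rule has_derI[of "pw \<phi>" "\<lambda>h. mk_ps2 (c h)"]) (auto simp: slin_def c p)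
  then show ?thesis ..
qed

text \<open>The logarithm: the derivative of \<open>\<phi>\<^sup>t\<close> at \<open>t = 0\<close>.\<close>

definition log2 :: "ps2 \<times> ps2 \<Rightarrow> ps2 \<times> ps2" where
  "log2 \<phi> = (SOME v. has_der (pw \<phi>) v)"

lemma has_der_log2: "ufilt 1 \<phi> \<Longrightarrow> has_der (pw \<phi>) (log2 \<phi>)"
  unfolding log2_def using ufilt_has_der by (rule someI_ex)

lemma der_subst2_commute:
  assumes "has_der F v" "\<And>h t. subst2 (subst2 h a) (F t) = subst2 (subst2 h (F t)) a"
  shows "der v (subst2 h a) = subst2 (der v h) a"
  by (rule slin_unique[OF has_derD[OF assms(1)]]) (unfold assms(2), rule slin_subst2[OF has_derD[OF assms(1)]])

lemma der_der_commute:
  assumes "has_der F v" "\<And>h t. der w (subst2 h (F t)) = subst2 (der w h) (F t)"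
  shows "der w (der v h) = der v (der w h)"
  by (rule slin_unique[OF slin_der[OF has_derD[OF assms(1)]]]) (unfold assms(2), rule has_derD[OF assms(1)])

lemma log2_commute:
  assumes "ufilt 1 \<phi>" "ufilt 1 \<psi>" "comp2 \<phi> \<psi> = comp2 \<psi> \<phi>"
  shows "der (log2 \<phi>) (subst2 h \<psi>) = subst2 (der (log2 \<phi>) h) \<psi>" 
    and "der (log2 \<phi>) (der (log2 \<psi>) h) = der (log2 \<psi>) (der (log2 \<phi>) h)"
proof -
  have p: "fixes0 \<phi>" "fixes0 \<psi>" using assms unip_diff2 by auto
  have c: "subst2 (subst2 h \<phi>) \<psi> = subst2 (subst2 h \<psi>) \<phi>" for h
    using assms(3) p by (metis subst2_comp2)
  have 1: "der (log2 \<phi>) (subst2 h \<psi>) = subst2 (der (log2 \<phi>) h) \<psi>" for h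
    by (rule der_subst2_commute[OF has_der_log2[OF assms(1)]]) (rule subst2_pw_commute[OF p c, symmetric])
  have 2: "der (log2 \<phi>) (subst2 h (pw \<psi> t)) = subst2 (der (log2 \<phi>) h) (pw \<psi> t)" for h t
    by (induction t arbitrary: h) (simp_all add: subst2_comp2 p 1)
  show "der (log2 \<phi>) (subst2 h \<psi>) = subst2 (der (log2 \<phi>) h) \<psi>" by (rule 1)
  show "der (log2 \<phi>) (der (log2 \<psi>) h) = der (log2 \<psi>) (der (log2 \<phi>) h)"
    by (rule der_der_commute[OF has_der_log2[OF assms(2)] 2])
qed

lemma coeff_1_pcompose_shift: "coeff (pcompose p [:s, 1:]) 1 = poly (pderiv p) (s :: complex)"
proof -
  have "coeff (pcompose p [:s, 1:]) 1 = poly (pderiv (pcompose p [:s, 1:])) 0"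
    by (simp add: poly_0_coeff_0 coeff_pderiv One_nat_def)
  then show ?thesis by (simp add: pderiv_pcompose poly_pcompose pderiv_pCons)
qed

text \<open>
  A consequence of Taylor's formula \<open>h \<circ> \<phi> = (\<Sum>n. X\<^sup>n h / n!)\<close>, where \<open>X = log2 \<phi>\<close>: the coefficient of
  \<open>h \<circ> \<phi>\<^sup>t\<close> is a polynomial in \<open>t\<close> whose derivatives at \<open>0\<close> are the coefficients of \<open>X\<^sup>n h\<close>.
\<close>

lemma coeff2_taylor:
  assumes u: "ufilt 1 \<phi>" and z: "\<And>n. 1 \<le> n \<Longrightarrow> coeff2 ((der (log2 \<phi>) ^^ n) h) i j = 0"
  shows "coeff2 (subst2 h \<phi>) i j = coeff2 h i j"
proof -
  let ?v = "log2 \<phi>"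
  have p: "fixes0 \<phi>" using u unip_diff2 by simp
  have "\<exists>p. (\<forall>t. coeff2 (subst2 h (pw \<phi> t)) i j = poly p (of_nat t)) \<and> coeff p 1 = coeff2 (der ?v h) i j" for h
    using has_derD[OF has_der_log2[OF u], of h] unfolding slin_def has_lin_def by blast
  then obtain P where P: "\<And>h t. coeff2 (subst2 h (pw \<phi> t)) i j = poly (P h) (of_nat t)"
    and P1: "\<And>h. coeff (P h) 1 = coeff2 (der ?v h) i j"
    by metis
  have add: "subst2 h (pw \<phi> (s + t)) = subst2 (subst2 h (pw \<phi> s)) (pw \<phi> t)" for h s t
    by (induction s arbitrary: h) (simp_all add: subst2_comp2 p)
  have com: "der ?v (subst2 h (pw \<phi> s)) = subst2 (der ?v h) (pw \<phi> s)" for h s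
    by (rule der_subst2_commute[OF has_der_log2[OF u]]) (simp add: add.commute flip: add)
  \<comment> \<open>The flow equation: \<open>P h\<close> interpolates a coefficient of \<open>h \<circ> \<phi>\<^sup>t\<close>.\<close>
  have "pderiv (P h) = P (der ?v h)" for h
  proof (rule poly_eqI_nat)
    fix s
    have "P (subst2 h (pw \<phi> s)) = pcompose (P h) [:of_nat s, 1:]"
      by (rule poly_eqI_nat) (simp add: poly_pcompose flip: P add of_nat_add)
    then have "poly (pderiv (P h)) (of_nat s) = coeff2 (der ?v (subst2 h (pw \<phi> s))) i j"
      using P1[of "subst2 h (pw \<phi> s)"] by (simp add: coeff_1_pcompose_shift)
    then show "poly (pderiv (P h)) (of_nat s) = poly (P (der ?v h)) (of_nat s)" by (simp add: com P)
  qed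
  then have P_n: "(pderiv ^^ n) (P h) = P ((der ?v ^^ n) h)" for n h
    by (induction n) simp_all
  have "coeff (P h) n = 0" if "1 \<le> n" for n
  proof -
    have "coeff ((pderiv ^^ n) (P h)) 0 = poly (P ((der ?v ^^ n) h)) (of_nat 0)" unfolding P_n by (simp add: poly_0_coeff_0)
    also have "\<dots> = 0" unfolding P[symmetric] using z[OF that] by simp
    finally show ?thesis by (simp add: coeff_higher_pderiv flip: pochhammer_fact)
  qed
  then have "P h = [:coeff (P h) 0:]" by (intro poly_eqI) (auto simp: coeff_pCons split: nat.splits)
  then have "poly (P h) (of_nat 1) = poly (P h) (of_nat 0)" by (metis poly_const_conv)
  then show ?thesis using P[of h 1] P[of h 0] p by (simp add: One_nat_def)
qed

lemma wt_log2_imp: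
  assumes "ufilt 1 \<phi>" "wt p q n (fst (log2 \<phi>))" "wt p q n (snd (log2 \<phi>))"
  shows "wt p q n (subst2 h \<phi> - h)"
  unfolding wt_def
proof (intro allI impI)
  fix i j assume ij: "p * i + q * j < n"
  have "wt p q n (der (log2 \<phi>) g)" for g
    unfolding der_def by (intro wt_add wt_mult_right assms)
  then have "coeff2 ((der (log2 \<phi>) ^^ m) h) i j = 0" if "1 \<le> m" for m
    using that wtD[OF _ ij] by (cases m) auto
  then show "coeff2 (subst2 h \<phi> - h) i j = 0" using coeff2_taylor[OF assms(1)] by simp
qed

lemma wt_01_iff: "wt 0 1 1 f \<longleftrightarrow> (\<forall>i. coeff2 f i 0 = 0)"
  by (auto simp: wt_def)

lemma y_dvd_iff: "wt 0 1 1 f \<longleftrightarrow> Y2 dvd f"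
proof
  assume f: "wt 0 1 1 f"
  have "f = Y2 * mk_ps2 (\<lambda>i j. coeff2 f i (Suc j))"
    using f by (intro ps2_eqI) (auto simp: coeff2_Y2_mult wt_01_iff)
  then show "Y2 dvd f" by (metis dvd_triv_left)
qed (auto simp: wt_01_iff coeff2_Y2_mult)

lemma y_dvd_log2_imp:
  assumes "ufilt 1 \<phi>" "wt 0 1 1 (snd (log2 \<phi>))"
  shows "wt 0 1 1 (snd \<phi>)"
  unfolding wt_01_iff
proof
  fix i
  have "Y2 dvd snd (log2 \<phi>)" using assms(2) by (simp add: y_dvd_iff)
  then have "Y2 dvd der (log2 \<phi>) g" if "Y2 dvd g" for g
    using that by (auto elim!: dvdE)
  then have "Y2 dvd (der (log2 \<phi>) ^^ n) Y2" for n by (induction n) auto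
  then have "coeff2 ((der (log2 \<phi>) ^^ n) Y2) i 0 = 0" for n by (auto simp: wt_01_iff simp flip: y_dvd_iff)
  then have "coeff2 (subst2 Y2 \<phi>) i 0 = coeff2 Y2 i 0" by (intro coeff2_taylor[OF assms(1)])
  then show "coeff2 (snd \<phi>) i 0 = 0" using unip_diff2[OF assms(1)] by (simp add: coeff2_Y2)
qed

section \<open>Commuting vector fields\<close>

definition commute :: "ps2 \<times> ps2 \<Rightarrow> ps2 \<times> ps2 \<Rightarrow> bool" where
  "commute v w \<longleftrightarrow> (\<forall>h. der v (der w h) = der w (der v h))"

definition det2 :: "ps2 \<times> ps2 \<Rightarrow> ps2 \<times> ps2 \<Rightarrow> ps2" where
  "det2 v w = fst v * snd w - snd v * fst w"

text \<open>Divisibility by \<open>x\<^sup>s\<close>, for the coefficients of a series in \<open>y\<close>.\<close>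

definition xord :: "nat \<Rightarrow> complex fps \<Rightarrow> bool" where
  "xord s f \<longleftrightarrow> f = 0 \<or> s \<le> subdegree f"

lemma xord_iff: "xord s f \<longleftrightarrow> (\<forall>n<s. fps_nth f n = 0)"
  unfolding xord_def by (metis fps_zero_nth leI less_le_trans nth_less_subdegree_zero nth_subdegree_nonzero)

lemma xord_add: "xord s f \<Longrightarrow> xord s g \<Longrightarrow> xord s (f + g)"
  and xord_diff: "xord s f \<Longrightarrow> xord s g \<Longrightarrow> xord s (f - g)"
  and xord_mono: "xord s f \<Longrightarrow> t \<le> s \<Longrightarrow> xord t f"
  and xord_deriv: "xord (Suc s) f \<Longrightarrow> xord s (fps_deriv f)"
  by (auto simp: xord_iff One_nat_def)

lemma xord_mult: "xord s f \<Longrightarrow> xord s (g * f)"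
  by (cases "f = 0"; cases "g = 0") (auto simp: xord_def)

lemma xord_sum: "(\<And>a. a \<in> A \<Longrightarrow> xord s (f a)) \<Longrightarrow> xord s (sum f A)"
  by (induction A rule: infinite_finite_induct) (auto intro: xord_add simp: xord_def[of _ 0])

lemma xord_cancel: "g \<noteq> 0 \<Longrightarrow> xord (s + subdegree g) (g * f) \<Longrightarrow> xord s f"
  by (cases "f = 0") (auto simp: xord_def)

lemma fps_mult_nth_split_last: "fps_nth (f * g) m = f $ 0 * g $ m + (\<Sum>l<m. f $ (m - l) * g $ l)" for f g :: "'a::comm_ring_1 fps"
  unfolding fps_mult_nth atLeast0AtMost
  by (subst sum.nat_diff_reindex[symmetric, of _ "Suc m", unfolded lessThan_Suc_atMost])
    (simp add: lessThan_Suc_atMost[symmetric] add.commute)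

lemma fps_mult_nth_rev: "fps_nth (f * g) m = (\<Sum>l=0..m. f $ (m - l) * g $ l)" for f g :: "'a::comm_ring_1 fps"
  unfolding mult.commute[of f g] fps_mult_nth by (intro sum.cong) (auto simp: mult.commute)

lemma nth_dx: "dx f $ j = fps_deriv (f $ j)"
  by (simp add: dx_fps_deriv)

lemma nth_dy: "dy f $ j = of_nat (Suc j) * f $ Suc j"
  by (simp add: dy_fps_deriv One_nat_def)

text \<open>A solution \<open>B\<close> of this linear equation is determined by its restriction to \<open>y = 0\<close>, and
  a zero of high order of the restriction propagates to the other coefficients.\<close>

lemma first_integral_propagation:
  assumes Q: "Q $ 0 \<noteq> 0" and eq: "Q * Q * dy B = R * B - S * dx B"
  shows "xord (s + m * (1 + 2 * subdegree (Q $ 0))) (B $ 0) \<Longrightarrow> \<forall>j\<le>m. xord s (B $ j)"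
proof (induction m arbitrary: s)
  case (Suc m)
  let ?q = "subdegree (Q $ 0)"
  have "xord ((s + (1 + 2 * ?q)) + m * (1 + 2 * ?q)) (B $ 0)" using Suc.prems by (simp add: algebra_simps)
  then have IH: "xord (s + (1 + 2 * ?q)) (B $ j)" if "j \<le> m" for j using Suc.IH that by blast
  then have IH': "xord (s + 2 * ?q) (B $ j)" if "j \<le> m" for j using that xord_mono by fastforce
  have "(Q * Q) $ 0 * dy B $ m = (R * B - S * dx B) $ m - (\<Sum>l<m. (Q * Q) $ (m - l) * dy B $ l)"
    using fps_mult_nth_split_last[of "Q * Q" "dy B" m] unfolding eq by simp
  also have "\<dots> = (\<Sum>l=0..m. R $ (m - l) * B $ l) - (\<Sum>l=0..m. S $ (m - l) * fps_deriv (B $ l))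
      - (\<Sum>l<m. (Q * Q) $ (m - l) * (of_nat (Suc l) * B $ Suc l))"
    using fps_mult_nth_rev[of R B m] fps_mult_nth_rev[of S "dx B" m] by (simp only: fps_sub_nth nth_dx nth_dy)
  also have "xord (s + 2 * ?q) \<dots>"
  proof (intro xord_diff xord_sum xord_mult xord_deriv IH')
    show "xord (Suc (s + 2 * ?q)) (B $ l)" if "l \<in> {0..m}" for l
      using IH[of l] that by (simp add: One_nat_def)
  qed auto
  finally have "xord (s + 2 * ?q) ((of_nat (Suc m) * (Q $ 0 * Q $ 0)) * B $ Suc m)"
    by (simp add: nth_dy mult_ac del: of_nat_Suc)
  moreover have "subdegree (of_nat (Suc m) * (Q $ 0 * Q $ 0)) = 2 * ?q"
    using Q by (simp flip: fps_of_nat del: of_nat_Suc)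
  moreover have "of_nat (Suc m) * (Q $ 0 * Q $ 0) \<noteq> 0" using Q by (simp del: of_nat_Suc)
  ultimately have "xord s (B $ Suc m)" using xord_cancel by metis
  moreover have "xord s (B $ j)" if "j \<le> m" for j using IH'[OF that] xord_mono by fastforce
  ultimately show ?case using le_Suc_eq by auto
qed simp

text \<open>
  The quotient \<open>A = B P / Q\<close> inherits the zeros of high order of the coefficients of \<open>B\<close>, with a loss
  for each coefficient that is bounded by the order of \<open>Q\<close> on the axis.
\<close>

lemma quotient_propagation:
  assumes Q: "Q $ 0 \<noteq> 0" and eq: "A * Q = B * (P :: ps2)"
  shows "\<forall>j\<le>m. xord (s + m * subdegree (Q $ 0) + subdegree (Q $ 0)) (B $ j) \<Longrightarrow> \<forall>j\<le>m. xord s (A $ j)"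
proof (induction m arbitrary: s)
  case 0
  have "Q $ 0 * A $ 0 = P $ 0 * B $ 0" using arg_cong[OF eq, of "\<lambda>f. f $ 0"] by (simp add: mult.commute)
  then have "xord (s + subdegree (Q $ 0)) (Q $ 0 * A $ 0)" using 0 xord_mult by simp
  then show ?case using Q xord_cancel by simp
next
  case (Suc m)
  let ?q = "subdegree (Q $ 0)"
  have B: "xord (s + ?q) (B $ j)" if "j \<le> Suc m" for j
    using Suc.prems that by (auto elim!: xord_mono)
  have "\<forall>j\<le>m. xord (s + ?q) (A $ j)"
    by (rule Suc.IH) (use Suc.prems in \<open>auto elim!: xord_mono simp: algebra_simps\<close>)
  then have IH: "xord (s + ?q) (A $ j)" if "j \<le> m" for j using that by blast
  have "Q $ 0 * A $ Suc m = (P * B) $ Suc m - (\<Sum>l<Suc m. Q $ (Suc m - l) * A $ l)"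
    using eq fps_mult_nth_split_last[of Q A "Suc m"] by (simp add: algebra_simps)
  also have "\<dots> = (P $ 0 * B $ Suc m + (\<Sum>l<Suc m. P $ (Suc m - l) * B $ l)) - (\<Sum>l<Suc m. Q $ (Suc m - l) * A $ l)"
    by (simp only: fps_mult_nth_split_last)
  also have "xord (s + ?q) \<dots>"
    by (intro xord_diff xord_add xord_sum xord_mult B IH) auto
  finally have "xord s (A $ Suc m)" using Q xord_cancel by blast
  then show ?case using IH xord_mono le_Suc_eq by (metis le_add1)
qed

lemma wt_01_nth: "wt 0 1 1 f \<longleftrightarrow> f $ 0 = 0"
  by (auto simp: wt_01_iff coeff2_def fps_eq_iff)

lemma wt_1r_nth: "1 \<le> r \<Longrightarrow> wt 1 r r f \<longleftrightarrow> xord r (f $ 0)"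
proof -
  assume "1 \<le> r"
  have "1 * i + r * j < r \<longleftrightarrow> i < r \<and> j = 0" for i j by (cases j) auto
  then show ?thesis by (auto simp: wt_def xord_iff coeff2_def)
qed

lemma y_factor:
  obtains f' where "\<And>f. (\<forall>l<e. f $ l = 0) \<Longrightarrow> f = Y2 ^ e * f' f" "\<And>f :: ps2. f' f $ 0 = f $ e"
proof
  show "f = Y2 ^ e * fps_shift e f" if "\<forall>l<e. f $ l = 0" for f
  proof (rule ps2_eqI)
    fix i j
    show "coeff2 f i j = coeff2 (Y2 ^ e * fps_shift e f) i j"
      unfolding coeff2_Y2_power_mult using that by (auto simp: coeff2_def)
  qed
qed simp

text \<open>
  Let \<open>Z = y\<^sup>e (P, Q)\<close> with \<open>(P, Q)\<close> not divisible by \<open>y\<close>. A parallel field that commutes with \<open>Z\<close> is \<open>a Z\<close> with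
  \<open>Z a = 0\<close>; for its second component \<open>B\<close> this means \<open>y Q (P B\<^sub>x + Q B\<^sub>y) = (e Q\<^sup>2 + y (P Q\<^sub>x + Q Q\<^sub>y)) B\<close>. If \<open>Q\<close>
  vanishes on the axis, or if \<open>e > 0\<close>, then \<open>B\<close> vanishes on the axis. Otherwise \<open>B\<close> is determined by its
  restriction to the axis, and a zero of high order of the restriction propagates to the whole field.
\<close>

lemma parallel_field_contact:
  assumes Z: "Z \<noteq> 0"
  obtains r where "1 \<le> r"
    "\<And>v. commute Z v \<Longrightarrow> det2 Z v = 0 \<Longrightarrow> wt 1 r r (snd v) \<Longrightarrow>
       wt 0 1 1 (snd v) \<or> (wt 1 1 K (fst v) \<and> wt 1 1 K (snd v))"
proof (cases "snd Z = 0")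
  case True
  then have "fst Z \<noteq> 0" using Z by (auto simp: prod_eq_iff)
  then show ?thesis using that[of 1] True by (auto simp: det2_def)
next
  case False
  then have "\<exists>e. fst Z $ e \<noteq> 0 \<or> snd Z $ e \<noteq> 0" by (auto simp: fps_eq_iff)
  define e where "e = (LEAST e. fst Z $ e \<noteq> 0 \<or> snd Z $ e \<noteq> 0)"
  have e: "fst Z $ e \<noteq> 0 \<or> snd Z $ e \<noteq> 0" "\<And>l. l < e \<Longrightarrow> fst Z $ l = 0 \<and> snd Z $ l = 0"
    using LeastI_ex[OF \<open>\<exists>e. _\<close>] not_less_Least unfolding e_def by blast+
  obtain P Q where PQ: "fst Z = Y2 ^ e * P" "snd Z = Y2 ^ e * Q" "P $ 0 \<noteq> 0 \<or> Q $ 0 \<noteq> 0"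
    using y_factor[of e] e by metis
  have par: "fst v * Q = snd v * P" if "det2 Z v = 0" for v
    using that unfolding det2_def PQ by (simp add: algebra_simps)
  have eqn: "Y2 * Q * der (P, Q) (snd v) = (of_nat e * (Q * Q) + Y2 * der (P, Q) Q) * snd v"
    if v: "commute Z v" "det2 Z v = 0" for v
  proof -
    have Zd: "der Z g = Y2 ^ e * der (P, Q) g" for g unfolding der_def PQ by (simp add: algebra_simps PQ)
    have "snd v * der Z g = snd Z * der v g" for g
      using v(2) unfolding det2_def der_def by algebra
    moreover have "der Z (snd v) = der v (snd Z)"
      using v(1) unfolding commute_def by (metis der_Y2)
    ultimately have "snd Z * der Z (snd v) = der Z (snd Z) * snd v" by (metis mult.commute)
    then have "Y2 ^ e * (Y2 ^ e * (Q * der (P, Q) (snd v))) = Y2 ^ e * (der (P, Q) (Y2 ^ e * Q) * snd v)"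
      unfolding Zd PQ by (simp only: mult_ac)
    then have 1: "Y2 ^ e * (Q * der (P, Q) (snd v)) = der (P, Q) (Y2 ^ e * Q) * snd v" by simp
    have "Y2 * der (P, Q) (Y2 ^ e) = of_nat e * (Y2 ^ e * Q)"
      by (induction e) (auto simp: algebra_simps simp flip: const2_1)
    then have "Y2 * der (P, Q) (Y2 ^ e * Q) = Y2 ^ e * (of_nat e * (Q * Q) + Y2 * der (P, Q) Q)"
      by (simp only: der_mult distrib_left) (simp add: algebra_simps)
    then have "Y2 ^ e * (Y2 * Q * der (P, Q) (snd v)) = Y2 ^ e * ((of_nat e * (Q * Q) + Y2 * der (P, Q) Q) * snd v)"
      using 1 by (metis (no_types, opaque_lifting) mult.assoc mult.left_commute)
    then show ?thesis by simp
  qed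
  show ?thesis
  proof (cases "Q $ 0 = 0 \<or> e \<noteq> 0")
    case True
    show ?thesis
    proof (rule that[of 1])
      fix v assume v: "commute Z v" "det2 Z v = 0"
      show "wt 0 1 1 (snd v) \<or> (wt 1 1 K (fst v) \<and> wt 1 1 K (snd v))"
      proof (cases "Q $ 0 = 0")
        case True
        then show ?thesis using arg_cong[OF par[OF v(2)], of "\<lambda>f. f $ 0"] PQ(3) by (simp add: wt_01_nth)
      next
        case False
        then show ?thesis using arg_cong[OF eqn[OF v], of "\<lambda>f. f $ 0"] True by (simp add: wt_01_nth Y2_def)
      qed
    qed simp
  next
    case False
    then have Q: "Q $ 0 \<noteq> 0" and e0: "e = 0" by auto
    let ?q = "subdegree (Q $ 0)"
    \<comment> \<open>The losses of order in the two propagation steps: \<open>s\<close> is what \<open>A\<close> requires of \<open>B\<close>, and \<open>r\<close> what \<open>B\<close> requires of its restriction.\<close>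
    define s where "s = K + K * ?q + ?q"
    define r where "r = Suc (s + K * (1 + 2 * ?q))"
    show ?thesis
    proof (rule that[of r])
      fix v assume v: "commute Z v" "det2 Z v = 0" "wt 1 r r (snd v)"
      have "Y2 * (Q * Q * dy (snd v)) = Y2 * (der (P, Q) Q * snd v - Q * P * dx (snd v))"
        using eqn[OF v(1,2)] e0 unfolding der_def by (simp add: algebra_simps)
      then have *: "Q * Q * dy (snd v) = der (P, Q) Q * snd v - Q * P * dx (snd v)" by simp
      have "xord (s + K * (1 + 2 * ?q)) (snd v $ 0)" using v(3) by (auto simp: wt_1r_nth r_def elim: xord_mono)
      from first_integral_propagation[OF Q * this] have B: "\<forall>j\<le>K. xord s (snd v $ j)" .
      from quotient_propagation[OF Q par[OF v(2)] this[unfolded s_def]] have A: "\<forall>j\<le>K. xord K (fst v $ j)" .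
      have "wt 1 1 K (fst v)" "wt 1 1 K (snd v)" using A B by (auto simp: wt_def xord_iff coeff2_def s_def)
      then show "wt 0 1 1 (snd v) \<or> (wt 1 1 K (fst v) \<and> wt 1 1 K (snd v))" by simp
    qed (simp add: r_def)
  qed
qed

text \<open>Compare the leading coefficients of \<open>f X g'\<close> and \<open>g X f'\<close>.\<close>

lemma equal_log_derivative_subdegree:
  fixes f g :: "'a::{idom,semiring_char_0} fps"
  assumes "f * fps_deriv g = g * fps_deriv f" "f \<noteq> 0" "g \<noteq> 0" shows "subdegree f = subdegree g"
proof -
  have X: "fps_nth (f * (fps_X * fps_deriv g)) (subdegree f + subdegree g) = f $ subdegree f * (of_nat (subdegree g) * g $ subdegree g)" for f g :: "'a fps"
  proof -
    have Xg: "fps_nth (fps_X * fps_deriv g) l = of_nat l * g $ l" for l by (cases l) (auto simp: One_nat_def)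
    have "fps_nth (f * (fps_X * fps_deriv g)) (subdegree f + subdegree g)
      = (\<Sum>i=0..subdegree f + subdegree g. f $ i * (of_nat (subdegree f + subdegree g - i) * g $ (subdegree f + subdegree g - i)))"
      by (subst fps_mult_nth) (simp only: Xg)
    also have "\<dots> = (\<Sum>i=0..subdegree f + subdegree g. if i = subdegree f then f $ subdegree f * (of_nat (subdegree g) * g $ subdegree g) else 0)"
    proof (rule sum.cong)
      fix i assume i: "i \<in> {0..subdegree f + subdegree g}"
      consider "i < subdegree f" | "i = subdegree f" | "subdegree f < i" by linarith
      then show "f $ i * (of_nat (subdegree f + subdegree g - i) * g $ (subdegree f + subdegree g - i))
         = (if i = subdegree f then f $ subdegree f * (of_nat (subdegree g) * g $ subdegree g) else 0)"
      proof cases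
        case 3
        then have "g $ (subdegree f + subdegree g - i) = 0" using i by (intro nth_less_subdegree_zero) auto
        then show ?thesis using 3 by simp
      qed auto
    qed simp
    finally show ?thesis by simp
  qed
  have "f * (fps_X * fps_deriv g) = g * (fps_X * fps_deriv f)" using assms(1) by (simp add: mult.left_commute)
  then have "f $ subdegree f * (of_nat (subdegree g) * g $ subdegree g) = g $ subdegree g * (of_nat (subdegree f) * f $ subdegree f)"
    using X[of f g] X[of g f, unfolded add.commute[of "subdegree g"]] by metis
  then have "(f $ subdegree f * g $ subdegree g) * of_nat (subdegree g) = (f $ subdegree f * g $ subdegree g) * of_nat (subdegree f)"
    by (simp only: mult_ac)
  then show ?thesis using assms(2,3) by simp
qed

lemma equal_log_derivative_fps:
  fixes f g :: "complex fps"
  assumes "f * fps_deriv g = g * fps_deriv f" "f \<noteq> 0" shows "\<exists>c. g = fps_const c * f"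
proof -
  define c where "c = g $ subdegree f / f $ subdegree f"
  let ?h = "g - fps_const c * f"
  have "f * fps_deriv ?h = ?h * fps_deriv f" using assms(1) by (simp add: algebra_simps)
  moreover have "?h $ subdegree f = 0" using assms(2) by (simp add: c_def)
  ultimately have "?h = 0" using equal_log_derivative_subdegree[of f ?h] assms(2) nth_subdegree_nonzero[of ?h] by metis
  then have "g = fps_const c * f" by simp
  then show ?thesis ..
qed

text \<open>
  A series with the same logarithmic derivatives as \<open>J\<close> is a constant multiple of \<open>J\<close>. The constant can
  be read off from the coefficients of lowest degree in \<open>y\<close>; the difference satisfies the same
  equations and has no term of this degree.
\<close>

lemma equal_log_derivative:
  assumes x: "J * dx f = f * dx J" and y: "J * dy f = f * dy J" and J: "J \<noteq> 0"
  shows "\<exists>c. f = const2 c * J"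
proof -
  let ?n = "subdegree J"
  have *: "J $ ?n * fps_deriv (f $ ?n) = f $ ?n * fps_deriv (J $ ?n)"
  proof (cases "f = 0")
    case False
    then have n: "subdegree f = ?n"
      using equal_log_derivative_subdegree[of J f] y J by (simp add: dy_fps_deriv)
    have nth: "fps_nth (g * dx h) (?n + ?n) = g $ ?n * fps_deriv (h $ ?n)" if "subdegree g = ?n" "subdegree h = ?n" for g h
    proof -
      have "(\<Sum>i=0..?n + ?n. g $ i * fps_deriv (h $ (?n + ?n - i))) = (\<Sum>i=0..?n + ?n. if i = ?n then g $ ?n * fps_deriv (h $ ?n) else 0)"
      proof (rule sum.cong)
        fix i assume i: "i \<in> {0..?n + ?n}"
        consider "i < ?n" | "i = ?n" | "?n < i" by linarith
        then show "g $ i * fps_deriv (h $ (?n + ?n - i)) = (if i = ?n then g $ ?n * fps_deriv (h $ ?n) else 0)"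
        proof cases
          case 1 then show ?thesis using that nth_less_subdegree_zero[of i g] by simp
        next
          case 3
          then have "h $ (?n + ?n - i) = 0" using i that by (intro nth_less_subdegree_zero) auto
          then show ?thesis using 3 by simp
        qed auto
      qed simp
      then show ?thesis by (simp add: fps_mult_nth nth_dx)
    qed
    show ?thesis using arg_cong[OF x, of "\<lambda>h. h $ (?n + ?n)"] nth[of J f] nth[of f J] n by simp
  qed simp
  moreover have "J $ ?n \<noteq> 0" using J by simp
  ultimately obtain c where c: "f $ ?n = fps_const c * J $ ?n" using equal_log_derivative_fps by blast
  let ?h = "f - const2 c * J"
  have "J * dy ?h = ?h * dy J" using y by (simp add: algebra_simps)
  moreover have "?h $ ?n = 0" using c by (simp add: const2_def)
  ultimately have "?h = 0" using equal_log_derivative_subdegree[of J ?h] J nth_subdegree_nonzero[of ?h]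
    unfolding dy_fps_deriv by metis
  then have "f = const2 c * J" by simp
  then show ?thesis ..
qed

lemma det2_cramer:
  assumes "m * fst v + n * fst w = 0" "m * snd v + n * snd w = 0" "det2 v w \<noteq> 0"
  shows "m = 0" "n = 0"
proof -
  have "m * det2 v w = snd w * (m * fst v + n * fst w) - fst w * (m * snd v + n * snd w)"
    "n * det2 v w = fst v * (m * snd v + n * snd w) - snd v * (m * fst v + n * fst w)"
    by (simp_all add: det2_def algebra_simps)
  then have "m * det2 v w = 0" "n * det2 v w = 0" using assms(1,2) by simp_all
  then show "m = 0" "n = 0" using assms(3) by auto
qed

text \<open>Two commuting independent fields have no nonconstant common first integrals, so the fields
  commuting with both are their combinations with constant coefficients.\<close>

lemma commute_frame:
  assumes ZX: "commute Z X" and vZ: "commute Z v" and vX: "commute X v" and J: "det2 Z X \<noteq> 0"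
  obtains c d where "v = (const2 c * fst Z, const2 c * snd Z) + (const2 d * fst X, const2 d * snd X)"
proof -
  let ?J = "det2 Z X"
  let ?\<alpha> = "det2 v X" and ?\<beta> = "det2 Z v"
  have Jv: "?J * der v h = ?\<alpha> * der Z h + ?\<beta> * der X h" for h
    by (simp add: det2_def der_def algebra_simps)
  \<comment> \<open>The Cramer coefficients \<open>?\<alpha> / ?J\<close> and \<open>?\<beta> / ?J\<close> are first integrals of every \<open>D\<close> that commutes with the three fields.\<close>
  have first: "?J * der D ?\<alpha> = ?\<alpha> * der D ?J" "?J * der D ?\<beta> = ?\<beta> * der D ?J"
    if D: "commute D Z" "commute D X" "commute D v" for D
  proof -
    define m n where "m = der D ?J * ?\<alpha> - ?J * der D ?\<alpha>" and "n = der D ?J * ?\<beta> - ?J * der D ?\<beta>"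
    have "m * der Z h + n * der X h = 0" for h
    proof -
      have "der D (?J * der v h) = der D (?\<alpha> * der Z h + ?\<beta> * der X h)" by (simp only: Jv)
      then have "der D ?J * der v h + ?J * der v (der D h)
         = der D ?\<alpha> * der Z h + ?\<alpha> * der Z (der D h) + (der D ?\<beta> * der X h + ?\<beta> * der X (der D h))"
        using D[unfolded commute_def, THEN spec] by (simp only: der_mult der_add)
      then have "der D ?J * der v h = der D ?\<alpha> * der Z h + der D ?\<beta> * der X h"
        unfolding Jv[of "der D h"] by (simp add: algebra_simps)
      then have "der D ?J * (?J * der v h) = ?J * (der D ?\<alpha> * der Z h + der D ?\<beta> * der X h)" by (simp add: mult.left_commute)
      then show ?thesis unfolding Jv m_def n_def by (simp add: algebra_simps)
    qed
    from this[of X2] this[of Y2] have "m = 0" "n = 0" using det2_cramer[OF _ _ J, of m n] by (simp_all only: der_X2 der_Y2)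
    then show "?J * der D ?\<alpha> = ?\<alpha> * der D ?J" "?J * der D ?\<beta> = ?\<beta> * der D ?J" unfolding m_def n_def by (simp_all add: mult.commute)
  qed
  have const: "\<exists>c. f = const2 c * ?J"
    if f: "?J * der Z f = f * der Z ?J" "?J * der X f = f * der X ?J" for f
  proof -
    define m n where "m = ?J * dx f - f * dx ?J" and "n = ?J * dy f - f * dy ?J"
    have 1: "fst Z * m + snd Z * n = 0" "fst X * m + snd X * n = 0"
    proof -
      have "fst v * m + snd v * n = ?J * der v f - f * der v ?J" for v
        unfolding m_def n_def der_def by (simp add: algebra_simps)
      then show "fst Z * m + snd Z * n = 0" "fst X * m + snd X * n = 0" using f by simp_all
    qed
    have "?J * m = snd X * (fst Z * m + snd Z * n) - snd Z * (fst X * m + snd X * n)"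
      "?J * n = fst Z * (fst X * m + snd X * n) - fst X * (fst Z * m + snd Z * n)"
      by (simp_all add: det2_def algebra_simps)
    then have "?J * m = 0" "?J * n = 0" using 1 by simp_all
    then have "m = 0" "n = 0" using J by auto
    then show ?thesis using equal_log_derivative[OF _ _ J, of f] unfolding m_def n_def by simp
  qed
  have sym: "commute Z Z" "commute X X" "commute X Z" using ZX unfolding commute_def by metis+
  note Z = first[OF sym(1) ZX vZ] and X = first[OF sym(3,2) vX]
  obtain c where c: "?\<alpha> = const2 c * ?J" using const[OF Z(1) X(1)] ..
  obtain d where d: "?\<beta> = const2 d * ?J" using const[OF Z(2) X(2)] ..
  have "?J * der v h = ?J * (const2 c * der Z h + const2 d * der X h)" for h
    unfolding Jv c d by (simp add: algebra_simps)
  then have *: "der v h = const2 c * der Z h + const2 d * der X h" for h using J by simp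
  show ?thesis by (rule that[of c d]) (use *[of X2] *[of Y2] in \<open>simp add: prod_eq_iff\<close>)
qed


section \<open>Contact of unipotent groups with the axis\<close>

text \<open>The subgroups of \<^const>\<open>formal_Diff\<close>, in terms of \<^const>\<open>comp2\<close> and \<^const>\<open>inv2\<close>.\<close>

definition diff_group :: "(ps2 \<times> ps2) set \<Rightarrow> bool" where
  "diff_group H \<longleftrightarrow> (\<forall>\<phi>\<in>H. diff2 \<phi> \<and> inv2 \<phi> \<in> H) \<and> id2 \<in> H \<and> (\<forall>\<phi>\<in>H. \<forall>\<psi>\<in>H. comp2 \<phi> \<psi> \<in> H)"

lemma diff_groupD:
  assumes "diff_group H"
  shows "\<phi> \<in> H \<Longrightarrow> diff2 \<phi>" "\<phi> \<in> H \<Longrightarrow> inv2 \<phi> \<in> H" "id2 \<in> H" "\<phi> \<in> H \<Longrightarrow> \<psi> \<in> H \<Longrightarrow> comp2 \<phi> \<psi> \<in> H"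
  using assms by (auto simp: diff_group_def)

lemma diff_group_comm2: "diff_group H \<Longrightarrow> \<phi> \<in> H \<Longrightarrow> \<psi> \<in> H \<Longrightarrow> comm2 \<phi> \<psi> \<in> H"
  and diff_group_pw: "diff_group H \<Longrightarrow> \<phi> \<in> H \<Longrightarrow> pw \<phi> t \<in> H"
  unfolding comm2_def conj2_def by (blast intro: diff_groupD, induction t) (auto intro: diff_groupD)

text \<open>Finite determination: the \<open>k\<close>-jet is injective on \<open>H\<close>.\<close>

definition jet_faithful :: "nat \<Rightarrow> (ps2 \<times> ps2) set \<Rightarrow> bool" where
  "jet_faithful k H \<longleftrightarrow> (\<forall>\<phi>\<in>H. wt 1 1 (Suc k) (fst \<phi> - X2) \<longrightarrow> wt 1 1 (Suc k) (snd \<phi> - Y2) \<longrightarrow> \<phi> = id2)"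

lemma jet_faithful_ufilt:
  assumes "jet_faithful k H" "\<phi> \<in> H" "ufilt (3 * k + 3) \<phi>" shows "\<phi> = id2"
proof -
  have "wt 1 1 (Suc k) h" if "wt 2 3 n h" "3 * k + 3 \<le> n" for h n
    using that by (auto simp: wt_def)
  then show ?thesis using assms unfolding jet_faithful_def ufilt_def by (metis le_add2)
qed

lemma wt_1r_subst2:
  assumes "fixes0 \<phi>" "1 \<le> r" "wt 1 r r (snd \<phi>)" "wt 1 r n f" shows "wt 1 r n (subst2 f \<phi>)"
proof (rule wt_subst2[OF _ assms(3,4)])
  show "wt 1 r 1 (fst \<phi>)" using assms(1,2) by (auto simp: wt_def fixes0_def max_ideal_def)
qed

lemma wt_1r_Y2: "wt 1 r r Y2"
  by (auto simp: wt_def coeff2_Y2)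

lemma wt_1r_comp2:
  "fixes0 \<phi> \<Longrightarrow> fixes0 \<psi> \<Longrightarrow> 1 \<le> r \<Longrightarrow> wt 1 r r (snd \<phi>) \<Longrightarrow> wt 1 r r (snd \<psi>) \<Longrightarrow> wt 1 r r (snd (comp2 \<phi> \<psi>))"
  by (simp add: comp2_def wt_1r_subst2)

lemma wt_1r_pw: "fixes0 \<phi> \<Longrightarrow> 1 \<le> r \<Longrightarrow> wt 1 r r (snd \<phi>) \<Longrightarrow> wt 1 r r (snd (pw \<phi> t))"
  by (induction t) (auto intro: wt_1r_comp2 wt_1r_Y2)

text \<open>The condition \<open>\<phi>\<^sub>2(x,0) = O(x\<^sup>r)\<close> holds for all powers of \<open>\<phi>\<close>, hence for their derivative.\<close>

lemma wt_1r_log2: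
  assumes "ufilt 1 \<phi>" "1 \<le> r" "wt 1 r r (snd \<phi>)" shows "wt 1 r r (snd (log2 \<phi>))"
proof -
  have p: "fixes0 \<phi>" using assms unip_diff2 by simp
  have "slin (\<lambda>t. snd (pw \<phi> t)) (snd (log2 \<phi>))" using has_derD[OF has_der_log2[OF assms(1)], of Y2] p by simp
  then show ?thesis by (rule slin_wt) (rule wt_1r_pw[OF p assms(2,3)])
qed

lemma wt_01_imp_1r: "1 \<le> r \<Longrightarrow> wt 0 1 1 f \<Longrightarrow> wt 1 r r f"
  by (simp add: wt_01_nth wt_1r_nth xord_def)

lemma wt_1r_mono: "1 \<le> r \<Longrightarrow> r \<le> s \<Longrightarrow> wt 1 s s f \<Longrightarrow> wt 1 r r f"
  by (simp add: wt_1r_nth xord_mono)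

definition scale2 :: "complex \<Rightarrow> ps2 \<times> ps2 \<Rightarrow> ps2 \<times> ps2" where
  "scale2 c v = (const2 c * fst v, const2 c * snd v)"

lemma der_scale_field: "der (scale2 c v) h = const2 c * der v h"
  by (simp add: der_def scale2_def algebra_simps)

lemma der_zero_field: "der 0 h = 0"
  by (simp add: der_def)

interpretation fields: vector_space scale2
  by unfold_locales (auto simp: scale2_def algebra_simps const2_hom prod_eq_iff)

text \<open>The orders of the nonzero elements of a finite-dimensional space of series are bounded.\<close>

lemma finite_span_contact_bounded:
  assumes "finite S"
  shows "\<exists>r\<ge>1. \<forall>v\<in>fields.span S. wt 1 r r (snd v) \<longrightarrow> wt 0 1 1 (snd v)"
  using assms
proof (induction S)
  case empty
  show ?case by (intro exI[of _ 1]) auto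
next
  case (insert s S)
  then obtain r where r: "1 \<le> r" "\<And>v. v \<in> fields.span S \<Longrightarrow> wt 1 r r (snd v) \<Longrightarrow> wt 0 1 1 (snd v)" by auto
  show ?case
  proof (cases "\<exists>v. v - s \<in> fields.span S \<and> wt 1 r r (snd v) \<and> \<not> wt 0 1 1 (snd v)")
    case True
    \<comment> \<open>Two elements of \<open>s + span S\<close> differ by an element of \<open>span S\<close>, so at most one class modulo the fields tangent to the axis has order larger than \<open>r\<close>.\<close>
    then obtain v0 where v0: "v0 - s \<in> fields.span S" "wt 1 r r (snd v0)" "\<not> wt 0 1 1 (snd v0)" by blast
    then obtain i where i: "snd v0 $ 0 $ i \<noteq> 0" by (auto simp: wt_01_nth fps_eq_iff)
    define r' where "r' = max r (Suc i)"
    have r': "1 \<le> r'" "r \<le> r'" "\<not> wt 1 r' r' (snd v0)" using r(1) i by (auto simp: r'_def wt_1r_nth xord_iff intro!: exI[of _ i])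
    show ?thesis
    proof (intro exI[of _ r'] conjI ballI impI)
      fix v assume v: "v \<in> fields.span (insert s S)" and w: "wt 1 r' r' (snd v)"
      obtain k where k: "v - scale2 k s \<in> fields.span S" using v by (auto simp: fields.span_insert)
      have "(v - scale2 k s) - scale2 k (v0 - s) \<in> fields.span S" by (intro fields.span_diff fields.span_scale k v0)
      also have "(v - scale2 k s) - scale2 k (v0 - s) = v - scale2 k v0" by (simp add: scale2_def prod_eq_iff algebra_simps)
      finally have "v - scale2 k v0 \<in> fields.span S" .
      moreover have "wt 1 r r (snd (v - scale2 k v0))"
        using wt_1r_mono[OF r(1) r'(2) w] v0(2) by (simp add: scale2_def wt_diff wt_mult_left)
      ultimately have z: "wt 0 1 1 (snd v - const2 k * snd v0)" using r(2) by (fastforce simp: scale2_def)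
      show "wt 0 1 1 (snd v)"
      proof (cases "k = 0")
        case False
        have "wt 1 r' r' (const2 k * snd v0)" using wt_diff[OF w wt_01_imp_1r[OF r'(1) z]] by simp
        then have "wt 1 r' r' (const2 (1 / k) * (const2 k * snd v0))" by (rule wt_mult_left)
        then show ?thesis using r'(3) False by (simp flip: mult.assoc const2_hom)
      qed (use z in simp)
    qed (use r' in auto)
  next
    case False
    show ?thesis
    proof (intro exI[of _ r] conjI ballI impI r(1))
      fix v assume v: "v \<in> fields.span (insert s S)" and w: "wt 1 r r (snd v)"
      obtain k where k: "v - scale2 k s \<in> fields.span S" using v by (auto simp: fields.span_insert)
      show "wt 0 1 1 (snd v)"
      proof (cases "k = 0")
        case True
        then show ?thesis using r(2)[of v] k w by simp
      next
        case k0: False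
        have "scale2 (1 / k) (v - scale2 k s) \<in> fields.span S" by (rule fields.span_scale[OF k])
        then have "scale2 (1 / k) v - s \<in> fields.span S" using k0 by (simp add: fields.scale_right_diff_distrib)
        moreover have "wt 1 r r (snd (scale2 (1 / k) v))" using w by (simp add: scale2_def wt_mult_left)
        ultimately have "wt 0 1 1 (snd (scale2 (1 / k) v))" using False by blast
        then have "wt 0 1 1 (const2 k * (const2 (1 / k) * snd v))" by (auto simp: scale2_def intro: wt_mult_left)
        then show ?thesis using k0 by (simp flip: mult.assoc const2_hom)
      qed
    qed
  qed
qed

text \<open>
  The kernel of \<open>T\<^sup>c\<^sup>+\<^sup>1\<close> is mapped by \<open>T\<close> into the kernel of \<open>T\<^sup>c\<close>; its dimension exceeds that of its image
  by at most the dimension of the kernel of \<open>T\<close>.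
\<close>

lemma (in vector_space) finite_span_iterated_kernel:
  assumes lin: "Vector_Spaces.linear scale scale T" and C: "subspace C" "\<And>v. v \<in> C \<Longrightarrow> T v \<in> C"
    and S: "finite S" "\<And>v. v \<in> C \<Longrightarrow> T v = 0 \<Longrightarrow> v \<in> span S"
  shows "\<exists>S'. finite S' \<and> (\<forall>v\<in>C. (T ^^ c) v = 0 \<longrightarrow> v \<in> span S')"
proof (induction c)
  case 0
  then show ?case by (intro exI[of _ "{}"]) auto
next
  case (Suc c)
  interpret T: Vector_Spaces.linear scale scale T by (rule lin)
  from Suc obtain S' where S': "finite S'" "\<And>v. v \<in> C \<Longrightarrow> (T ^^ c) v = 0 \<Longrightarrow> v \<in> span S'" by blast
  define U where "U = {v \<in> C. (T ^^ Suc c) v = 0}"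
  obtain B where B: "B \<subseteq> T ` U" "independent B" "T ` U \<subseteq> span B" using basis_exists by metis
  have "T ` U \<subseteq> span S'" using S'(2) C(2) by (auto simp: U_def funpow_swap1)
  then have "finite B" using independent_span_bound[OF S'(1) B(2)] B(1) by blast
  then obtain B' where B': "finite B'" "B' \<subseteq> U" "B = T ` B'" using finite_subset_image[OF _ B(1)] by blast
  show ?case
  proof (intro exI[of _ "S \<union> B'"] conjI ballI impI)
    fix v assume v: "v \<in> C" "(T ^^ Suc c) v = 0"
    then have "T v \<in> span (T ` B')" using B B'(3) by (auto simp: U_def)
    then obtain w where w: "w \<in> span B'" "T v = T w" using T.span_image by (metis imageE)
    have "span B' \<subseteq> C" using B'(2) by (intro span_minimal C) (auto simp: U_def)
    then have "v - w \<in> C" using w v C(1) subspace_diff by blast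
    then have "v - w \<in> span S" using S(2) w(2) by (simp add: T.diff)
    then have "(v - w) + w \<in> span (S \<union> B')"
      using w(1) span_mono[of S "S \<union> B'"] span_mono[of B' "S \<union> B'"] by (intro span_add) auto
    then show "v \<in> span (S \<union> B')" by simp
  qed (use S(1) B' in auto)
qed

lemma has_der_id2: "has_der (\<lambda>_. id2) 0"
  using slin_const by (simp add: has_der_def der_def)

lemma has_der_pw_inv2:
  assumes "ufilt 1 \<phi>" shows "has_der (\<lambda>t. inv2 (pw \<phi> t)) (- log2 \<phi>)"
proof -
  have u: "ufilt 1 (inv2 \<phi>)" using ufilt_inv2[OF assms] by simp
  have d: "diff2 \<phi>" using assms unip_diff2 by simp
  have "has_der (\<lambda>t. comp2 (pw \<phi> t) (pw (inv2 \<phi>) t)) (log2 \<phi> + log2 (inv2 \<phi>))"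
    by (intro has_der_comp2 has_der_log2 assms u)
  then have "has_der (\<lambda>t. id2) (log2 \<phi> + log2 (inv2 \<phi>))" unfolding pw_inv2[OF d] .
  then have "log2 \<phi> + log2 (inv2 \<phi>) = 0" using has_der_unique has_der_id2 by blast
  then have "log2 (inv2 \<phi>) = - log2 \<phi>" by (simp add: eq_neg_iff_add_eq_0 add.commute)
  moreover have "pw (inv2 \<phi>) = (\<lambda>t. inv2 (pw \<phi> t))" using inv2_pw[OF d] by blast
  ultimately show ?thesis using has_der_log2[OF u] by simp
qed

lemma inv2_comp2: "diff2 a \<Longrightarrow> diff2 b \<Longrightarrow> inv2 (comp2 a b) = comp2 (inv2 b) (inv2 a)"
  using group.inv_mult_group[OF group_formal_Diff, of a b] by (simp add: inv2_def)

lemma inv2_comm2: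
  assumes "diff2 a" "diff2 \<psi>" shows "inv2 (comm2 a \<psi>) = comp2 \<psi> (conj2 a (inv2 \<psi>))"
  using assms by (simp add: comm2_def conj2_def inv2_comp2 comp2_assoc)

lemma Ad_minus: "Ad a (- v) = - Ad a v"
  by (simp add: Ad_def der_minus_field)

definition AdT :: "ps2 \<times> ps2 \<Rightarrow> ps2 \<times> ps2 \<Rightarrow> ps2 \<times> ps2" where "AdT a v = Ad a v - v"

lemma has_der_comm2:
  assumes "diff2 a" "\<And>t. diff2 (F t)" "has_der F v" "has_der (\<lambda>t. inv2 (F t)) (- v)"
  shows "has_der (\<lambda>t. comm2 a (F t)) (AdT a v)" "has_der (\<lambda>t. inv2 (comm2 a (F t))) (- AdT a v)"
proof -
  show "has_der (\<lambda>t. comm2 a (F t)) (AdT a v)"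
    using has_der_comp2[OF has_der_conj2[OF assms(1,3)] assms(4)] by (simp add: comm2_def AdT_def)
  show "has_der (\<lambda>t. inv2 (comm2 a (F t))) (- AdT a v)"
    using has_der_comp2[OF assms(3) has_der_conj2[OF assms(1,4)]] assms(1,2) by (simp add: inv2_comm2 AdT_def Ad_minus)
qed

text \<open>In a unipotent group with trivial \<open>k\<close>-jet kernel the iterated commutators with \<open>a\<close> are
  eventually trivial. Applied to \<open>\<phi>\<^sup>t\<close>, whose coefficients are polynomials in \<open>t\<close>, the linear terms give
  nilpotency on the logarithms.\<close>

lemma AdT_nilpotent:
  assumes N: "diff_group N" "\<And>\<phi>. \<phi> \<in> N \<Longrightarrow> ufilt 1 \<phi>" "jet_faithful k N" and "a \<in> N" "\<phi> \<in> N"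
  shows "(AdT a ^^ (3 * k + 3)) (log2 \<phi>) = 0"
proof -
  have "\<exists>F. (\<forall>t. F t \<in> N \<and> ufilt (Suc m) (F t)) \<and> has_der F ((AdT a ^^ m) (log2 \<phi>)) \<and> has_der (\<lambda>t. inv2 (F t)) (- (AdT a ^^ m) (log2 \<phi>))" for m
  proof (induction m)
    case 0
    have u: "ufilt 1 \<phi>" using N(2) assms(5) by blast
    show ?case
      using diff_group_pw[OF N(1) assms(5)] ufilt_pw[OF u] has_der_log2[OF u] has_der_pw_inv2[OF u]
      by (intro exI[of _ "pw \<phi>"]) (simp flip: One_nat_def)
  next
    case (Suc m)
    then obtain F where F: "\<And>t. F t \<in> N" "\<And>t. ufilt (Suc m) (F t)" "has_der F ((AdT a ^^ m) (log2 \<phi>))"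
      "has_der (\<lambda>t. inv2 (F t)) (- (AdT a ^^ m) (log2 \<phi>))" by blast
    have d: "diff2 a" "\<And>t. diff2 (F t)" using diff_groupD(1)[OF N(1)] assms(4) F(1) by auto
    have "ufilt (1 + Suc m) (comm2 a (F t))" for t
      by (rule ufilt_comm2[OF N(2)[OF assms(4)] _ F(2)]) auto
    then show ?case
      using has_der_comm2[OF d F(3,4)] diff_group_comm2[OF N(1) assms(4) F(1)]
      by (intro exI[of _ "\<lambda>t. comm2 a (F t)"]) (auto simp: plus_1_eq_Suc)
  qed
  from this[of "3 * k + 3"] obtain F where F: "\<And>t. F t \<in> N" "\<And>t. ufilt (Suc (3 * k + 3)) (F t)"
    "has_der F ((AdT a ^^ (3 * k + 3)) (log2 \<phi>))" by blast
  have "F t = id2" for t using jet_faithful_ufilt[OF N(3) F(1)] ufilt_mono[OF F(2), of "3 * k + 3"] by simp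
  then have "F = (\<lambda>_. id2)" by blast
  then show ?thesis using F(3) has_der_id2 has_der_unique by blast
qed

text \<open>
  An element \<open>\<zeta> \<noteq> 1\<close> as deep as possible in the filtration is central, since its commutators are
  deeper.
\<close>

lemma nontrivial_center:
  assumes N: "diff_group N" "\<And>\<phi>. \<phi> \<in> N \<Longrightarrow> ufilt 1 \<phi>" "jet_faithful k N" and "N \<noteq> {id2}"
  obtains \<zeta> where "\<zeta> \<in> N" "\<zeta> \<noteq> id2" "\<And>\<phi>. \<phi> \<in> N \<Longrightarrow> comp2 \<zeta> \<phi> = comp2 \<phi> \<zeta>"
proof -
  let ?P = "\<lambda>i. \<exists>\<zeta>\<in>N. \<zeta> \<noteq> id2 \<and> ufilt i \<zeta>"
  have 1: "?P 1" using assms diff_groupD(3)[OF N(1)] by blast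
  have b: "i \<le> 3 * k + 3" if "?P i" for i
    using that jet_faithful_ufilt[OF N(3)] ufilt_mono by (meson nat_le_linear)
  define i where "i = (GREATEST i. ?P i)"
  have "?P i" unfolding i_def using GreatestI_nat[of ?P, OF 1] b by blast
  then obtain \<zeta> where \<zeta>: "\<zeta> \<in> N" "\<zeta> \<noteq> id2" "ufilt i \<zeta>" by blast
  have le: "j \<le> i" if "?P j" for j unfolding i_def using Greatest_le_nat[of ?P, OF that] b by blast
  have i1: "1 \<le> i" using le[OF 1] .
  have "comp2 \<zeta> \<phi> = comp2 \<phi> \<zeta>" if "\<phi> \<in> N" for \<phi>
  proof -
    have "ufilt (i + 1) (comm2 \<zeta> \<phi>)" using ufilt_comm2[OF \<zeta>(3) i1 N(2)[OF that]] by simp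
    moreover have "\<not> ?P (i + 1)" using le[of "i + 1"] by auto
    ultimately have "comm2 \<zeta> \<phi> = id2" using diff_group_comm2[OF N(1) \<zeta>(1) that] by blast
    then show ?thesis using comm2_eq_id2_iff diff_groupD(1)[OF N(1)] \<zeta>(1) that by blast
  qed
  then show ?thesis using that \<zeta> by blast
qed

lemma subspace_commute: "fields.subspace {v. commute Z v}"
  using der_const2[of Z 0] by (intro fields.subspaceI) (simp_all add: commute_def der_add_field der_scale_field der_zero_field)

text \<open>
  If all logarithms are parallel to the logarithm \<open>Z\<close> of a central element, the claim is
  \<open>parallel_field_contact\<close>. Otherwise the logarithms lie in an iterated kernel of \<open>Ad a - 1\<close> on the fields that commute
  with \<open>Z\<close>, where the kernel itself is spanned by \<open>Z\<close> and the logarithm of \<open>a\<close>.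
\<close>

lemma unipotent_contact_bounded:
  assumes N: "diff_group N" "\<And>\<phi>. \<phi> \<in> N \<Longrightarrow> ufilt 1 \<phi>" "jet_faithful k N"
  shows "\<exists>r\<ge>1. \<forall>\<phi>\<in>N. wt 1 r r (snd \<phi>) \<longrightarrow> wt 0 1 1 (snd \<phi>)"
proof (cases "N = {id2}")
  case True
  then show ?thesis by (intro exI[of _ 1]) (auto simp: wt_def coeff2_Y2)
next
  case False
  obtain \<zeta> where \<zeta>: "\<zeta> \<in> N" "\<zeta> \<noteq> id2" "\<And>\<phi>. \<phi> \<in> N \<Longrightarrow> comp2 \<zeta> \<phi> = comp2 \<phi> \<zeta>"
    using nontrivial_center[OF N False] by blast
  define Z where "Z = log2 \<zeta>"
  have com: "commute Z (log2 \<phi>)" if "\<phi> \<in> N" for \<phi>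
    unfolding commute_def Z_def using log2_commute(2)[OF N(2) N(2) \<zeta>(3)] \<zeta>(1) that by blast
  have Z0: "Z \<noteq> 0"
  proof
    assume "Z = 0"
    then have "wt 1 1 n (subst2 h \<zeta> - h)" for n h using wt_log2_imp[OF N(2)[OF \<zeta>(1)]] by (simp add: Z_def)
    then have "subst2 h \<zeta> = h" for h by (rule wt_eqI)
    from this[of X2] this[of Y2] have "\<zeta> = id2" using diff_groupD(1)[OF N(1) \<zeta>(1)] by (simp add: prod_eq_iff)
    then show False using \<zeta>(2) by simp
  qed
  show ?thesis
  proof (cases "\<forall>\<phi>\<in>N. det2 Z (log2 \<phi>) = 0")
    case True
    obtain r where r: "1 \<le> r" "\<And>v. commute Z v \<Longrightarrow> det2 Z v = 0 \<Longrightarrow> wt 1 r r (snd v) \<Longrightarrow>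
       wt 0 1 1 (snd v) \<or> (wt 1 1 (Suc k) (fst v) \<and> wt 1 1 (Suc k) (snd v))"
      using parallel_field_contact[OF Z0] by metis
    show ?thesis
    proof (intro exI[of _ r] conjI ballI impI r(1))
      fix \<phi> assume \<phi>: "\<phi> \<in> N" "wt 1 r r (snd \<phi>)"
      have u: "ufilt 1 \<phi>" using N(2) \<phi>(1) by blast
      consider "wt 0 1 1 (snd (log2 \<phi>))" | "wt 1 1 (Suc k) (fst (log2 \<phi>))" "wt 1 1 (Suc k) (snd (log2 \<phi>))"
        using r(2)[OF com[OF \<phi>(1)] _ wt_1r_log2[OF u r(1) \<phi>(2)]] True \<phi>(1) by blast
      then show "wt 0 1 1 (snd \<phi>)"
      proof cases
        case 1 then show ?thesis using y_dvd_log2_imp[OF u] by blast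
      next
        case 2
        have "\<phi> = id2" using wt_log2_imp[OF u 2, of X2] wt_log2_imp[OF u 2, of Y2] N(3) \<phi>(1) unip_diff2[OF u]
          by (simp add: jet_faithful_def)
        then show ?thesis by (simp add: wt_def coeff2_Y2)
      qed
    qed
  next
    case False
    then obtain a where a: "a \<in> N" "det2 Z (log2 a) \<noteq> 0" by blast
    have da: "diff2 a" and ua: "ufilt 1 a" using diff_groupD(1)[OF N(1)] N(2) a(1) by auto
    let ?C = "{v. commute Z v}"
    have Za: "der Z (subst2 h a) = subst2 (der Z h) a" for h
      unfolding Z_def by (rule log2_commute(1)) (use N(2) \<zeta> a in auto)
    have Za': "der Z (subst2 h (inv2 a)) = subst2 (der Z h) (inv2 a)" for h
    proof -
      have "subst2 (der Z (subst2 h (inv2 a))) a = der Z h" using Za[of "subst2 h (inv2 a)"] da by simp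
      then show ?thesis using subst2_inv2(1)[OF da, of "der Z (subst2 h (inv2 a))"] by simp
    qed
    have inv: "AdT a v \<in> ?C" if "v \<in> ?C" for v
      using that da unfolding AdT_def by (simp add: commute_def der_diff_field der_Ad Za Za')
    have lin: "Vector_Spaces.linear scale2 scale2 (AdT a)"
      unfolding Vector_Spaces.linear_iff
    proof (intro conjI allI fields.vector_space_axioms)
      show "AdT a (v + w) = AdT a v + AdT a w" for v w
        by (simp add: AdT_def Ad_def der_add_field prod_eq_iff)
      show "AdT a (scale2 c v) = scale2 c (AdT a v)" for c v
        by (simp add: AdT_def Ad_def der_scale_field prod_eq_iff) (simp add: scale2_def right_diff_distrib)
    qed
    have ker: "v \<in> fields.span {Z, log2 a}" if v: "v \<in> ?C" "AdT a v = 0" for v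
    proof -
      have Ad: "Ad a v = v" using v(2) by (simp add: AdT_def)
      have va: "der v (subst2 h a) = subst2 (der v h) a" for h
      proof -
        have "subst2 (der v (subst2 h a)) (inv2 a) = der v h" using der_Ad[OF da, of v h] Ad by simp
        then show ?thesis using subst2_inv2(2)[OF da, of "der v (subst2 h a)"] by simp
      qed
      have "der v (subst2 h (pw a t)) = subst2 (der v h) (pw a t)" for h t
        by (induction t arbitrary: h) (simp_all add: subst2_comp2 da va)
      then have "commute (log2 a) v"
        unfolding commute_def using der_der_commute[OF has_der_log2[OF ua]] by metis
      then obtain c d where "v = (const2 c * fst Z, const2 c * snd Z) + (const2 d * fst (log2 a), const2 d * snd (log2 a))"
        using commute_frame[OF com[OF a(1)] _ _ a(2), of v] v(1) by blast
      then have "v = scale2 c Z + scale2 d (log2 a)" by (simp add: scale2_def)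
      then show ?thesis using fields.span_base[of _ "{Z, log2 a}"] by (metis fields.span_add fields.span_scale insertI1 insertI2)
    qed
    have "\<exists>S. finite S \<and> (\<forall>v\<in>?C. (AdT a ^^ (3 * k + 3)) v = 0 \<longrightarrow> v \<in> fields.span S)"
    proof (rule fields.finite_span_iterated_kernel[of "AdT a" ?C "{Z, log2 a}"])
      show "finite {Z, log2 a}" by simp
    qed (fact lin subspace_commute inv ker)+
    then obtain S where S: "finite S" "\<And>v. v \<in> ?C \<Longrightarrow> (AdT a ^^ (3 * k + 3)) v = 0 \<Longrightarrow> v \<in> fields.span S"
      by blast
    obtain r where r: "1 \<le> r" "\<And>v. v \<in> fields.span S \<Longrightarrow> wt 1 r r (snd v) \<Longrightarrow> wt 0 1 1 (snd v)"
      using finite_span_contact_bounded[OF S(1)] by blast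
    show ?thesis
    proof (intro exI[of _ r] conjI ballI impI r(1))
      fix \<phi> assume \<phi>: "\<phi> \<in> N" "wt 1 r r (snd \<phi>)"
      have u: "ufilt 1 \<phi>" using N(2) \<phi>(1) by blast
      have "log2 \<phi> \<in> fields.span S" using S(2) com[OF \<phi>(1)] AdT_nilpotent[OF N a(1) \<phi>(1)] by simp
      then have "wt 0 1 1 (snd (log2 \<phi>))" using r(2) wt_1r_log2[OF u r(1) \<phi>(2)] by blast
      then show "wt 0 1 1 (snd \<phi>)" by (rule y_dvd_log2_imp[OF u])
    qed
  qed
qed

section \<open>Contact of finitely determined groups with the axis\<close>

text \<open>The eigenvalues of the linear part, once \<open>\<phi>\<close> preserves the direction of the axis.\<close>

definition lam :: "ps2 \<times> ps2 \<Rightarrow> complex" where "lam \<phi> = coeff2 (fst \<phi>) 1 0"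
definition mu :: "ps2 \<times> ps2 \<Rightarrow> complex" where "mu \<phi> = coeff2 (snd \<phi>) 0 1"

definition near_axis :: "(ps2 \<times> ps2) set \<Rightarrow> nat \<Rightarrow> (ps2 \<times> ps2) set" where
  "near_axis G r = {\<phi> \<in> G. wt 1 r r (snd \<phi>)}"

lemma wt_1r_iff: "1 \<le> r \<Longrightarrow> s \<le> r \<Longrightarrow> wt 1 r s f \<longleftrightarrow> (\<forall>i<s. coeff2 f i 0 = 0)"
proof -
  assume "1 \<le> r" "s \<le> r"
  then have "1 * i + r * j < s \<longleftrightarrow> i < s \<and> j = 0" for i j by (cases j) auto
  then show ?thesis by (auto simp: wt_def)
qed

lemma coeff2_power_lead: "coeff2 f 0 0 = 0 \<Longrightarrow> coeff2 (f ^ s) s 0 = coeff2 f 1 0 ^ s"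
  by (simp add: coeff2_def fps_power_zeroth startsby_zero_power_nth_same)

text \<open>
  Modulo \<open>x\<^sup>r\<close> the diffeomorphism \<open>\<phi>\<close> maps the axis to itself by \<open>x \<mapsto> \<lambda> x + \<dots>\<close>, so it multiplies the
  leading coefficient of order \<open>s < r\<close> by \<open>\<lambda>\<^sup>s\<close>.
\<close>

lemma coeff2_subst2_lead:
  assumes \<phi>: "fixes0 \<phi>" "wt 1 r r (snd \<phi>)" and s: "s < r" and f: "\<And>i. i < s \<Longrightarrow> coeff2 f i 0 = 0"
  shows "coeff2 (subst2 f \<phi>) s 0 = coeff2 f s 0 * lam \<phi> ^ s"
    and "\<And>i. i < s \<Longrightarrow> coeff2 (subst2 f \<phi>) i 0 = 0"
proof -
  have r: "1 \<le> r" using s by simp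
  let ?c = "coeff2 f s 0"
  define g where "g = f - const2 ?c * X2 ^ s"
  have "coeff2 (X2 ^ s) i 0 = (if i = s then 1 else 0)" for i using coeff2_monom[of s 0 i 0] by simp
  then have "wt 1 r (Suc s) g" using wt_1r_iff[OF r, of "Suc s"] s f by (auto simp: g_def less_Suc_eq)
  then have "wt 1 r (Suc s) (subst2 g \<phi>)" by (rule wt_1r_subst2[OF \<phi>(1) r \<phi>(2)])
  then have "coeff2 (subst2 g \<phi>) s 0 = 0" by (simp add: wt_def)
  moreover have "subst2 f \<phi> = const2 ?c * fst \<phi> ^ s + subst2 g \<phi>" using \<phi>(1) by (simp add: g_def)
  moreover have "coeff2 (fst \<phi>) 0 0 = 0" using \<phi>(1) by (simp add: fixes0_def max_ideal_def)
  ultimately show "coeff2 (subst2 f \<phi>) s 0 = ?c * lam \<phi> ^ s"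
    by (simp add: coeff2_power_lead lam_def)
  have "wt 1 r s f" using wt_1r_iff[OF r] s f by simp
  then have "wt 1 r s (subst2 f \<phi>)" by (rule wt_1r_subst2[OF \<phi>(1) r \<phi>(2)])
  then show "\<And>i. i < s \<Longrightarrow> coeff2 (subst2 f \<phi>) i 0 = 0" using wt_1r_iff[OF r] s by simp
qed

lemma near_axis_coeffs:
  assumes "diff2 \<phi>" "wt 1 r r (snd \<phi>)" "2 \<le> r"
  shows "coeff2 (snd \<phi>) 1 0 = 0" "lam \<phi> \<noteq> 0" "mu \<phi> \<noteq> 0"
proof -
  show "coeff2 (snd \<phi>) 1 0 = 0" using assms wt_1r_iff[of r r] by auto
  then show "lam \<phi> \<noteq> 0" "mu \<phi> \<noteq> 0" using assms(1) by (auto simp: diff2_def jac_def lam_def mu_def)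
qed

lemma wt_1r_inv2:
  assumes \<phi>: "diff2 \<phi>" "wt 1 r r (snd \<phi>)" and r: "2 \<le> r" shows "wt 1 r r (snd (inv2 \<phi>))"
proof -
  let ?g = "snd (inv2 \<phi>)"
  have g\<phi>: "subst2 ?g \<phi> = Y2" using comp2_inv2(2)[OF \<phi>(1)] unfolding comp2_def by (metis snd_conv snd_id2)
  have "coeff2 ?g s 0 = 0" if "s < r" for s
    using that
  proof (induction s rule: less_induct)
    case (less s)
    have "coeff2 (subst2 ?g \<phi>) s 0 = coeff2 ?g s 0 * lam \<phi> ^ s"
      by (rule coeff2_subst2_lead[of _ r]) (use \<phi> less in auto)
    then show ?case using near_axis_coeffs(2)[OF \<phi> r] by (simp add: g\<phi> coeff2_Y2)
  qed
  then show ?thesis using wt_1r_iff[of r r] r by simp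
qed

lemma diff_group_near_axis:
  assumes G: "diff_group G" and r: "2 \<le> r" shows "diff_group (near_axis G r)"
  unfolding diff_group_def
proof (intro conjI ballI)
  show "id2 \<in> near_axis G r" using diff_groupD(3)[OF G] by (simp add: near_axis_def wt_1r_Y2)
  fix \<phi> assume \<phi>: "\<phi> \<in> near_axis G r"
  then have d: "diff2 \<phi>" using diff_groupD(1)[OF G] by (simp add: near_axis_def)
  then show "diff2 \<phi>" .
  show "inv2 \<phi> \<in> near_axis G r" using \<phi> d wt_1r_inv2[OF d _ r] diff_groupD(2)[OF G] by (simp add: near_axis_def)
  fix \<psi> assume \<psi>: "\<psi> \<in> near_axis G r"
  then have "diff2 \<psi>" using diff_groupD(1)[OF G] by (simp add: near_axis_def)
  then show "comp2 \<phi> \<psi> \<in> near_axis G r"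
    using \<phi> \<psi> d r diff_groupD(4)[OF G] wt_1r_comp2[of \<phi> \<psi> r] by (simp add: near_axis_def)
qed

lemma lam_mu_comp2:
  assumes "coeff2 (snd \<phi>) 1 0 = 0" "coeff2 (snd \<psi>) 1 0 = 0" "fixes0 \<psi>"
  shows "lam (comp2 \<phi> \<psi>) = lam \<phi> * lam \<psi>" "mu (comp2 \<phi> \<psi>) = mu \<phi> * mu \<psi>"
  using assms by (simp_all add: lam_def mu_def comp2_def coeff2_subst2_linear)

lemma lam_mu_inv2:
  assumes "diff2 \<phi>" "wt 1 2 2 (snd \<phi>)"
  shows "lam (inv2 \<phi>) * lam \<phi> = 1" "mu (inv2 \<phi>) * mu \<phi> = 1"
proof -
  have "coeff2 (snd \<phi>) 1 0 = 0" "coeff2 (snd (inv2 \<phi>)) 1 0 = 0"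
    using near_axis_coeffs(1)[OF assms] near_axis_coeffs(1)[OF _ wt_1r_inv2[OF assms]] assms(1) by auto
  then show "lam (inv2 \<phi>) * lam \<phi> = 1" "mu (inv2 \<phi>) * mu \<phi> = 1"
    using lam_mu_comp2[of "inv2 \<phi>" \<phi>] assms(1) by (auto simp: lam_def mu_def coeff2_X2 coeff2_Y2)
qed

text \<open>The order of contact of the axis with its image. If \<open>\<phi>\<close> preserves the axis, the value is the default \<open>0\<close>.\<close>

definition contact :: "ps2 \<times> ps2 \<Rightarrow> nat" where "contact \<phi> = subdegree (snd \<phi> $ 0)"

lemma contact_coeff:
  assumes "\<not> wt 0 1 1 (snd \<phi>)"
  shows "coeff2 (snd \<phi>) (contact \<phi>) 0 \<noteq> 0" "i < contact \<phi> \<Longrightarrow> coeff2 (snd \<phi>) i 0 = 0"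
  using assms by (auto simp: contact_def coeff2_def wt_01_nth)

lemma contact_ge: "1 \<le> r \<Longrightarrow> wt 1 r r (snd \<phi>) \<Longrightarrow> \<not> wt 0 1 1 (snd \<phi>) \<Longrightarrow> r \<le> contact \<phi>"
  by (simp add: wt_1r_nth wt_01_nth xord_def contact_def)

text \<open>If \<open>\<kappa> = [\<psi>, \<phi>]\<close> preserves the axis, compare the leading terms along the axis of both sides of
  \<open>y \<circ> (\<psi> \<circ> \<phi>) = y \<circ> (\<kappa> \<circ> \<phi> \<circ> \<psi>)\<close>.\<close>

lemma eigenvalue_relation:
  assumes \<psi>: "diff2 \<psi>" "\<not> wt 0 1 1 (snd \<psi>)" and \<phi>: "diff2 \<phi>" "wt 1 n n (snd \<phi>)" "contact \<psi> < n" "2 \<le> n"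
    and \<kappa>: "wt 0 1 1 (snd (comm2 \<psi> \<phi>))" "mu (comm2 \<psi> \<phi>) = 1"
  shows "lam \<phi> ^ contact \<psi> = mu \<phi>"
proof -
  let ?d = "contact \<psi>" and ?g = "snd \<psi>"
  obtain w where w: "snd (comm2 \<psi> \<phi>) = Y2 * w" using \<kappa>(1) y_dvd_iff by (auto elim: dvdE)
  have w0: "coeff2 w 0 0 = 1" using \<kappa>(2) by (simp add: mu_def w coeff2_Y2_mult)
  have "subst2 (subst2 (subst2 Y2 (comm2 \<psi> \<phi>)) \<phi>) \<psi> = subst2 (subst2 Y2 \<psi>) \<phi>"
    using \<psi>(1) \<phi>(1) by (simp add: subst2_comm2 del: subst2_Y2)
  then have g\<phi>: "subst2 ?g \<phi> = subst2 (snd \<phi>) \<psi> * subst2 (subst2 w \<phi>) \<psi>"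
    using \<psi>(1) \<phi>(1) by (simp add: w)
  define u where "u = mk_ps2 (\<lambda>i j. coeff2 (snd \<phi>) i (Suc j))"
  define h where "h = snd \<phi> - Y2 * u"
  have h: "wt 1 1 n h" using \<phi>(2-4) wt_1r_iff[of n n] by (auto simp: wt_def h_def u_def coeff2_Y2_mult)
  have u0: "coeff2 u 0 0 = mu \<phi>" by (simp add: u_def mu_def One_nat_def)
  have "subst2 (snd \<phi>) \<psi> = ?g * subst2 u \<psi> + subst2 h \<psi>" using \<psi>(1) by (simp add: h_def)
  then have eq: "subst2 ?g \<phi> = ?g * (subst2 u \<psi> * subst2 (subst2 w \<phi>) \<psi>) + subst2 h \<psi> * subst2 (subst2 w \<phi>) \<psi>"
    unfolding g\<phi> by (simp add: algebra_simps)
  have "wt 1 1 n (subst2 h \<psi> * subst2 (subst2 w \<phi>) \<psi>)"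
    by (intro wt_mult_right wt_subst2_11 h) (use \<psi> in simp)
  then have "coeff2 (subst2 h \<psi> * subst2 (subst2 w \<phi>) \<psi>) ?d 0 = 0" using \<phi>(3) by (simp add: wt_def)
  moreover have "coeff2 (?g * v) ?d 0 = coeff2 ?g ?d 0 * coeff2 v 0 0" for v
  proof -
    have "coeff2 (?g * v) ?d 0 = (\<Sum>a\<le>?d. coeff2 ?g a 0 * coeff2 v (?d - a) 0)" by (simp add: coeff2_mult)
    also have "\<dots> = (\<Sum>a\<le>?d. if a = ?d then coeff2 ?g ?d 0 * coeff2 v 0 0 else 0)"
      using contact_coeff(2)[OF \<psi>(2)] by (intro sum.cong) auto
    finally show ?thesis by simp
  qed
  ultimately have "coeff2 (subst2 ?g \<phi>) ?d 0 = coeff2 ?g ?d 0 * mu \<phi>"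
    unfolding eq using \<psi>(1) \<phi>(1) by (simp add: w0 u0)
  moreover have "coeff2 (subst2 ?g \<phi>) ?d 0 = coeff2 ?g ?d 0 * lam \<phi> ^ ?d"
    by (rule coeff2_subst2_lead[of _ n]) (use \<phi> contact_coeff(2)[OF \<psi>(2)] in auto)
  ultimately show ?thesis using contact_coeff(1)[OF \<psi>(2)] by simp
qed

lemma contact_comp2_right:
  assumes "diff2 \<kappa>" "wt 0 1 1 (snd \<kappa>)" "\<not> wt 0 1 1 (snd \<phi>)"
  shows "contact (comp2 \<phi> \<kappa>) = contact \<phi>"
proof -
  let ?d = "contact \<phi>"
  have r: "wt 1 (max 2 (Suc ?d)) (max 2 (Suc ?d)) (snd \<kappa>)" using wt_01_imp_1r[OF _ assms(2)] by simp
  have "lam \<kappa> \<noteq> 0" using near_axis_coeffs(2)[OF assms(1) r] by simp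
  moreover note coeff2_subst2_lead[OF _ r, of ?d "snd \<phi>"]
  ultimately have "coeff2 (snd (comp2 \<phi> \<kappa>)) ?d 0 \<noteq> 0" "\<And>i. i < ?d \<Longrightarrow> coeff2 (snd (comp2 \<phi> \<kappa>)) i 0 = 0"
    using contact_coeff[OF assms(3)] assms(1) by (auto simp: comp2_def)
  then show ?thesis unfolding contact_def[of "comp2 \<phi> \<kappa>"] by (intro subdegreeI) (auto simp: coeff2_def)
qed

lemma finite_image_factor:
  assumes "finite (f ` A)" "\<And>x y. x \<in> A \<Longrightarrow> y \<in> A \<Longrightarrow> f x = f y \<Longrightarrow> c x = c y"
  shows "finite (c ` A)"
proof -
  have "c ` A \<subseteq> (\<lambda>p. c (inv_into A f p)) ` f ` A"
  proof
    fix z assume "z \<in> c ` A"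
    then obtain x where x: "x \<in> A" "z = c x" by blast
    have "f (inv_into A f (f x)) = f x" "inv_into A f (f x) \<in> A" using x(1) by (auto intro: f_inv_into_f inv_into_into)
    then show "z \<in> (\<lambda>p. c (inv_into A f p)) ` f ` A" using assms(2) x by (metis (no_types, lifting) imageI)
  qed
  then show ?thesis using assms(1) finite_surj finite_imageI by blast
qed

text \<open>
  Argue by contradiction. Unbounded finite contact provides \<open>\<psi>\<^sub>1\<close> and \<open>\<psi>\<^sub>2\<close> of different orders of contact, so that
  the eigenvalues of all elements of still higher contact are roots of unity of bounded order. Two such
  elements with the same eigenvalues differ by a unipotent element, which preserves the axis; so only
  finitely many orders of contact occur among them.
\<close>

lemma contact_bounded:
  assumes G: "diff_group G" and k: "jet_faithful k G"
  shows "\<exists>r\<ge>1. \<forall>\<phi>\<in>G. wt 1 r r (snd \<phi>) \<longrightarrow> wt 0 1 1 (snd \<phi>)"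
proof (rule ccontr)
  assume unbounded: "\<not> ?thesis"
  define N where "N = {\<phi> \<in> near_axis G 2. lam \<phi> = 1 \<and> mu \<phi> = 1}"
  have G2: "diff_group (near_axis G 2)" using diff_group_near_axis[OF G] by simp
  have c2: "diff2 \<phi>" "coeff2 (snd \<phi>) 1 0 = 0" "wt 1 2 2 (snd \<phi>)" if "\<phi> \<in> near_axis G 2" for \<phi>
    using that near_axis_coeffs(1)[of \<phi> 2] diff_groupD(1)[OF G] by (auto simp: near_axis_def)
  have hom: "lam (comp2 \<phi> \<psi>) = lam \<phi> * lam \<psi>" "mu (comp2 \<phi> \<psi>) = mu \<phi> * mu \<psi>"
    "lam (inv2 \<phi>) * lam \<phi> = 1" "mu (inv2 \<phi>) * mu \<phi> = 1" if "\<phi> \<in> near_axis G 2" "\<psi> \<in> near_axis G 2" for \<phi> \<psi>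
    using that c2 lam_mu_comp2 lam_mu_inv2 by simp_all
  have N: "diff_group N"
    unfolding diff_group_def
  proof (intro conjI ballI)
    show "id2 \<in> N" using diff_groupD(3)[OF G2] by (simp add: N_def lam_def mu_def coeff2_X2 coeff2_Y2)
    fix \<phi> assume \<phi>: "\<phi> \<in> N"
    then show "diff2 \<phi>" "inv2 \<phi> \<in> N" using c2 diff_groupD(2)[OF G2] hom(3,4)[of \<phi> \<phi>] by (auto simp: N_def)
    fix \<psi> assume "\<psi> \<in> N"
    then show "comp2 \<phi> \<psi> \<in> N" using \<phi> diff_groupD(4)[OF G2] hom(1,2) by (auto simp: N_def)
  qed
  have Nu: "ufilt 1 \<phi>" if "\<phi> \<in> N" for \<phi>
    using that unip_iff[of \<phi>] c2[of \<phi>] by (auto simp: N_def lam_def mu_def)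
  have Nk: "jet_faithful k N" using k by (auto simp: jet_faithful_def N_def near_axis_def)
  obtain r1 where r1: "1 \<le> r1" "\<And>\<phi>. \<phi> \<in> N \<Longrightarrow> wt 1 r1 r1 (snd \<phi>) \<Longrightarrow> wt 0 1 1 (snd \<phi>)"
    using unipotent_contact_bounded[OF N Nu Nk] by blast
  define r0 where "r0 = max 2 r1"
  have r0: "2 \<le> r0" "r1 \<le> r0" by (auto simp: r0_def)
  have near_mono: "near_axis G n \<subseteq> near_axis G m" if "1 \<le> m" "m \<le> n" for m n
    using wt_1r_mono[OF that] by (auto simp: near_axis_def)
  have N0: "wt 0 1 1 (snd \<kappa>)" if "\<kappa> \<in> near_axis G r0" "lam \<kappa> = 1" "mu \<kappa> = 1" for \<kappa>
    using r1(2)[of \<kappa>] that near_mono[of 2 r0] near_mono[OF r1(1) r0(2)] r0 by (auto simp: N_def near_axis_def)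
  have G0: "diff_group (near_axis G r0)" using diff_group_near_axis[OF G r0(1)] .
  have ex: "\<exists>\<psi>\<in>near_axis G r. \<not> wt 0 1 1 (snd \<psi>) \<and> r \<le> contact \<psi>" if "1 \<le> r" for r
    using unbounded that contact_ge[OF that] unfolding near_axis_def by blast
  have in2: "\<phi> \<in> near_axis G 2" if "\<phi> \<in> near_axis G r0" for \<phi> using that near_mono[of 2 r0] r0 by auto
  have rel: "lam \<phi> ^ contact \<psi> = mu \<phi>"
    if \<psi>: "\<psi> \<in> near_axis G r0" "\<not> wt 0 1 1 (snd \<psi>)" and \<phi>: "\<phi> \<in> near_axis G n" "contact \<psi> < n" "r0 \<le> n" for \<phi> \<psi> n
  proof -
    have \<phi>0: "\<phi> \<in> near_axis G r0" using near_mono[of r0 n] \<phi> r0 by auto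
    have \<kappa>: "comm2 \<psi> \<phi> \<in> near_axis G r0" by (rule diff_group_comm2[OF G0 \<psi>(1) \<phi>0])
    have eq: "comp2 (comm2 \<psi> \<phi>) (comp2 \<phi> \<psi>) = comp2 \<psi> \<phi>"
    proof (rule comp2_eqI)
      show "subst2 h (comp2 (comm2 \<psi> \<phi>) (comp2 \<phi> \<psi>)) = subst2 h (comp2 \<psi> \<phi>)" for h
        using c2(1) in2 \<psi>(1) \<phi>0 by (simp add: subst2_comp2 subst2_comm2)
    qed (use c2(1) in2 \<psi>(1) \<phi>0 in auto)
    have m: "\<psi> \<in> near_axis G 2" "\<phi> \<in> near_axis G 2" "comm2 \<psi> \<phi> \<in> near_axis G 2" "comp2 \<phi> \<psi> \<in> near_axis G 2"
      using in2 \<psi>(1) \<phi>0 \<kappa> diff_groupD(4)[OF G2] by auto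
    have "lam (comm2 \<psi> \<phi>) * (lam \<phi> * lam \<psi>) = lam \<psi> * lam \<phi>" "mu (comm2 \<psi> \<phi>) * (mu \<phi> * mu \<psi>) = mu \<psi> * mu \<phi>"
      using arg_cong[OF eq, of lam] arg_cong[OF eq, of mu] hom(1,2) m by simp_all
    moreover have "lam \<phi> \<noteq> 0" "lam \<psi> \<noteq> 0" "mu \<phi> \<noteq> 0" "mu \<psi> \<noteq> 0"
      using near_axis_coeffs(2,3)[OF c2(1) c2(3)] m by auto
    ultimately have one: "lam (comm2 \<psi> \<phi>) = 1" "mu (comm2 \<psi> \<phi>) = 1" by (auto simp: field_simps)
    show ?thesis
      by (rule eigenvalue_relation[of \<psi> \<phi> n]) (use c2(1) m \<psi> \<phi> r0 one N0[OF \<kappa> one] in \<open>auto simp: near_axis_def\<close>)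
  qed
  obtain \<psi>1 where \<psi>1: "\<psi>1 \<in> near_axis G r0" "\<not> wt 0 1 1 (snd \<psi>1)" "r0 \<le> contact \<psi>1"
    using ex[of r0] r0 by auto
  obtain \<psi>2 where \<psi>2: "\<psi>2 \<in> near_axis G (Suc (contact \<psi>1))" "\<not> wt 0 1 1 (snd \<psi>2)" "Suc (contact \<psi>1) \<le> contact \<psi>2"
    using ex[of "Suc (contact \<psi>1)"] by auto
  have \<psi>2': "\<psi>2 \<in> near_axis G r0" using near_mono[of r0 "Suc (contact \<psi>1)"] \<psi>1(3) \<psi>2(1) r0 by auto
  define n where "n = Suc (contact \<psi>2)"
  define q where "q = contact \<psi>2 - contact \<psi>1"
  have n: "r0 \<le> n" "contact \<psi>1 < n" "contact \<psi>2 < n" "contact \<psi>2 = contact \<psi>1 + q" "1 \<le> q"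
    using \<psi>1(3) \<psi>2(3) by (auto simp: n_def q_def)
  have Gn: "diff_group (near_axis G n)" using diff_group_near_axis[OF G] n r0 by simp
  have n0: "\<phi> \<in> near_axis G r0" if "\<phi> \<in> near_axis G n" for \<phi> using that near_mono[of r0 n] n r0 by auto
  define R where "R = {z :: complex. z ^ q = 1}"
  have "finite R" unfolding R_def using n(5) by (intro finite_nth_roots) auto
  have R: "lam \<phi> \<in> R \<and> mu \<phi> \<in> R" if \<phi>: "\<phi> \<in> near_axis G n" for \<phi>
  proof -
    have e: "lam \<phi> ^ contact \<psi>1 = mu \<phi>" "lam \<phi> ^ contact \<psi>2 = mu \<phi>"
      using rel[OF \<psi>1(1,2) \<phi> n(2,1)] rel[OF \<psi>2' \<psi>2(2) \<phi> n(3,1)] by auto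
    have "\<phi> \<in> near_axis G 2" by (rule in2[OF n0[OF \<phi>]])
    then have "mu \<phi> \<noteq> 0" using near_axis_coeffs(3)[OF c2(1) c2(3)] by simp
    then have "lam \<phi> ^ q = 1" using e by (simp add: n(4) power_add)
    moreover have "mu \<phi> ^ q = (lam \<phi> ^ q) ^ contact \<psi>1" using e(1) by (metis mult.commute power_mult)
    ultimately show ?thesis by (simp add: R_def)
  qed
  define A where "A = {\<phi> \<in> near_axis G n. \<not> wt 0 1 1 (snd \<phi>)}"
  have "(\<lambda>\<phi>. (lam \<phi>, mu \<phi>)) ` A \<subseteq> R \<times> R" using R by (auto simp: A_def)
  then have fin: "finite ((\<lambda>\<phi>. (lam \<phi>, mu \<phi>)) ` A)" using \<open>finite R\<close> finite_subset by blast
  have "finite (contact ` A)"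
  proof (rule finite_image_factor[OF fin])
    fix \<phi> \<phi>' assume \<phi>: "\<phi> \<in> A" "\<phi>' \<in> A" "(lam \<phi>, mu \<phi>) = (lam \<phi>', mu \<phi>')"
    define \<kappa> where "\<kappa> = comp2 (inv2 \<phi>) \<phi>'"
    have m: "\<phi> \<in> near_axis G n" "\<phi>' \<in> near_axis G n" "inv2 \<phi> \<in> near_axis G n" "\<kappa> \<in> near_axis G n"
      using \<phi> diff_groupD[OF Gn] by (auto simp: A_def \<kappa>_def)
    have d: "diff2 \<phi>" "diff2 \<phi>'" "diff2 \<kappa>" using m diff_groupD(1)[OF Gn] by auto
    have "lam \<kappa> = 1" "mu \<kappa> = 1"
      unfolding \<kappa>_def using hom[OF in2 in2, OF n0 n0, OF m(1) m(1)] hom(1,2)[OF in2 in2, OF n0 n0, OF m(3,2)] \<phi>(3) by auto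
    then have "wt 0 1 1 (snd \<kappa>)" using N0 n0[OF m(4)] by blast
    then have "contact (comp2 \<phi> \<kappa>) = contact \<phi>" using contact_comp2_right d \<phi>(1) by (auto simp: A_def)
    moreover have "comp2 \<phi> \<kappa> = \<phi>'"
      unfolding \<kappa>_def using d by (simp flip: comp2_assoc)
    ultimately show "contact \<phi> = contact \<phi>'" by simp
  qed
  then obtain M where M: "\<And>\<phi>. \<phi> \<in> A \<Longrightarrow> contact \<phi> \<le> M"
    using finite_nat_set_iff_bounded_le by auto
  obtain \<phi> where \<phi>: "\<phi> \<in> near_axis G (n + Suc M)" "\<not> wt 0 1 1 (snd \<phi>)" "n + Suc M \<le> contact \<phi>"
    using ex[of "n + Suc M"] by auto
  then have "\<phi> \<in> A" using near_mono[of n "n + Suc M"] n r0 by (auto simp: A_def)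
  then show False using M[of \<phi>] \<phi>(3) by simp
qed

section \<open>Weierstrass division\<close>

text \<open>The order of \<open>F(0, y)\<close> is \<open>a\<close>.\<close>

definition yreg :: "nat \<Rightarrow> ps2 \<Rightarrow> bool" where
  "yreg a F \<longleftrightarrow> (\<forall>j<a. coeff2 F 0 j = 0) \<and> coeff2 F 0 a \<noteq> 0"

text \<open>
  Let \<open>\<tau>\<close> discard the terms of degree less than \<open>a\<close> in \<open>y\<close> and divide by \<open>y\<^sup>a\<close>. Write \<open>F = L + y\<^sup>a \<tau> F\<close>, where \<open>L\<close> is
  divisible by \<open>x\<close> and \<open>\<tau> F\<close> is a unit. The quotient has to satisfy \<open>\<tau> (q F) = \<tau> f\<close>, that is,
  \<open>q = (\<tau> f - \<tau> (q L)) / \<tau> F\<close>, which is a contraction for the order in \<open>x\<close>.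
\<close>

lemma weierstrass_division:
  assumes F: "yreg a F"
  obtains q r where "f = q * F + r" "\<And>i j. a \<le> j \<Longrightarrow> coeff2 r i j = 0"
proof -
  define \<tau> where "\<tau> h = mk_ps2 (\<lambda>i j. coeff2 h i (j + a))" for h
  define L where "L = F - Y2 ^ a * \<tau> F"
  have \<tau>: "\<tau> (g + h) = \<tau> g + \<tau> h" "\<tau> (g - h) = \<tau> g - \<tau> h" "\<tau> (Y2 ^ a * h) = h" for g h
    by (rule ps2_eqI; simp add: \<tau>_def coeff2_Y2_power_mult)+
  have w\<tau>: "wt 1 0 n h \<Longrightarrow> wt 1 0 n (\<tau> h)" for n h by (auto simp: wt_def \<tau>_def)
  have L: "wt 1 0 1 L" using F by (auto simp: wt_def L_def \<tau>_def coeff2_Y2_power_mult yreg_def)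
  have "coeff2 (\<tau> F) 0 0 \<noteq> 0" using F by (simp add: \<tau>_def yreg_def)
  then obtain V where V: "\<tau> F * V = 1" using ps2_unit_inverse by metis
  define P :: "(nat \<times> nat \<Rightarrow> complex) \<Rightarrow> ps2" where "P s = mk_ps2 (\<lambda>i j. s (i, j))" for s
  define T where "T s = (\<lambda>(i, j). coeff2 (V * (\<tau> f - \<tau> (P s * L))) i j)" for s
  obtain s where s: "T s = s"
  proof (rule contraction_fixpoint[where w = fst and T = T])
    fix n and i :: "nat \<times> nat" and r s :: "nat \<times> nat \<Rightarrow> complex"
    assume eq: "\<And>i. fst i < n \<Longrightarrow> r i = s i" and i: "fst i < Suc n"
    have "wt 1 0 n (P r - P s)" using eq by (auto simp: wt_def P_def)
    then have "wt 1 0 (n + 1) (V * \<tau> ((P r - P s) * L))" by (intro wt_mult_left w\<tau> wt_mult L)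
    then have "wt 1 0 (n + 1) (V * (\<tau> f - \<tau> (P s * L)) - V * (\<tau> f - \<tau> (P r * L)))"
      by (simp add: left_diff_distrib \<tau> algebra_simps)
    from wtD[OF this, of "fst i" "snd i"] show "T r i = T s i" using i by (simp add: T_def case_prod_unfold)
  qed
  define q where "q = P s"
  have "q = V * (\<tau> f - \<tau> (q * L))"
  proof (rule ps2_eqI)
    show "coeff2 q i j = coeff2 (V * (\<tau> f - \<tau> (q * L))) i j" for i j
      using fun_cong[OF s, of "(i, j)"] by (simp add: T_def q_def P_def)
  qed
  then have "q * \<tau> F = (\<tau> F * V) * (\<tau> f - \<tau> (q * L))" by (metis mult.assoc mult.commute)
  then have "\<tau> f = \<tau> (q * L) + \<tau> (Y2 ^ a * (q * \<tau> F))" by (simp add: V \<tau>)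
  also have "\<dots> = \<tau> (q * F)" unfolding \<tau>(1)[symmetric] by (simp add: L_def algebra_simps)
  finally have "\<tau> (f - q * F) = 0" by (simp add: \<tau>)
  then have z: "coeff2 (f - q * F) i (j + a) = 0" for i j
    by (metis \<tau>_def coeff2_mk_ps2 coeff2_linear(1))
  show ?thesis
  proof (rule that[of q "f - q * F"])
    show "coeff2 (f - q * F) i j = 0" if "a \<le> j" for i j using z[of i "j - a"] that by simp
  qed simp
qed

lemma weierstrass_unique:
  assumes F: "yreg a F" and r: "\<And>i j. a \<le> j \<Longrightarrow> coeff2 (q * F) i j = 0"
  shows "q = 0"
proof (rule wt_all_0)
  show "wt 1 0 n q" for n
  proof (induction n)
    case (Suc n)
    have low: "coeff2 q i j = 0" if "i < n" for i j using wtD[OF Suc] that by simp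
    have "coeff2 q n b = 0" for b
    proof (induction b rule: less_induct)
      case (less b)
      have "coeff2 (q * F) n (a + b) = (\<Sum>b'\<le>a + b. \<Sum>i\<le>n. coeff2 q i b' * coeff2 F (n - i) (a + b - b'))"
        by (simp add: coeff2_mult)
      also have "\<dots> = (\<Sum>b'\<le>a + b. \<Sum>i\<le>n. if i = n \<and> b' = b then coeff2 q n b * coeff2 F 0 a else 0)"
      proof (intro sum.cong refl)
        fix b' i assume "b' \<in> {..a + b}" "i \<in> {..n}"
        then show "coeff2 q i b' * coeff2 F (n - i) (a + b - b') = (if i = n \<and> b' = b then coeff2 q n b * coeff2 F 0 a else 0)"
          using low less F by (cases "i = n"; cases "b' < b"; cases "b' = b") (auto simp: yreg_def)
      qed
      also have "\<dots> = coeff2 q n b * coeff2 F 0 a"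
      proof -
        have "(\<Sum>i\<le>n. if i = n \<and> b' = b then c else 0) = (if b' = b then c else (0::complex))" for b' c by (cases "b' = b") auto
        then show ?thesis by simp
      qed
      finally show ?case using r[of "a + b" n] F by (simp add: yreg_def)
    qed
    then show ?case using low by (auto simp: wt_def less_Suc_eq)
  qed simp
qed

lemma weierstrass_preparation:
  assumes g: "yreg a g"
  obtains W q where "W = q * g" "coeff2 q 0 0 \<noteq> 0" "\<And>i. coeff2 W i a = (if i = 0 then 1 else 0)"
    "\<And>j. j < a \<Longrightarrow> coeff2 W 0 j = 0" "\<And>i j. a < j \<Longrightarrow> coeff2 W i j = 0" 
proof -
  obtain q r where qr: "Y2 ^ a = q * g + r" "\<And>i j. a \<le> j \<Longrightarrow> coeff2 r i j = 0"
    using weierstrass_division[OF g, of "Y2 ^ a"] by blast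
  have Ya: "coeff2 (Y2 ^ a) i j = (if i = 0 \<and> j = a then 1 else 0)" for i j using coeff2_monom[of 0 a i j] by simp
  have qg: "coeff2 (q * g) i j = (if i = 0 \<and> j = a then 1 else 0) - coeff2 r i j" for i j
    using arg_cong[OF qr(1), of "\<lambda>f. coeff2 f i j"] by (simp add: Ya)
  have 0: "coeff2 (q * g) 0 j = (\<Sum>b\<le>j. coeff2 q 0 b * coeff2 g 0 (j - b))" for j by (simp add: coeff2_mult)
  have low: "coeff2 (q * g) 0 j = 0" if "j < a" for j using that g unfolding 0 by (intro sum.neutral) (auto simp: yreg_def)
  have "coeff2 (q * g) 0 a = (\<Sum>b\<le>a. if b = 0 then coeff2 q 0 0 * coeff2 g 0 a else 0)"
    unfolding 0 using g by (intro sum.cong) (auto simp: yreg_def)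
  then have "coeff2 q 0 0 \<noteq> 0" using qg[of 0 a] qr(2)[of a 0] by auto
  then show ?thesis using that[of "q * g" q] low qg qr(2) by simp
qed

section \<open>The blow-up in the horizontal direction\<close>

text \<open>The chart \<open>(x, y) \<mapsto> (x, x y)\<close> centered at the direction \<open>y = 0\<close>.\<close>

definition B0 :: "ps2 \<times> ps2" where "B0 = (X2, X2 * Y2)"

lemma fixes0_B0 [simp]: "fixes0 B0"
  by (simp add: B0_def fixes0_def max_ideal_def coeff2_X2)

lemma coeff2_subst2_B0: "coeff2 (subst2 h B0) i j = (if j \<le> i then coeff2 h (i - j) j else 0)"
proof -
  have c: "coeff2 (fst B0 ^ a * snd B0 ^ b) i j = (if i = a + b \<and> j = b then 1 else 0)" for a b
    using coeff2_monom[of "a + b" b i j] by (simp add: B0_def power_mult_distrib power_add mult.assoc)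
  have "coeff2 (subst2 h B0) i j = (\<Sum>x\<in>{(a, b). a + b \<le> i + j}. if x = (i - j, j) \<and> j \<le> i then coeff2 h (i - j) j else 0)"
    unfolding subst2_def coeff2_mk_ps2 by (rule sum.cong) (auto simp: c split: if_splits)
  then show ?thesis by (cases "j \<le> i") auto
qed

lemma subst2_B0_inj: "subst2 h B0 = 0 \<Longrightarrow> h = 0"
proof (rule ps2_eqI)
  fix i j assume "subst2 h B0 = 0"
  then have "coeff2 (subst2 h B0) (i + j) j = 0" by simp
  then show "coeff2 h i j = coeff2 0 i j" by (simp add: coeff2_subst2_B0)
qed

lemma blow_up_factor:
  assumes "wt 1 1 m h"
  obtains g where "subst2 h B0 = X2 ^ m * g" "\<And>i j. coeff2 g i j = (if j \<le> i + m then coeff2 h (i + m - j) j else 0)"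
proof
  show "subst2 h B0 = X2 ^ m * mk_ps2 (\<lambda>i j. if j \<le> i + m then coeff2 h (i + m - j) j else 0)"
    by (rule ps2_eqI) (use assms in \<open>auto simp: coeff2_subst2_B0 coeff2_X2_power_mult wt_def\<close>)
qed simp

text \<open>
  Divide \<open>f\<close> by \<open>F\<close>. The pull-back of the remainder is divisible by \<open>W\<close> and has degree less than \<open>a\<close> in \<open>y\<close>,
  so it vanishes.
\<close>

lemma blow_down_dvd:
  assumes F: "yreg a F" and W: "yreg a W" and FW: "subst2 F B0 = X2 ^ a * W" and dvd: "W dvd subst2 f B0"
  shows "F dvd f"
proof -
  obtain q r where qr: "f = q * F + r" "\<And>i j. a \<le> j \<Longrightarrow> coeff2 r i j = 0" using weierstrass_division[OF F, of f] by blast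
  have "subst2 f B0 = (subst2 q B0 * X2 ^ a) * W + subst2 r B0" by (simp add: qr(1) FW)
  then have "W dvd subst2 r B0" using dvd by (metis dvd_add_right_iff dvd_triv_right)
  then obtain s where s: "subst2 r B0 = s * W" by (metis dvdE mult.commute)
  have "s = 0" by (rule weierstrass_unique[OF W]) (simp add: coeff2_subst2_B0 qr(2) flip: s)
  then have "r = 0" using s subst2_B0_inj by simp
  then show ?thesis using qr(1) by simp
qed

text \<open>
  The Weierstrass polynomial \<open>W(x,y)\<close> of the factor \<open>W'\<close> of the strict transform blows down to the series
  \<open>x\<^sup>a W(x, y/x)\<close>, a factor of \<open>h\<close> of order \<open>a < m\<close>.
\<close>

lemma blow_down_reducible:
  assumes h: "wt 1 1 m h" "W' dvd subst2 h B0" and W': "yreg a W'" and a: "1 \<le> a" "a < m"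
  shows "\<not> irreducible h"
proof
  assume irr: "irreducible h"
  obtain W q where W: "W = q * W'" "coeff2 q 0 0 \<noteq> 0" "\<And>i. coeff2 W i a = (if i = 0 then 1 else 0)"
    "\<And>j. j < a \<Longrightarrow> coeff2 W 0 j = 0" "\<And>i j. a < j \<Longrightarrow> coeff2 W i j = 0" using weierstrass_preparation[OF W'] by blast
  obtain v where v: "q * v = 1" using ps2_unit_inverse[OF W(2)] by metis
  have "W dvd W'" using W(1) v by (metis dvd_triv_left mult.commute mult.left_commute mult.right_neutral)
  define F where "F = mk_ps2 (\<lambda>p j. if j \<le> a \<and> a \<le> p + j then coeff2 W (p + j - a) j else 0)"
  have F: "yreg a F" "yreg a W" using W by (auto simp: yreg_def F_def)
  have FW: "subst2 F B0 = X2 ^ a * W"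
    by (rule ps2_eqI) (auto simp: coeff2_subst2_B0 coeff2_X2_power_mult F_def W(5))
  have "F dvd h" by (rule blow_down_dvd[OF F FW]) (use \<open>W dvd W'\<close> h(2) dvd_trans in blast)
  then obtain p where p: "h = F * p" by (rule dvdE)
  have "coeff2 F 0 0 = 0" using F(1) a(1) by (simp add: yreg_def)
  then have "\<not> F dvd 1" by (simp add: ps2_dvd_1_iff)
  moreover have "\<not> p dvd 1"
  proof
    assume "p dvd 1"
    then obtain p' where "1 = p * p'" by (rule dvdE)
    then have "F = h * p'" by (metis p mult.assoc mult.right_neutral)
    then have "wt 1 1 m F" using h(1) wt_mult_right by simp
    then show False using F(1) a(2) by (auto simp: wt_def yreg_def)
  qed
  ultimately show False using irr p by (auto simp: irreducible_def)
qed

section \<open>Directions\<close>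

text \<open>The direction \<open>Some c\<close> is the line \<open>y = c x\<close>, and \<open>None\<close> is the line \<open>x = 0\<close>.\<close>

definition dline :: "complex option \<Rightarrow> (complex \<times> complex) set" where
  "dline d = (case d of None \<Rightarrow> line 1 0 | Some c \<Rightarrow> line (- c) 1)"

definition dmap :: "complex option \<Rightarrow> ps2 \<times> ps2" where
  "dmap d = (case d of None \<Rightarrow> (Y2, X2) | Some c \<Rightarrow> (X2, Y2 + const2 c * X2))"

lemma diff2_dmap [simp]: "diff2 (dmap d)"
  by (auto simp: diff2_def fixes0_def max_ideal_def jac_def dmap_def coeff2_X2 coeff2_Y2 split: option.split)

lemma blowup_chart_dline: "blowup_chart (dline d) = comp2 (dmap d) B0"
proof (cases d)
  case None
  then show ?thesis by (simp add: blowup_chart_def dline_def line_def dmap_def comp2_def B0_def[symmetric])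
    (simp add: B0_def)
next
  case (Some c)
  have "(THE c'. (1, c') \<in> line (- c) 1) = c" by (rule the_equality) (auto simp: line_def)
  then show ?thesis using Some fixes0_B0
    by (simp add: blowup_chart_def dline_def dmap_def comp2_def line_def) (simp add: B0_def algebra_simps)
qed

lemma dline_inj: "dline d = dline e \<Longrightarrow> d = e"
proof -
  assume eq: "dline d = dline e"
  have "(0, 1) \<in> dline d \<longleftrightarrow> d = None" "(1, c) \<in> dline d \<longleftrightarrow> d = Some c" for d c
    by (auto simp: dline_def line_def split: option.split)
  then show "d = e" using eq by (metis not_Some_eq)
qed

definition lform :: "complex \<Rightarrow> complex \<Rightarrow> ps2" where "lform a b = const2 a * X2 + const2 b * Y2"

lemma coeff2_lform: "coeff2 (lform a b) i j = (if i = 1 \<and> j = 0 then a else if i = 0 \<and> j = 1 then b else 0)"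
  by (auto simp: lform_def coeff2_X2 coeff2_Y2)

lemma subst2_lform_dmap:
  "subst2 (lform a b) (dmap d) = (case d of None \<Rightarrow> lform b a | Some c \<Rightarrow> lform (a + b * c) b)"
  by (cases d) (auto simp: lform_def dmap_def const2_hom algebra_simps fixes0_def max_ideal_def coeff2_X2 coeff2_Y2)

lemma line_eq_dline:
  assumes ab: "(a, b) \<noteq> (0, 0)" and z: "coeff2 (subst2 (lform a b) (dmap d)) 1 0 = 0"
  shows "line a b = dline d"
proof (cases d)
  case None
  then have "b = 0" "a \<noteq> 0" using ab z by (auto simp: subst2_lform_dmap coeff2_lform)
  then show ?thesis using None by (auto simp: dline_def line_def)
next
  case (Some c)
  then have *: "a = - b * c" "b \<noteq> 0" using ab z by (auto simp: subst2_lform_dmap coeff2_lform eq_neg_iff_add_eq_0)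
  have "a * u + b * v = b * (- c * u + 1 * v)" for u v by (simp add: *(1) algebra_simps)
  then show ?thesis using Some *(2) by (simp add: dline_def line_def)
qed

lemma dline_lform: obtains a b where "(a, b) \<noteq> (0, 0)" "subst2 (lform a b) (dmap d) = Y2"
proof (cases d)
  case None
  then show ?thesis using that[of 1 0] by (simp add: subst2_lform_dmap) (simp add: lform_def)
next
  case (Some c)
  then show ?thesis using that[of "- c" 1] by (simp add: subst2_lform_dmap) (simp add: lform_def)
qed

text \<open>\<open>pure f m d\<close> says that the initial form of \<open>f\<close> has degree \<open>m\<close> and is a power of a linear form
  defining \<open>d\<close>; the change of coordinates \<open>dmap d\<close> turns it into a multiple of \<open>y\<^sup>m\<close>.\<close>

definition pure :: "ps2 \<Rightarrow> nat \<Rightarrow> complex option \<Rightarrow> bool" where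
  "pure f m d \<longleftrightarrow> (\<exists>c. c \<noteq> 0 \<and> wt 1 1 (Suc m) (subst2 f (dmap d) - const2 c * Y2 ^ m))"

lemma wt_subst2_diff2_iff:
  assumes "diff2 \<phi>" shows "wt 1 1 n (subst2 f \<phi>) \<longleftrightarrow> wt 1 1 n f"
  using wt_subst2_11[of \<phi> n f] wt_subst2_11[of "inv2 \<phi>" n "subst2 f \<phi>"] assms by auto

lemma coeff2_Y2_power: "coeff2 (Y2 ^ m) i j = (if i = 0 \<and> j = m then 1 else 0)"
  using coeff2_monom[of 0 m i j] by simp

lemma pure_wt:
  assumes "pure f m d" shows "wt 1 1 m f" "\<not> wt 1 1 (Suc m) f"
proof -
  obtain c where c: "c \<noteq> 0" "wt 1 1 (Suc m) (subst2 f (dmap d) - const2 c * Y2 ^ m)" using assms by (auto simp: pure_def)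
  have "wt 1 1 m (subst2 f (dmap d))"
    using wt_mono[OF c(2), of m] wt_cong[of 1 1 m] by (auto simp: wt_def coeff2_Y2_power)
  then show "wt 1 1 m f" by (simp add: wt_subst2_diff2_iff)
  have "coeff2 (subst2 f (dmap d)) 0 m \<noteq> 0" using wtD[OF c(2), of 0 m] c(1) by (simp add: coeff2_Y2_power)
  then have "\<not> wt 1 1 (Suc m) (subst2 f (dmap d))" using wtD[of 1 1 "Suc m" _ 0 m] by auto
  then show "\<not> wt 1 1 (Suc m) f" by (simp add: wt_subst2_diff2_iff)
qed

lemma wt_unit_mult: assumes "coeff2 u 0 0 \<noteq> 0" shows "wt 1 1 n (u * f) \<longleftrightarrow> wt 1 1 n f"
proof -
  obtain v where v: "u * v = 1" using ps2_unit_inverse[OF assms] by metis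
  then have "f = v * (u * f)" by (metis mult.assoc mult.commute mult.left_neutral)
  then show ?thesis using wt_mult_left by metis
qed

lemma pure_unit_mult:
  assumes u: "coeff2 u 0 0 \<noteq> 0" and f: "pure f m d" shows "pure (u * f) m d"
proof -
  obtain c where c: "c \<noteq> 0" "wt 1 1 (Suc m) (subst2 f (dmap d) - const2 c * Y2 ^ m)" using f by (auto simp: pure_def)
  let ?u = "subst2 u (dmap d)"
  have "wt 1 1 (1 + m) ((?u - const2 (coeff2 u 0 0)) * (const2 c * Y2 ^ m))"
    by (intro wt_mult wt_mult_left) (auto simp: wt_def coeff2_const2 coeff2_Y2_power)
  moreover have "wt 1 1 (Suc m) (?u * (subst2 f (dmap d) - const2 c * Y2 ^ m))" by (rule wt_mult_left[OF c(2)])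
  moreover have "subst2 (u * f) (dmap d) - const2 (coeff2 u 0 0 * c) * Y2 ^ m
     = ?u * (subst2 f (dmap d) - const2 c * Y2 ^ m) + (?u - const2 (coeff2 u 0 0)) * (const2 c * Y2 ^ m)"
    by (simp add: algebra_simps const2_hom)
  ultimately have "wt 1 1 (Suc m) (subst2 (u * f) (dmap d) - const2 (coeff2 u 0 0 * c) * Y2 ^ m)"
    by (simp add: wt_add plus_1_eq_Suc)
  then show ?thesis unfolding pure_def using u c(1) by (intro exI[of _ "coeff2 u 0 0 * c"]) auto
qed

lemma principal_dvd: "principal f = principal g \<longleftrightarrow> f dvd g \<and> g dvd f"
proof
  assume eq: "principal f = principal g"
  have "f \<in> principal f" "g \<in> principal g" unfolding principal_def by (metis (mono_tags) mem_Collect_eq mult.right_neutral)+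
  then have "f \<in> principal g" "g \<in> principal f" using eq by auto
  then show "f dvd g \<and> g dvd f" unfolding principal_def dvd_def by blast
next
  assume fg: "f dvd g \<and> g dvd f"
  have P: "principal f = {h. f dvd h}" for f by (auto simp: principal_def dvd_def)
  show "principal f = principal g" unfolding P using fg by (blast intro: dvd_trans)
qed

lemma principal_eqE:
  assumes "principal f = principal g" "f \<noteq> 0" obtains u where "g = u * f" "coeff2 u 0 0 \<noteq> 0"
proof -
  have "f dvd g" "g dvd f" using assms(1) by (auto simp: principal_dvd)
  then obtain u v where uv: "g = f * u" "f = g * v" by (metis dvdE)
  then have "f * (u * v) = f * 1" by (metis mult.assoc mult.right_neutral)
  then have "u * v = 1" using assms(2) by (metis mult_left_cancel)
  then have "coeff2 u 0 0 \<noteq> 0" using coeff2_mult_00[of u v] by (auto simp: coeff2_1)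
  then show ?thesis using that[of u] uv(1) by (simp add: mult.commute)
qed

lemma principal_unit_mult: "coeff2 u 0 0 \<noteq> 0 \<Longrightarrow> principal (u * f) = principal f"
proof -
  assume "coeff2 u 0 0 \<noteq> 0"
  then obtain v where v: "u * v = 1" using ps2_unit_inverse by metis
  then have "f = (u * f) * v" by (metis mult.assoc mult.commute mult.left_neutral)
  then show ?thesis unfolding principal_dvd by (metis dvd_triv_left dvd_triv_right)
qed

lemma pure_nonzero: "pure f m d \<Longrightarrow> f \<noteq> 0"
  using pure_wt(2)[of f m d] by auto

lemma pure_multiplicity:
  assumes "pure f m d" shows "multiplicity_at_0 (principal f) = m"
  unfolding multiplicity_at_0_def
proof (rule the_equality)
  show "\<exists>g. principal f = principal g \<and> g \<in> max_ideal_pow m - max_ideal_pow (Suc m)"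
    using pure_wt[OF assms] by (auto simp: mem_max_ideal_pow_wt)
  fix n assume "\<exists>g. principal f = principal g \<and> g \<in> max_ideal_pow n - max_ideal_pow (Suc n)"
  then obtain g where g: "principal f = principal g" "wt 1 1 n g" "\<not> wt 1 1 (Suc n) g" by (auto simp: mem_max_ideal_pow_wt)
  obtain u where "g = u * f" "coeff2 u 0 0 \<noteq> 0" using principal_eqE[OF g(1) pure_nonzero[OF assms]] .
  then have "wt 1 1 n f" "\<not> wt 1 1 (Suc n) f" using g wt_unit_mult by auto
  then show "n = m" using pure_wt[OF assms] wt_mono by (metis not_less_eq_eq order_antisym_conv)
qed

lemma pure_tangent_direction:
  assumes f: "pure f m d" and m: "1 \<le> m" shows "tangent_direction (principal f) = dline d"
  unfolding tangent_direction_def pure_multiplicity[OF f]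
proof (rule the_equality)
  obtain c where c: "c \<noteq> 0" "wt 1 1 (Suc m) (subst2 f (dmap d) - const2 c * Y2 ^ m)" using f by (auto simp: pure_def)
  obtain a b where ab: "(a, b) \<noteq> (0, 0)" "subst2 (lform a b) (dmap d) = Y2" using dline_lform .
  have "coeff2 (subst2 (lform a b) (dmap d)) 1 0 = 0" by (simp add: ab coeff2_Y2)
  then have L: "dline d = line a b" using line_eq_dline[OF ab(1)] by simp
  have "wt 1 1 (Suc m) (const2 (1 / c) * (subst2 f (dmap d) - const2 c * Y2 ^ m))" by (rule wt_mult_left[OF c(2)])
  also have "const2 (1 / c) * (subst2 f (dmap d) - const2 c * Y2 ^ m) = subst2 (const2 (1 / c) * f - lform a b ^ m) (dmap d)"
    using c(1) by (simp add: ab right_diff_distrib flip: mult.assoc const2_hom)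
  finally have "wt 1 1 (Suc m) (const2 (1 / c) * f - lform a b ^ m)" by (simp only: wt_subst2_diff2_iff diff2_dmap)
  moreover have "principal f = principal (const2 (1 / c) * f)"
    using principal_unit_mult[of "const2 (1 / c)" f] c(1) by (simp add: coeff2_const2)
  ultimately show "\<exists>f' a b. principal f = principal f' \<and> (a, b) \<noteq> (0, 0) \<and> dline d = line a b \<and>
      f' - (const2 a * X2 + const2 b * Y2) ^ m \<in> max_ideal_pow (Suc m)"
    unfolding mem_max_ideal_pow_wt using ab(1) L by (metis lform_def)
next
  fix L assume "\<exists>f' a b. principal f = principal f' \<and> (a, b) \<noteq> (0, 0) \<and> L = line a b \<and>
      f' - (const2 a * X2 + const2 b * Y2) ^ m \<in> max_ideal_pow (Suc m)"
  then obtain g a b where g: "principal f = principal g" "(a, b) \<noteq> (0, 0)" "L = line a b" "wt 1 1 (Suc m) (g - lform a b ^ m)"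
    unfolding mem_max_ideal_pow_wt lform_def by blast
  obtain u where u: "g = u * f" "coeff2 u 0 0 \<noteq> 0" using principal_eqE[OF g(1) pure_nonzero[OF f]] .
  obtain c where c: "c \<noteq> 0" "wt 1 1 (Suc m) (subst2 g (dmap d) - const2 c * Y2 ^ m)"
    using pure_unit_mult[OF u(2) f] u(1) by (auto simp: pure_def)
  let ?l = "subst2 (lform a b) (dmap d)"
  have "wt 1 1 (Suc m) (subst2 (g - lform a b ^ m) (dmap d))" using g(4) by (simp only: wt_subst2_diff2_iff diff2_dmap)
  then have "coeff2 (subst2 g (dmap d)) m 0 = coeff2 (?l ^ m) m 0" by (auto simp: wt_def)
  moreover have "coeff2 (subst2 g (dmap d)) m 0 = 0" using wtD[OF c(2), of m 0] m by (simp add: coeff2_Y2_power)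
  moreover have "coeff2 ?l 0 0 = 0" by (simp add: coeff2_lform)
  ultimately have "coeff2 ?l 1 0 = 0" using coeff2_power_lead[of ?l m] by simp
  then show "L = dline d" using line_eq_dline g by simp
qed

lemma pure_blow_up:
  assumes "pure f m d"
  obtains g where "subst2 (subst2 f (dmap d)) B0 = X2 ^ m * g" "yreg m g" "\<And>j. j \<noteq> m \<Longrightarrow> coeff2 g 0 j = 0" "yreg m (subst2 f (dmap d))"
proof -
  obtain c where c: "c \<noteq> 0" "wt 1 1 (Suc m) (subst2 f (dmap d) - const2 c * Y2 ^ m)" using assms by (auto simp: pure_def)
  have co: "coeff2 (subst2 f (dmap d)) i j = (if j = m then c else 0)" if "i + j = m" for i j
    using wtD[OF c(2), of i j] that by (auto simp: coeff2_Y2_power)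
  have w: "wt 1 1 m (subst2 f (dmap d))" using pure_wt(1)[OF assms] by (simp add: wt_subst2_diff2_iff)
  obtain g where g: "subst2 (subst2 f (dmap d)) B0 = X2 ^ m * g"
    "\<And>i j. coeff2 g i j = (if j \<le> i + m then coeff2 (subst2 f (dmap d)) (i + m - j) j else 0)"
    using blow_up_factor[OF w] by metis
  show ?thesis
    by (rule that[OF g(1)]) (use co c(1) w in \<open>auto simp: yreg_def g(2) wt_def\<close>)
qed

lemma pure_strict_transform:
  assumes f: "pure f m d" and m: "1 \<le> m" and g: "subst2 (subst2 f (dmap d)) B0 = X2 ^ m * g"
  shows "strict_transform (principal f) = principal g"
  unfolding strict_transform_def pure_multiplicity[OF f] pure_tangent_direction[OF f m] blowup_chart_dline
proof (rule the_equality)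
  show "\<exists>f' g'. principal f = principal f' \<and> principal g = principal g' \<and> subst2 f' (comp2 (dmap d) B0) = X2 ^ m * g'"
    using g by (metis subst2_comp2 diff2_dmap diff2_fixes0 fixes0_B0)
  fix \<delta> assume "\<exists>f' g'. principal f = principal f' \<and> \<delta> = principal g' \<and> subst2 f' (comp2 (dmap d) B0) = X2 ^ m * g'"
  then obtain f' g' where f': "principal f = principal f'" "\<delta> = principal g'" "subst2 f' (comp2 (dmap d) B0) = X2 ^ m * g'" by blast
  obtain u where u: "f' = u * f" "coeff2 u 0 0 \<noteq> 0" using principal_eqE[OF f'(1) pure_nonzero[OF f]] .
  let ?u = "subst2 (subst2 u (dmap d)) B0"
  have "X2 ^ m * g' = X2 ^ m * (?u * g)" using f'(3) by (simp add: subst2_comp2 u g mult.left_commute)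
  then have "g' = ?u * g" by simp
  then show "\<delta> = principal g" unfolding f'(2) using principal_unit_mult[of ?u g] u(2) by simp
qed

section \<open>Irreducible curves have a tangent direction and irreducible strict transforms\<close>

lemma irreducible_subst2:
  assumes "diff2 \<phi>" "irreducible f" shows "irreducible (subst2 f \<phi>)"
proof -
  have u: "subst2 g \<phi> dvd 1 \<longleftrightarrow> g dvd 1" for g using assms(1) by (simp add: ps2_dvd_1_iff)
  have "subst2 f \<phi> \<noteq> 0"
  proof
    assume "subst2 f \<phi> = 0"
    then have "f = 0" using subst2_inv2(1)[OF assms(1), of f] by simp
    then show False using assms(2) by simp
  qed
  moreover have "a dvd 1 \<or> b dvd 1" if "subst2 f \<phi> = a * b" for a b
  proof -
    have "f = subst2 a (inv2 \<phi>) * subst2 b (inv2 \<phi>)" using subst2_inv2(1)[OF assms(1), of f] assms(1) that by simp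
    then have "subst2 a (inv2 \<phi>) dvd 1 \<or> subst2 b (inv2 \<phi>) dvd 1" using assms(2) by (simp add: irreducible_def)
    then show ?thesis using assms(1) by (simp add: ps2_dvd_1_iff)
  qed
  ultimately show ?thesis using assms(2) u by (simp add: irreducible_def)
qed

lemma coeff2_subst2_swap: "coeff2 (subst2 f (dmap None)) i j = coeff2 f j i"
proof -
  have c: "coeff2 (fst (dmap None) ^ a * snd (dmap None) ^ b) i j = (if a = j \<and> b = i then 1 else 0)" for a b
    using coeff2_monom[of b a i j] by (auto simp: dmap_def mult.commute)
  have "coeff2 (subst2 f (dmap None)) i j = (\<Sum>x\<in>{(a, b). a + b \<le> i + j}. if x = (j, i) then coeff2 f j i else 0)"
    unfolding subst2_def coeff2_mk_ps2 by (rule sum.cong) (auto simp: c split: if_splits)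
  then show ?thesis by simp
qed

text \<open>The restriction of \<open>f\<close> to the curve \<open>y = c x\<^sup>e\<close> depends polynomially on \<open>c\<close>.\<close>

lemma coeff2_subst2_parabola:
  assumes e: "1 \<le> e"
  shows "coeff2 (subst2 f (X2, Y2 + const2 c * X2 ^ e)) n 0 = (\<Sum>b\<le>n. (if e * b \<le> n then coeff2 f (n - e * b) b else 0) * c ^ b)"
proof -
  have co: "coeff2 (X2 ^ a * (Y2 + const2 c * X2 ^ e) ^ b) n 0 = (if a + e * b = n then c ^ b else 0)" for a b
  proof -
    have "fps_nth (X2 ^ a * (Y2 + const2 c * X2 ^ e) ^ b) 0 = fps_X ^ a * (fps_const c * fps_X ^ e) ^ b"
      by (simp add: fps_power_zeroth X2_def Y2_def const2_def)
    also have "\<dots> = fps_const (c ^ b) * fps_X ^ (a + e * b)"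
      by (simp add: power_mult_distrib power_add mult.left_commute flip: power_mult fps_const_power)
    finally show ?thesis by (simp add: coeff2_def)
  qed
  have b: "b \<le> n" if "e * b \<le> n" for b using that e by (metis le_trans mult_le_mono1 nat_mult_1)
  have "coeff2 (subst2 f (X2, Y2 + const2 c * X2 ^ e)) n 0 = (\<Sum>x\<in>{(a, b). a + b \<le> n}. if fst x + e * snd x = n then coeff2 f (fst x) (snd x) * c ^ snd x else 0)"
    unfolding subst2_def coeff2_mk_ps2 by (rule sum.cong) (auto simp: co)
  also have "\<dots> = (\<Sum>x\<in>(\<lambda>b. (n - e * b, b)) ` {b. e * b \<le> n}. coeff2 f (fst x) (snd x) * c ^ snd x)"
  proof (rule sum.mono_neutral_cong_right)
    show "(\<lambda>b. (n - e * b, b)) ` {b. e * b \<le> n} \<subseteq> {(a, b). a + b \<le> n}"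
    proof -
      have "n - e * b + b \<le> n" if "e * b \<le> n" for b
      proof -
        have "1 * b \<le> e * b" using e by (rule mult_le_mono1)
        then show ?thesis using that by linarith
      qed
      then show ?thesis by auto
    qed
  qed (auto simp: image_iff)
  also have "\<dots> = (\<Sum>b | e * b \<le> n. coeff2 f (n - e * b) b * c ^ b)"
    by (subst sum.reindex) (auto simp: inj_on_def)
  also have "\<dots> = (\<Sum>b\<le>n. (if e * b \<le> n then coeff2 f (n - e * b) b else 0) * c ^ b)"
    by (rule sum.mono_neutral_cong_left) (use b in auto)
  finally show ?thesis .
qed

lemma coeff2_subst2_slope: "coeff2 (subst2 f (dmap (Some c))) n 0 = (\<Sum>b\<le>n. coeff2 f (n - b) b * c ^ b)"
proof -
  have "(\<Sum>b\<le>n. (if 1 * b \<le> n then coeff2 f (n - 1 * b) b else 0) * c ^ b) = (\<Sum>b\<le>n. coeff2 f (n - b) b * c ^ b)"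
    by (rule sum.cong) auto
  then show ?thesis using coeff2_subst2_parabola[of 1 f c n] by (simp add: dmap_def)
qed

text \<open>
  Choose coordinates in which \<open>y\<close> divides the initial form, and let \<open>a \<ge> 1\<close> be its multiplicity there. The
  strict transform at the direction \<open>y = 0\<close> then has order \<open>a\<close> on the exceptional divisor, and if \<open>a\<close> were less than
  the order \<open>m\<close> of \<open>f\<close>, it would blow down to a proper factor of \<open>f\<close>. So the initial form is a multiple of \<open>y\<^sup>m\<close>.
\<close>

lemma irreducible_pure:
  assumes irr: "irreducible f" and f: "f \<in> max_ideal"
  obtains m d where "1 \<le> m" "pure f m d"
proof -
  have "f \<noteq> 0" using irr by auto
  then have "\<exists>n. \<not> wt 1 1 n f" using wt_all_0 by blast
  define n where "n = (LEAST n. \<not> wt 1 1 n f)"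
  have n: "\<not> wt 1 1 n f" "\<And>k. k < n \<Longrightarrow> wt 1 1 k f"
    unfolding n_def using LeastI_ex[OF \<open>\<exists>n. _\<close>] not_less_Least by blast+
  have "n \<noteq> 0" "n \<noteq> 1" using n(1) f by (auto simp: max_ideal_wt intro!: Nat.gr0I)
  then obtain m where m: "n = Suc m" "1 \<le> m" by (cases n) auto
  have w: "wt 1 1 m f" "\<not> wt 1 1 (Suc m) f" using n m by auto
  define p where "p = (\<Sum>j\<le>m. monom (coeff2 f (m - j) j) j)"
  have cp: "coeff p j = (if j \<le> m then coeff2 f (m - j) j else 0)" for j
    by (auto simp: p_def coeff_sum if_distrib[of "\<lambda>x. x _"] cong: if_cong)
  have top: "\<exists>j\<le>m. coeff2 h (m - j) j \<noteq> 0" if h: "wt 1 1 m h" "\<not> wt 1 1 (Suc m) h" for h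
  proof -
    obtain i j where "i + j < Suc m" "coeff2 h i j \<noteq> 0" using h(2) by (auto simp: wt_def)
    moreover from this have "i + j = m" using wtD[OF h(1), of i j] by fastforce
    ultimately show ?thesis by (metis add_diff_cancel_right' le_add2)
  qed
  show ?thesis
  proof (cases "constant (poly p)")
    case True
    have "degree p = 0" using True constant_degree by blast
    then have z: "coeff2 f (m - j) j = 0" if "j \<le> m" "j \<noteq> 0" for j
      using cp[of j] that coeff_eq_0[of p j] by simp
    then have "coeff2 f m 0 \<noteq> 0" using top[OF w] by (metis diff_zero)
    moreover have "wt 1 1 (Suc m) (subst2 f (dmap None) - const2 (coeff2 f m 0) * Y2 ^ m)"
      unfolding wt_def coeff2_linear coeff2_subst2_swap coeff2_Y2_power
    proof (intro allI impI)
      fix i j assume ij: "1 * i + 1 * j < Suc m"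
      show "coeff2 f j i - coeff2 f m 0 * (if i = 0 \<and> j = m then 1 else 0) = 0"
        using ij z[of i] wtD[OF w(1), of j i] by (cases "i + j = m"; cases "i = 0") auto
    qed
    ultimately show ?thesis using that[of m None] m(2) by (auto simp: pure_def)
  next
    case False
    then obtain c where c: "poly p c = 0" using fundamental_theorem_of_algebra by blast
    let ?h = "subst2 f (dmap (Some c))"
    have h: "wt 1 1 m ?h" "\<not> wt 1 1 (Suc m) ?h" using w by (simp_all add: wt_subst2_diff2_iff)
    obtain g where g: "subst2 ?h B0 = X2 ^ m * g" "\<And>i j. coeff2 g i j = (if j \<le> i + m then coeff2 ?h (i + m - j) j else 0)"
      using blow_up_factor[OF h(1)] by metis
    have "poly p c = (\<Sum>j\<le>m. coeff2 f (m - j) j * c ^ j)" by (simp add: p_def poly_sum poly_monom)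
    then have g0: "coeff2 g 0 0 = 0" using c by (simp add: g(2) coeff2_subst2_slope)
    have ex: "\<exists>j. coeff2 g 0 j \<noteq> 0" using top[OF h] by (auto simp: g(2))
    define a where "a = (LEAST j. coeff2 g 0 j \<noteq> 0)"
    have a: "coeff2 g 0 a \<noteq> 0" "\<And>j. j < a \<Longrightarrow> coeff2 g 0 j = 0"
      unfolding a_def using LeastI_ex[OF ex] not_less_Least by blast+
    have "1 \<le> a" using a(1) g0 by (cases a) (auto simp: One_nat_def)
    moreover have "a \<le> m" using a(1) by (auto simp: g(2) split: if_splits)
    moreover have "irreducible ?h" using irreducible_subst2[OF diff2_dmap irr] .
    ultimately have "a = m"
      using blow_down_reducible[OF h(1), of g a] a g(1) by (fastforce simp: yreg_def)
    have "wt 1 1 (Suc m) (?h - const2 (coeff2 ?h 0 m) * Y2 ^ m)"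
      unfolding wt_def coeff2_linear coeff2_Y2_power
    proof (intro allI impI)
      fix i j assume ij: "1 * i + 1 * j < Suc m"
      have "coeff2 ?h (m - j) j = 0" if "j < m" using a(2)[of j] that \<open>a = m\<close> by (simp add: g(2))
      then show "coeff2 ?h i j - coeff2 ?h 0 m * (if i = 0 \<and> j = m then 1 else 0) = 0"
        using ij wtD[OF h(1), of i j] by (cases "i + j = m"; cases "j = m") auto
    qed
    moreover have "coeff2 ?h 0 m \<noteq> 0" using a(1) \<open>a = m\<close> by (simp add: g(2))
    ultimately show ?thesis using that[of m "Some c"] m(2) by (auto simp: pure_def)
  qed
qed

text \<open>The restriction to \<open>x = 0\<close>, the exceptional divisor of \<^const>\<open>B0\<close>.\<close>

definition restrict_x0 :: "ps2 \<Rightarrow> complex fps" where "restrict_x0 f = Abs_fps (\<lambda>j. coeff2 f 0 j)"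

lemma restrict_x0_mult: "restrict_x0 (f * g) = restrict_x0 f * restrict_x0 g"
  by (rule fps_ext) (simp add: restrict_x0_def coeff2_mult fps_mult_nth atLeast0AtMost)

text \<open>
  A factorization of the strict transform into two nonunits splits its order \<open>m\<close> on the exceptional
  divisor as \<open>a + b\<close> with \<open>a, b \<ge> 1\<close>, and then the factor of order \<open>a < m\<close> blows down to a factor of \<open>f\<close>.
\<close>

lemma irreducible_strict_transform:
  assumes irr: "irreducible f" and f: "pure f m d" "1 \<le> m" and g: "subst2 (subst2 f (dmap d)) B0 = X2 ^ m * g"
  shows "irreducible g" "g \<in> max_ideal"
proof -
  let ?h = "subst2 f (dmap d)"
  obtain g' where g': "subst2 ?h B0 = X2 ^ m * g'" "yreg m g'" "\<And>j. j \<noteq> m \<Longrightarrow> coeff2 g' 0 j = 0"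
    using pure_blow_up[OF f(1)] by blast
  have "g = g'" using g g'(1) by simp
  then have g0: "restrict_x0 g $ m \<noteq> 0" "coeff2 g 0 0 = 0" "\<And>j. j < m \<Longrightarrow> restrict_x0 g $ j = 0" using g' f(2) by (auto simp: yreg_def restrict_x0_def)
  then show "g \<in> max_ideal" by (simp add: max_ideal_def)
  have sub: "subdegree (restrict_x0 g) = m" using g0 by (intro subdegreeI) auto
  have h: "wt 1 1 m ?h" "irreducible ?h"
    using pure_wt(1)[OF f(1)] irreducible_subst2[OF diff2_dmap irr] by (simp_all add: wt_subst2_diff2_iff)
  have "a dvd 1 \<or> b dvd 1" if ab: "g = a * b" for a b
  proof (rule ccontr)
    assume "\<not> (a dvd 1 \<or> b dvd 1)"
    then have z: "restrict_x0 a $ 0 = 0" "restrict_x0 b $ 0 = 0" by (simp_all add: ps2_dvd_1_iff restrict_x0_def)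
    have nz: "restrict_x0 a \<noteq> 0" "restrict_x0 b \<noteq> 0" using g0(1) unfolding ab restrict_x0_mult by auto
    have pos: "1 \<le> subdegree (restrict_x0 a)" "1 \<le> subdegree (restrict_x0 b)"
      using z nz by (auto simp: One_nat_def Suc_le_eq subdegree_greaterI[of _ 0] intro!: Nat.gr0I) (metis nth_subdegree_nonzero)+
    have "subdegree (restrict_x0 a) + subdegree (restrict_x0 b) = m" using sub nz unfolding ab restrict_x0_mult by simp
    then have "subdegree (restrict_x0 a) < m" using pos by simp
    moreover have "yreg (subdegree (restrict_x0 a)) a"
    proof -
      have xa: "coeff2 a 0 j = restrict_x0 a $ j" for j by (simp add: restrict_x0_def)
      show ?thesis unfolding yreg_def xa using nth_subdegree_nonzero[OF nz(1)] nth_less_subdegree_zero by blast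
    qed
    moreover have "a dvd subst2 ?h B0" unfolding g ab by simp
    ultimately show False using blow_down_reducible[OF h(1)] pos(1) h(2) by blast
  qed
  moreover have "g \<noteq> 0" using g0(1) by (auto simp: restrict_x0_def)
  ultimately show "irreducible g" using g0(2) by (auto simp: irreducible_def ps2_dvd_1_iff)
qed

section \<open>Resolution of irreducible curves\<close>

text \<open>The curve \<open>f\<close> of multiplicity \<open>m\<close> and direction \<open>d\<close> has strict transform \<open>g\<close>.\<close>

definition blow_step :: "ps2 \<Rightarrow> nat \<Rightarrow> complex option \<Rightarrow> ps2 \<Rightarrow> bool" where
  "blow_step f m d g \<longleftrightarrow> irreducible f \<and> f \<in> max_ideal \<and> 1 \<le> m \<and> pure f m d \<and> subst2 (subst2 f (dmap d)) B0 = X2 ^ m * g"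

lemma blow_step_exists:
  assumes "irreducible f" "f \<in> max_ideal" obtains m d g where "blow_step f m d g"
proof -
  obtain m d where md: "1 \<le> m" "pure f m d" using irreducible_pure[OF assms] .
  then show ?thesis using that assms pure_blow_up[OF md(2)] unfolding blow_step_def by metis
qed

lemma blow_step_next: "blow_step f m d g \<Longrightarrow> irreducible g \<and> g \<in> max_ideal"
  using irreducible_strict_transform unfolding blow_step_def by blast

lemma blow_step_yreg:
  assumes "blow_step f m d g" shows "yreg m g" "yreg m (subst2 f (dmap d))"
proof -
  obtain g' where "subst2 (subst2 f (dmap d)) B0 = X2 ^ m * g'" "yreg m g'" "yreg m (subst2 f (dmap d))"
    using pure_blow_up assms unfolding blow_step_def by metis
  then show "yreg m g" "yreg m (subst2 f (dmap d))" using assms by (auto simp: blow_step_def)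
qed

lemma blow_step_curve:
  assumes "blow_step f m d g"
  shows "tangent_direction (principal f) = dline d" "strict_transform (principal f) = principal g"
  using assms pure_tangent_direction pure_strict_transform unfolding blow_step_def by blast+

text \<open>Equations, multiplicities and directions of a curve and all its strict transforms.\<close>

definition blow_seq :: "(nat \<Rightarrow> ps2) \<Rightarrow> (nat \<Rightarrow> nat) \<Rightarrow> (nat \<Rightarrow> complex option) \<Rightarrow> bool" where
  "blow_seq fs ms ds \<longleftrightarrow> (\<forall>k. blow_step (fs k) (ms k) (ds k) (fs (Suc k)))"

lemma blow_seq_exists:
  assumes "irreducible f" "f \<in> max_ideal"
  obtains fs ms ds where "fs 0 = f" "blow_seq fs ms ds"
proof -
  define nxt where "nxt h = (SOME g. \<exists>m d. blow_step h m d g)" for h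
  have nxt: "\<exists>m d. blow_step h m d (nxt h)" if "irreducible h \<and> h \<in> max_ideal" for h
    unfolding nxt_def by (rule someI_ex) (use blow_step_exists that in blast)
  define fs where "fs k = (nxt ^^ k) f" for k
  have fs_Suc: "fs (Suc k) = nxt (fs k)" and fs0: "fs 0 = f" for k by (simp_all add: fs_def)
  have inv: "irreducible (fs k) \<and> fs k \<in> max_ideal" for k
  proof (induction k)
    case (Suc k)
    then show ?case unfolding fs_Suc using nxt blow_step_next by blast
  qed (simp add: fs0 assms)
  have "\<forall>k. \<exists>m d. blow_step (fs k) m d (fs (Suc k))" unfolding fs_Suc using nxt inv by blast
  then obtain ms ds where "\<forall>k. blow_step (fs k) (ms k) (ds k) (fs (Suc k))" by metis
  then show ?thesis by (intro that[of fs ms ds]) (simp_all add: fs0 blow_seq_def)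
qed

lemma blow_seqD: "blow_seq fs ms ds \<Longrightarrow> blow_step (fs k) (ms k) (ds k) (fs (Suc k))"
  by (simp add: blow_seq_def)

lemma curve_at_blow_seq: "blow_seq fs ms ds \<Longrightarrow> curve_at (principal (fs 0)) k = principal (fs k)"
  by (induction k) (auto simp: blow_step_curve(2)[OF blow_seqD])

text \<open>Series in \<open>x\<close> alone, without constant term; \<open>y = s\<close> is then a smooth curve.\<close>

definition xonly :: "ps2 \<Rightarrow> bool" where
  "xonly s \<longleftrightarrow> coeff2 s 0 0 = 0 \<and> (\<forall>i j. 0 < j \<longrightarrow> coeff2 s i j = 0)"

lemma xonly_minus: "xonly s \<Longrightarrow> xonly (- s)" by (simp add: xonly_def)

lemma coeff2_X2_power: "coeff2 (X2 ^ m) i j = (if i = m \<and> j = 0 then 1 else 0)"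
  using coeff2_monom[of m 0 i j] by simp

lemma subst2_xonly:
  assumes "xonly s" "fst \<phi> = X2" "fixes0 \<phi>" shows "subst2 s \<phi> = s"
proof (rule ps2_eqI)
  fix i j
  have "coeff2 (subst2 s \<phi>) i j = (\<Sum>x\<in>{(a, b). a + b \<le> i + j}. if x = (i, 0) then coeff2 s i j else 0)"
    unfolding subst2_def coeff2_mk_ps2
  proof (rule sum.cong[OF refl])
    fix x assume "x \<in> {(a, b). a + b \<le> i + j}"
    obtain a b where x: "x = (a, b)" by (cases x)
    show "(case x of (a, b) \<Rightarrow> coeff2 s a b * coeff2 (fst \<phi> ^ a * snd \<phi> ^ b) i j) = (if x = (i, 0) then coeff2 s i j else 0)"
      using assms(1) by (cases "b = 0"; cases "j = 0") (auto simp: x xonly_def assms(2) coeff2_X2_power)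
  qed
  then show "coeff2 (subst2 s \<phi>) i j = coeff2 s i j" by simp
qed

definition shear :: "ps2 \<Rightarrow> ps2 \<times> ps2" where "shear s = (X2, Y2 + s)"

lemma diff2_shear [simp]: "xonly s \<Longrightarrow> diff2 (shear s)"
  by (auto simp: shear_def diff2_def fixes0_def max_ideal_def jac_def coeff2_X2 coeff2_Y2 xonly_def)

lemma subst2_shear: "xonly s \<Longrightarrow> xonly t \<Longrightarrow> subst2 (Y2 + t) (shear s) = Y2 + s + t"
  using subst2_xonly[of t "shear s"] diff2_fixes0[OF diff2_shear, of s] by (simp add: shear_def)

lemma inv2_shear: "xonly s \<Longrightarrow> inv2 (shear s) = shear (- s)"
proof -
  assume s: "xonly s"
  have "fst (shear t) = X2" "snd (shear t) = Y2 + t" for t by (simp_all add: shear_def)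
  then have "comp2 (shear (- s)) (shear s) = id2"
    using subst2_shear[OF s xonly_minus[OF s]] diff2_fixes0[OF diff2_shear[OF s]]
    by (simp add: comp2_def id2_def del: subst2_add)
  then show ?thesis by (rule inv2_unique[OF diff2_shear diff2_shear, rotated 2]) (use s xonly_minus in auto)
qed

lemma graph_root_dvd:
  assumes s: "xonly s" and z: "subst2 f (X2, s) = 0" shows "Y2 - s dvd f"
proof -
  have p: "fixes0 (X2, s)" "fixes0 (X2, 0)" using s by (auto simp: fixes0_def max_ideal_def coeff2_X2 xonly_def)
  have ps: "fixes0 (shear s)" using s by simp
  let ?h = "subst2 f (shear s)"
  have "comp2 (shear s) (X2, 0) = (X2, s)" using subst2_xonly[OF s, of "(X2, 0)"] p by (simp add: comp2_def shear_def)
  then have "subst2 ?h (X2, 0) = 0" using z p ps by (metis subst2_comp2)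
  moreover have "coeff2 (subst2 ?h (X2, 0)) i 0 = coeff2 ?h i 0" for i
    using coeff2_subst2_lead(1)[of "(X2, 0)" "Suc i" i "?h - (\<Sum>k<i. const2 (coeff2 ?h k 0) * X2 ^ k)"] p
    by (simp add: lam_def coeff2_X2 coeff2_X2_power if_distrib[of "\<lambda>x. _ * x"] cong: if_cong)
  ultimately have "Y2 dvd ?h" by (simp add: wt_01_iff flip: y_dvd_iff)
  then obtain u where "?h = Y2 * u" by (rule dvdE)
  then have "subst2 ?h (inv2 (shear s)) = subst2 (Y2 * u) (inv2 (shear s))" by simp
  moreover have "subst2 Y2 (inv2 (shear s)) = Y2 - s"
    using inv2_shear[OF s] diff2_fixes0[OF diff2_shear, OF xonly_minus, OF s] by (simp add: shear_def)
  ultimately have "f = (Y2 - s) * subst2 u (inv2 (shear s))" using s by simp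
  then show ?thesis by (metis dvd_triv_left)
qed

text \<open>The Weierstrass polynomial of degree one of \<open>f\<close> is \<open>y - s\<close>.\<close>

lemma yreg_graph:
  assumes "yreg 1 f" obtains s u where "xonly s" "f = u * (Y2 - s)" "coeff2 u 0 0 \<noteq> 0"
proof -
  obtain W q where W: "W = q * f" "coeff2 q 0 0 \<noteq> 0" "\<And>i. coeff2 W i 1 = (if i = 0 then 1 else 0)"
    "\<And>j. j < 1 \<Longrightarrow> coeff2 W 0 j = 0" "\<And>i j. 1 < j \<Longrightarrow> coeff2 W i j = 0"
    using weierstrass_preparation[OF assms] by blast
  obtain v where v: "q * v = 1" "coeff2 v 0 0 * coeff2 q 0 0 = 1" using ps2_unit_inverse[OF W(2)] .
  have j: "j = 0 \<or> j = 1 \<or> 1 < j" for j :: nat by linarith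
  have "coeff2 (Y2 - W) i j = 0" if "0 < j" for i j using W(3,5) j[of j] that by (auto simp: coeff2_Y2)
  then have "xonly (Y2 - W)" using W(4)[of 0] by (simp add: xonly_def coeff2_Y2)
  moreover have "f = v * (Y2 - (Y2 - W))" using v(1) W(1) by (simp flip: mult.assoc) (simp add: mult.commute)
  ultimately show ?thesis using that v(2) by fastforce
qed

lemma pure_nonvertical:
  assumes "pure f m d" "coeff2 f 0 m \<noteq> 0" "1 \<le> m" obtains c where "d = Some c"
proof (cases d)
  case None
  then have "wt 1 1 (Suc m) (subst2 f (dmap None) - const2 c * Y2 ^ m) \<Longrightarrow> False" for c
    using wtD[of 1 1 "Suc m" _ m 0] assms(2,3) by (fastforce simp: coeff2_subst2_swap coeff2_Y2_power)
  then show ?thesis using assms(1) None by (auto simp: pure_def)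
qed

lemma pure_1_Some:
  assumes "pure f 1 (Some c)" shows "coeff2 f 0 1 \<noteq> 0" "coeff2 f 1 0 = - c * coeff2 f 0 1"
proof -
  obtain e where e: "e \<noteq> 0" "wt 1 1 2 (subst2 f (dmap (Some c)) - const2 e * Y2)" using assms by (auto simp: pure_def)
  have p: "fixes0 (dmap (Some c))" by simp
  have d: "fst (dmap (Some c)) = X2" "snd (dmap (Some c)) = Y2 + const2 c * X2" by (simp_all add: dmap_def)
  have "coeff2 (subst2 f (dmap (Some c))) 0 1 = e" "coeff2 (subst2 f (dmap (Some c))) 1 0 = 0"
    using wtD[OF e(2), of 0 1] wtD[OF e(2), of 1 0] by (simp_all add: coeff2_Y2)
  then have "coeff2 f 0 1 = e" "coeff2 f 1 0 + coeff2 f 0 1 * c = 0"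
    using coeff2_subst2_linear[OF p, of f] by (simp_all add: d coeff2_X2 coeff2_Y2)
  then show "coeff2 f 0 1 \<noteq> 0" "coeff2 f 1 0 = - c * coeff2 f 0 1"
    using e(1) by (auto simp: eq_neg_iff_add_eq_0 mult.commute)
qed

text \<open>
  A strict transform of a curve of multiplicity \<open>m\<close> meets the exceptional divisor with multiplicity \<open>m\<close>.
\<close>

lemma blow_seq_multiplicity_le: "blow_seq fs ms ds \<Longrightarrow> ms (Suc k) \<le> ms k"
proof (rule ccontr)
  assume b: "blow_seq fs ms ds" and "\<not> ms (Suc k) \<le> ms k"
  moreover have "coeff2 (fs (Suc k)) 0 (ms k) \<noteq> 0" using blow_step_yreg(1)[OF blow_seqD[OF b]] by (auto simp: yreg_def)
  moreover have "wt 1 1 (ms (Suc k)) (fs (Suc k))" using blow_seqD[OF b, of "Suc k"] pure_wt(1) by (auto simp: blow_step_def)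
  ultimately show False by (auto simp: wt_def)
qed

text \<open>If the multiplicity stayed equal to \<open>m\<close>, all further directions would be \<open>y = c\<^sub>j x\<close>; the series
  \<open>\<Sum> c\<^sub>j x\<^sup>j\<close> is then a root of \<open>f\<close>, so that \<open>f\<close> is smooth.\<close>

lemma blow_seq_resolution:
  assumes b: "blow_seq fs ms ds"
  obtains k c where "ms k = 1" "ds k = Some c"
proof -
  define M where "M = (LEAST m. \<exists>k. ms k = m)"
  obtain K where K: "ms K = M" unfolding M_def using LeastI_ex[of "\<lambda>m. \<exists>k. ms k = m"] by blast
  have "M \<le> ms k" for k unfolding M_def by (rule Least_le) blast
  moreover have "ms k \<le> ms j" if "j \<le> k" for j k
    using that by (induction rule: dec_induct) (use blow_seq_multiplicity_le[OF b] order_trans in blast)+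
  ultimately have M: "ms (K + k) = M" for k using K by (metis le_add1 order_antisym)
  have M1: "1 \<le> M" using blow_seqD[OF b, of K] K by (simp add: blow_step_def)
  define F where "F j = fs (K + Suc j)" for j
  have stepF: "blow_step (F j) M (ds (K + Suc j)) (F (Suc j))" for j
    using blow_seqD[OF b, of "K + Suc j"] M[of "Suc j"] by (simp add: F_def)
  have regF: "coeff2 (F j) 0 M \<noteq> 0" for j
    using blow_step_yreg(1)[OF blow_seqD[OF b, of "K + j"]] M[of j] by (simp add: F_def yreg_def)
  have "\<exists>c. ds (K + Suc j) = Some c" for j
    using pure_nonvertical[of "F j" M] stepF[of j] regF[of j] M1 unfolding blow_step_def by metis
  then obtain c where c: "\<And>j. ds (K + Suc j) = Some (c j)" by metis
  \<comment> \<open>The series \<open>\<Sum>\<^sub>i c\<^sub>j\<^sub>+\<^sub>i x\<^sup>i\<^sup>+\<^sup>1\<close>; the chart maps the curve \<open>y = S (j + 1)\<close> to \<open>y = S j\<close>.\<close>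
  define S where "S j = mk_ps2 (\<lambda>i l. if l = 0 \<and> 0 < i then c (j + (i - 1)) else 0)" for j
  have xS: "xonly (S j)" for j by (simp add: S_def xonly_def)
  have S_Suc: "S j = X2 * (S (Suc j) + const2 (c j))" for j
  proof (rule ps2_eqI)
    fix i l
    consider "i = 0" | "i = 1" | k where "i = Suc (Suc k)" by (metis One_nat_def not0_implies_Suc)
    then show "coeff2 (S j) i l = coeff2 (X2 * (S (Suc j) + const2 (c j))) i l"
      by cases (auto simp: S_def coeff2_X2_mult coeff2_const2 One_nat_def)
  qed
  have p: "fixes0 (X2, S j)" for j using xS[of j] by (simp add: fixes0_def max_ideal_def coeff2_X2 xonly_def)
  have "comp2 (comp2 (dmap (Some (c j))) B0) (X2, S (Suc j)) = (X2, S j)" for j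
    using p[of "Suc j"] diff2_fixes0[OF diff2_dmap]
    by (simp add: comp2_def dmap_def) (simp add: B0_def S_Suc[of j] algebra_simps)
  note chart = this
  have "subst2 (F j) (X2, S j) = X2 ^ M * subst2 (F (Suc j)) (X2, S (Suc j))" for j
  proof -
    let ?\<phi> = "(X2, S (Suc j))"
    have "subst2 (F j) (X2, S j) = subst2 (F j) (comp2 (comp2 (dmap (Some (c j))) B0) ?\<phi>)" by (simp only: chart)
    also have "\<dots> = subst2 (subst2 (subst2 (F j) (dmap (Some (c j)))) B0) ?\<phi>" using p[of "Suc j"] by (simp add: subst2_comp2)
    also have "subst2 (subst2 (F j) (dmap (Some (c j)))) B0 = X2 ^ M * F (Suc j)"
      using stepF[of j] unfolding blow_step_def c by blast
    also have "subst2 (X2 ^ M * F (Suc j)) ?\<phi> = X2 ^ M * subst2 (F (Suc j)) ?\<phi>" using p[of "Suc j"] by simp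
    finally show ?thesis .
  qed
  note step = this
  have "subst2 (F 0) (X2, S 0) = X2 ^ (M * n) * subst2 (F n) (X2, S n)" for n
  proof (induction n)
    case (Suc n)
    also have "X2 ^ (M * n) * subst2 (F n) (X2, S n) = X2 ^ (M * n) * (X2 ^ M * subst2 (F (Suc n)) (X2, S (Suc n)))"
      by (simp only: step[of n])
    also have "\<dots> = X2 ^ (M * Suc n) * subst2 (F (Suc n)) (X2, S (Suc n))"
      by (simp only: mult_Suc_right power_add mult_ac)
    finally show ?case .
  qed simp
  note power = this
  have "wt 1 0 n (subst2 (F 0) (X2, S 0))" for n
  proof -
    have "n \<le> M * n" using M1 by simp
    then have "i < M * n" if "1 * i + 0 * j < n" for i j using that by linarith
    then show ?thesis unfolding wt_def power[of n] coeff2_X2_power_mult by meson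
  qed
  then have "subst2 (F 0) (X2, S 0) = 0" by (rule wt_all_0)
  then have "Y2 - S 0 dvd F 0" by (rule graph_root_dvd[OF xS])
  then obtain u where u: "F 0 = (Y2 - S 0) * u" by (rule dvdE)
  have "irreducible (F 0)" using stepF[of 0] by (simp add: blow_step_def)
  moreover have c0: "coeff2 (Y2 - S 0) 0 0 = 0" by (simp add: S_def coeff2_Y2)
  ultimately have "coeff2 u 0 0 \<noteq> 0" using u by (auto simp: irreducible_def ps2_dvd_1_iff)
  moreover have "coeff2 (F 0) 0 1 = coeff2 u 0 0" unfolding u coeff2_mult_01 c0 by (simp add: coeff2_Y2 S_def)
  moreover have "wt 1 1 M (F 0)" using stepF[of 0] pure_wt(1) by (auto simp: blow_step_def)
  ultimately have "M \<le> 1" using wtD[of 1 1 M "F 0" 0 1] by fastforce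
  then have "ms (K + Suc 0) = 1" using M[of "Suc 0"] M1 by simp
  then show ?thesis using that c by blast
qed

section \<open>Lifting diffeomorphisms to blow-ups\<close>

text \<open>
  In coordinates in which the common tangent direction is \<open>y = 0\<close>, the second component of \<open>\<psi>\<close> has no term \<open>x\<close>, since the
  initial forms of \<open>f\<close> and \<open>f \<circ> \<psi>\<close> are both multiples of \<open>y\<^sup>m\<close>. So both components of \<open>\<psi>\<close> pull back to multiples
  \<open>x u\<close> and \<open>x w\<close> of \<open>x\<close>, where \<open>u\<close> is a unit, and the lift is \<open>(x u, w / u)\<close>.
\<close>

lemma lift_step:
  assumes \<psi>: "diff2 \<psi>" and f: "blow_step f m d g" and f\<psi>: "pure (subst2 f \<psi>) m d"
  obtains \<psi>' u where "diff2 \<psi>'" "comp2 \<psi> (comp2 (dmap d) B0) = comp2 (comp2 (dmap d) B0) \<psi>'"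
    "coeff2 u 0 0 \<noteq> 0" "subst2 (subst2 (subst2 f \<psi>) (dmap d)) B0 = X2 ^ m * (u * subst2 g \<psi>')"
proof -
  let ?A = "dmap d"
  have m: "1 \<le> m" and fp: "pure f m d" and fg: "subst2 (subst2 f ?A) B0 = X2 ^ m * g" using f by (auto simp: blow_step_def)
  define \<theta> where "\<theta> = comp2 (inv2 ?A) (comp2 \<psi> ?A)"
  have d: "diff2 \<theta>" using \<psi> by (simp add: \<theta>_def)
  have A\<theta>: "comp2 ?A \<theta> = comp2 \<psi> ?A" using \<psi> by (simp add: \<theta>_def flip: comp2_assoc)
  have s\<theta>: "subst2 (subst2 h ?A) \<theta> = subst2 (subst2 h \<psi>) ?A" for h
    using A\<theta> \<psi> d by (metis diff2_dmap diff2_fixes0 subst2_comp2)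
  obtain c where c: "c \<noteq> 0" "wt 1 1 (Suc m) (subst2 f ?A - const2 c * Y2 ^ m)" using fp by (auto simp: pure_def)
  obtain c' where c': "wt 1 1 (Suc m) (subst2 (subst2 f \<psi>) ?A - const2 c' * Y2 ^ m)" using f\<psi> by (auto simp: pure_def)
  have "wt 1 1 (Suc m) (subst2 (subst2 f ?A - const2 c * Y2 ^ m) \<theta>)" by (rule wt_subst2_11[OF _ c(2)]) (use d in simp)
  moreover have "subst2 (subst2 f ?A - const2 c * Y2 ^ m) \<theta> = subst2 (subst2 f \<psi>) ?A - const2 c * snd \<theta> ^ m"
    using d s\<theta> by simp
  ultimately have "wt 1 1 (Suc m) ((subst2 (subst2 f \<psi>) ?A - const2 c' * Y2 ^ m) - (subst2 (subst2 f \<psi>) ?A - const2 c * snd \<theta> ^ m))"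
    using wt_diff[OF c'] by metis
  from wtD[OF this, of m 0] have "c * coeff2 (snd \<theta> ^ m) m 0 = 0" using m by (simp add: coeff2_Y2_power)
  moreover have \<theta>0: "coeff2 (fst \<theta>) 0 0 = 0" "coeff2 (snd \<theta>) 0 0 = 0" using diff2_fixes0[OF d] by (auto simp: fixes0_def max_ideal_def)
  ultimately have q: "coeff2 (snd \<theta>) 1 0 = 0" using c(1) coeff2_power_lead[OF \<theta>0(2), of m] by simp
  have w1: "wt 1 1 1 (fst \<theta>)" "wt 1 1 1 (snd \<theta>)" using \<theta>0 by (auto simp: wt_11_iff_00)
  obtain u where u: "subst2 (fst \<theta>) B0 = X2 ^ 1 * u" "\<And>i j. coeff2 u i j = (if j \<le> i + 1 then coeff2 (fst \<theta>) (i + 1 - j) j else 0)"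
    using blow_up_factor[OF w1(1)] by metis
  obtain w where w: "subst2 (snd \<theta>) B0 = X2 ^ 1 * w" "\<And>i j. coeff2 w i j = (if j \<le> i + 1 then coeff2 (snd \<theta>) (i + 1 - j) j else 0)"
    using blow_up_factor[OF w1(2)] by metis
  have co: "coeff2 u 0 0 = coeff2 (fst \<theta>) 1 0" "coeff2 w 0 0 = 0" "coeff2 w 0 1 = coeff2 (snd \<theta>) 0 1"
    using q by (simp_all add: u(2) w(2))
  have "jac \<theta> \<noteq> 0" using d by (simp add: diff2_def)
  then have nz: "coeff2 u 0 0 \<noteq> 0" "coeff2 w 0 1 \<noteq> 0" using q co by (auto simp: jac_def)
  obtain v where v: "u * v = 1" "coeff2 v 0 0 * coeff2 u 0 0 = 1" using ps2_unit_inverse[OF nz(1)] .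
  define \<psi>' where "\<psi>' = (X2 * u, w * v)"
  have "coeff2 v 0 0 \<noteq> 0" using v(2) by auto
  then have d': "diff2 \<psi>'"
    using nz co(2) by (simp add: \<psi>'_def diff2_def fixes0_def max_ideal_def jac_def coeff2_mult_10 coeff2_mult_01 coeff2_X2)
  have "X2 * u * (w * v) = X2 * w * (u * v)" by (simp only: mult_ac)
  then have B: "comp2 B0 \<psi>' = comp2 \<theta> B0"
    using diff2_fixes0[OF d'] u(1) w(1) v(1) unfolding comp2_def by (simp add: B0_def[of] \<psi>'_def)
  have AB: "comp2 \<psi> (comp2 ?A B0) = comp2 (comp2 ?A B0) \<psi>'"
  proof -
    have "comp2 \<psi> (comp2 ?A B0) = comp2 (comp2 \<psi> ?A) B0" by (simp add: comp2_assoc)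
    also have "\<dots> = comp2 ?A (comp2 \<theta> B0)" unfolding A\<theta>[symmetric] using d by (simp add: comp2_assoc)
    also have "\<dots> = comp2 (comp2 ?A B0) \<psi>'" unfolding B[symmetric] using d' by (simp add: comp2_assoc)
    finally show ?thesis .
  qed
  have "subst2 (subst2 (subst2 f \<psi>) ?A) B0 = subst2 f (comp2 \<psi> (comp2 ?A B0))" using \<psi> by (simp add: subst2_comp2)
  also have "\<dots> = subst2 (X2 ^ m * g) \<psi>'" unfolding AB using d' by (simp add: subst2_comp2 fg del: subst2_mult)
  also have "\<dots> = X2 ^ m * (u ^ m * subst2 g \<psi>')"
    using diff2_fixes0[OF d'] by (simp add: \<psi>'_def power_mult_distrib mult.assoc)
  finally have "subst2 (subst2 (subst2 f \<psi>) ?A) B0 = X2 ^ m * (u ^ m * subst2 g \<psi>')" .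
  moreover have "coeff2 (u ^ m) 0 0 \<noteq> 0" using nz(1) by (induction m) (auto simp: coeff2_1)
  ultimately show ?thesis using that[OF d' AB] by blast
qed

primrec blow_downs :: "(nat \<Rightarrow> complex option) \<Rightarrow> nat \<Rightarrow> ps2 \<times> ps2" where
  "blow_downs ds 0 = id2"
| "blow_downs ds (Suc k) = comp2 (blow_downs ds k) (comp2 (dmap (ds k)) B0)"

lemma fixes0_blow_downs [simp]: "fixes0 (blow_downs ds k)"
  by (induction k) auto

text \<open>
  A diffeomorphism that fixes the infinitely near points of \<open>fs 0\<close> up to order \<open>k\<close> lifts, and its lift
  relates the strict transforms. By \<open>blow_down_dvd\<close>, the lift preserves the strict transform only if the
  diffeomorphism preserves the curve.
\<close>

lemma lift_to_blow_up:
  assumes b: "blow_seq fs ms ds" and \<psi>: "diff2 \<psi>"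
    and pts: "\<And>j. j < k \<Longrightarrow> tangent_direction (curve_at (principal (subst2 (fs 0) \<psi>)) j) = dline (ds j)"
  shows "\<exists>\<psi>'. diff2 \<psi>' \<and> comp2 \<psi> (blow_downs ds k) = comp2 (blow_downs ds k) \<psi>' \<and>
    curve_at (principal (subst2 (fs 0) \<psi>)) k = principal (subst2 (fs k) \<psi>') \<and>
    (fs k dvd subst2 (fs k) \<psi>' \<longrightarrow> fs 0 dvd subst2 (fs 0) \<psi>)"
  using pts
proof (induction k)
  case 0
  then show ?case using \<psi> by (intro exI[of _ \<psi>]) simp
next
  case (Suc k)
  then obtain \<psi>1 where \<psi>1: "diff2 \<psi>1" "comp2 \<psi> (blow_downs ds k) = comp2 (blow_downs ds k) \<psi>1"
    "curve_at (principal (subst2 (fs 0) \<psi>)) k = principal (subst2 (fs k) \<psi>1)"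
    "fs k dvd subst2 (fs k) \<psi>1 \<longrightarrow> fs 0 dvd subst2 (fs 0) \<psi>" by auto
  let ?f = "fs k" and ?h = "subst2 (fs k) \<psi>1"
  have st: "blow_step ?f (ms k) (ds k) (fs (Suc k))" using blow_seqD[OF b] .
  have irr: "irreducible ?h" "?h \<in> max_ideal"
    using st irreducible_subst2[OF \<psi>1(1)] \<psi>1(1) by (auto simp: blow_step_def max_ideal_def)
  obtain m' d' where md: "1 \<le> m'" "pure ?h m' d'" using irreducible_pure[OF irr] .
  have "dline d' = dline (ds k)"
    using Suc.prems[of k] pure_tangent_direction[OF md(2,1)] by (simp add: \<psi>1(3))
  then have d': "d' = ds k" by (rule dline_inj)
  have fp: "pure ?f (ms k) (ds k)" using st by (simp add: blow_step_def)
  have "m' = ms k"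
  proof -
    have "wt 1 1 n ?h \<longleftrightarrow> wt 1 1 n ?f" for n using wt_subst2_diff2_iff[OF \<psi>1(1)] .
    then show ?thesis using pure_wt[OF md(2)] pure_wt[OF fp] wt_mono by (metis not_less_eq_eq order_antisym_conv)
  qed
  then have hp: "pure ?h (ms k) (ds k)" using md d' by simp
  obtain \<psi>2 u where \<psi>2: "diff2 \<psi>2" "comp2 \<psi>1 (comp2 (dmap (ds k)) B0) = comp2 (comp2 (dmap (ds k)) B0) \<psi>2"
    "coeff2 u 0 0 \<noteq> 0" "subst2 (subst2 ?h (dmap (ds k))) B0 = X2 ^ ms k * (u * subst2 (fs (Suc k)) \<psi>2)"
    using lift_step[OF \<psi>1(1) st hp] .
  have "comp2 \<psi> (blow_downs ds (Suc k)) = comp2 (comp2 \<psi> (blow_downs ds k)) (comp2 (dmap (ds k)) B0)"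
    by (simp add: comp2_assoc)
  also have "\<dots> = comp2 (blow_downs ds k) (comp2 \<psi>1 (comp2 (dmap (ds k)) B0))"
    unfolding \<psi>1(2) by (rule comp2_assoc) (use \<psi>1(1) in auto)
  also have "\<dots> = comp2 (blow_downs ds (Suc k)) \<psi>2"
    unfolding \<psi>2(2) using \<psi>2(1) by (simp add: comp2_assoc)
  finally have com: "comp2 \<psi> (blow_downs ds (Suc k)) = comp2 (blow_downs ds (Suc k)) \<psi>2" .
  have cur: "curve_at (principal (subst2 (fs 0) \<psi>)) (Suc k) = principal (subst2 (fs (Suc k)) \<psi>2)"
    using pure_strict_transform[OF hp _ \<psi>2(4)] st \<psi>2(3) by (simp add: \<psi>1(3) blow_step_def principal_unit_mult)
  have "?f dvd ?h" if "fs (Suc k) dvd subst2 (fs (Suc k)) \<psi>2"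
  proof -
    have "subst2 ?f (dmap (ds k)) dvd subst2 ?h (dmap (ds k))"
    proof (rule blow_down_dvd)
      show "fs (Suc k) dvd subst2 (subst2 ?h (dmap (ds k))) B0" unfolding \<psi>2(4) using that by simp
      show "subst2 (subst2 ?f (dmap (ds k))) B0 = X2 ^ ms k * fs (Suc k)" using st by (simp add: blow_step_def)
    qed (use blow_step_yreg[OF st] in auto)
    then obtain w where "subst2 ?h (dmap (ds k)) = subst2 ?f (dmap (ds k)) * w" by (rule dvdE)
    then have "subst2 (subst2 ?h (dmap (ds k))) (inv2 (dmap (ds k))) = subst2 (subst2 ?f (dmap (ds k)) * w) (inv2 (dmap (ds k)))" by simp
    then have "?h = ?f * subst2 w (inv2 (dmap (ds k)))" by simp
    then show ?thesis by (metis dvd_triv_left)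
  qed
  then show ?case using \<psi>1(4) \<psi>2(1) com cur by blast
qed

text \<open>
  The monomial \<open>x\<^sup>i y\<^sup>j\<close> pulls back to \<open>x\<^sup>i\<^sup>+\<^sup>j y\<^sup>j\<close>, whose degree is at most twice as large: each blow-up at most
  doubles the order.
\<close>

lemma blow_downs_wt:
  assumes "wt 1 1 (2 ^ k * n) (subst2 h (blow_downs ds k))" shows "wt 1 1 n h"
  using assms
proof (induction k arbitrary: n)
  case (Suc k)
  let ?h = "subst2 (subst2 h (blow_downs ds k)) (dmap (ds k))"
  have "wt 1 1 (2 * (2 ^ k * n)) (subst2 ?h B0)" using Suc.prems by (simp add: subst2_comp2 mult_ac)
  then have "coeff2 ?h i j = 0" if "i + j < 2 ^ k * n" for i j
    using wtD[of 1 1 _ "subst2 ?h B0" "i + j" j] that by (simp add: coeff2_subst2_B0)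
  then have "wt 1 1 (2 ^ k * n) ?h" by (simp add: wt_def)
  then show ?case using Suc.IH by (simp add: wt_subst2_diff2_iff)
qed simp

definition nonzero_pair :: "ps2 \<times> ps2 \<Rightarrow> bool" where "nonzero_pair a \<longleftrightarrow> fixes0 a \<and> fst a \<noteq> 0 \<and> snd a \<noteq> 0"

lemma nonzero_pair_chart:
  assumes "nonzero_pair a" shows "nonzero_pair (comp2 (comp2 (dmap d) B0) a)"
proof (cases d)
  case (Some c)
  have "snd a + const2 c \<noteq> 0"
  proof
    assume z: "snd a + const2 c = 0"
    have "coeff2 (snd a) 0 0 = 0" using assms by (simp add: nonzero_pair_def fixes0_def max_ideal_def)
    then have "c = 0" using arg_cong[OF z, of "\<lambda>f. coeff2 f 0 0"] by (simp add: coeff2_const2)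
    then show False using z assms by (simp add: nonzero_pair_def)
  qed
  then have "fst a * (snd a + const2 c) \<noteq> 0" using assms by (simp add: nonzero_pair_def)
  then have "fst a * snd a + const2 c * fst a \<noteq> 0" by (simp add: distrib_left mult.commute)
  then show ?thesis using Some assms by (simp add: nonzero_pair_def) (simp add: comp2_def dmap_def, simp add: B0_def)
qed (use assms in \<open>simp add: nonzero_pair_def, simp add: comp2_def dmap_def, simp add: B0_def\<close>)

text \<open>
  The chart \<open>(x, x y)\<close> is injective on pairs of series with nonzero first component, as \<open>y\<close> is recovered
  by division.
\<close>

lemma chart_left_cancel:
  assumes "nonzero_pair a" "nonzero_pair b" "comp2 (comp2 (dmap d) B0) a = comp2 (comp2 (dmap d) B0) b" shows "a = b"
proof -
  have p: "fixes0 a" "fixes0 b" using assms by (auto simp: nonzero_pair_def)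
  have "comp2 (inv2 (dmap d)) (comp2 (dmap d) (comp2 B0 a)) = comp2 (inv2 (dmap d)) (comp2 (dmap d) (comp2 B0 b))"
    using assms(3) p by (simp add: comp2_assoc)
  then have "comp2 B0 a = comp2 B0 b" using p by (simp flip: comp2_assoc)
  moreover have "comp2 B0 a = (fst a, fst a * snd a)" if "fixes0 a" for a
    unfolding comp2_def using subst2_mult[OF that, of X2 Y2] that by (simp add: B0_def)
  ultimately have "(fst a, fst a * snd a) = (fst b, fst b * snd b)" using p by metis
  then show ?thesis using assms(2) by (auto simp: nonzero_pair_def prod_eq_iff)
qed

lemma blow_downs_left_cancel:
  assumes "nonzero_pair a" "nonzero_pair b" "comp2 (blow_downs ds k) a = comp2 (blow_downs ds k) b" shows "a = b"
  using assms
proof (induction k arbitrary: a b)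
  case (Suc k)
  have p: "fixes0 a" "fixes0 b" using Suc.prems by (auto simp: nonzero_pair_def)
  have "comp2 (blow_downs ds k) (comp2 (comp2 (dmap (ds k)) B0) a) = comp2 (blow_downs ds k) (comp2 (comp2 (dmap (ds k)) B0) b)"
    using Suc.prems(3) p by (simp add: comp2_assoc)
  then have "comp2 (comp2 (dmap (ds k)) B0) a = comp2 (comp2 (dmap (ds k)) B0) b"
    using Suc.IH nonzero_pair_chart Suc.prems by blast
  then show ?case using chart_left_cancel Suc.prems by blast
qed (auto simp: nonzero_pair_def)

lemma diff2_nonzero_pair: "diff2 a \<Longrightarrow> nonzero_pair a"
  by (auto simp: diff2_def nonzero_pair_def jac_def)

text \<open>The group of lifts of elements of \<open>G\<close>, in coordinates \<open>P\<close>.\<close>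

definition lift_group :: "(ps2 \<times> ps2) set \<Rightarrow> ps2 \<times> ps2 \<Rightarrow> (ps2 \<times> ps2) set" where
  "lift_group G P = {\<chi>. diff2 \<chi> \<and> (\<exists>\<psi>\<in>G. comp2 \<psi> P = comp2 P \<chi>)}"

lemma diff_group_lift_group:
  assumes G: "diff_group G" and P: "fixes0 P" shows "diff_group (lift_group G P)"
  unfolding diff_group_def
proof (intro conjI ballI)
  show "id2 \<in> lift_group G P" using diff_groupD(3)[OF G] P by (auto simp: lift_group_def intro!: bexI[of _ id2])
  fix \<chi> assume \<chi>: "\<chi> \<in> lift_group G P"
  then show d: "diff2 \<chi>" by (simp add: lift_group_def)
  obtain \<psi> where \<psi>: "\<psi> \<in> G" "comp2 \<psi> P = comp2 P \<chi>" using \<chi> by (auto simp: lift_group_def)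
  have d\<psi>: "diff2 \<psi>" using diff_groupD(1)[OF G \<psi>(1)] .
  have "comp2 (inv2 \<psi>) P = comp2 P (inv2 \<chi>)"
  proof -
    have "comp2 (inv2 \<psi>) (comp2 (comp2 \<psi> P) (inv2 \<chi>)) = comp2 (inv2 \<psi>) (comp2 P (comp2 \<chi> (inv2 \<chi>)))"
      unfolding \<psi>(2) using d P by (subst comp2_assoc) auto
    moreover have "comp2 (inv2 \<psi>) (comp2 (comp2 \<psi> P) (inv2 \<chi>)) = comp2 (comp2 (inv2 \<psi>) \<psi>) (comp2 P (inv2 \<chi>))"
      using d P d\<psi> by (simp add: comp2_assoc del: comp2_inv2)
    ultimately show ?thesis using d P d\<psi> by simp
  qed
  then show "inv2 \<chi> \<in> lift_group G P" using d diff_groupD(2)[OF G \<psi>(1)] by (auto simp: lift_group_def)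
  fix \<chi>' assume "\<chi>' \<in> lift_group G P"
  then obtain \<psi>' where \<psi>': "\<psi>' \<in> G" "comp2 \<psi>' P = comp2 P \<chi>'" and d': "diff2 \<chi>'" by (auto simp: lift_group_def)
  have d\<psi>': "diff2 \<psi>'" using diff_groupD(1)[OF G \<psi>'(1)] .
  have "comp2 (comp2 \<psi> \<psi>') P = comp2 \<psi> (comp2 P \<chi>')" using P d\<psi>' by (simp add: comp2_assoc \<psi>'(2))
  also have "\<dots> = comp2 (comp2 \<psi> P) \<chi>'" using P d' by (simp add: comp2_assoc)
  also have "\<dots> = comp2 P (comp2 \<chi> \<chi>')" unfolding \<psi>(2) using d d' by (simp add: comp2_assoc)
  finally show "comp2 \<chi> \<chi>' \<in> lift_group G P"
    using d d' diff_groupD(4)[OF G \<psi>(1) \<psi>'(1)] by (auto simp: lift_group_def)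
qed

text \<open>
  A lift close to the identity comes from an element of \<open>G\<close> close to the identity, hence from the
  identity, whose only lift is the identity.
\<close>

lemma jet_faithful_lift_group:
  assumes G: "diff_group G" "jet_faithful k G" and \<sigma>: "diff2 \<sigma>"
  shows "jet_faithful (2 ^ n * Suc k) (lift_group G (comp2 (blow_downs ds n) \<sigma>))"
  unfolding jet_faithful_def
proof (intro ballI impI)
  let ?P = "comp2 (blow_downs ds n) \<sigma>" and ?K = "2 ^ n * Suc k"
  fix \<chi> assume "\<chi> \<in> lift_group G ?P" and w: "wt 1 1 (Suc ?K) (fst \<chi> - X2)" "wt 1 1 (Suc ?K) (snd \<chi> - Y2)"
  then obtain \<psi> where \<psi>: "\<psi> \<in> G" "comp2 \<psi> ?P = comp2 ?P \<chi>" and d: "diff2 \<chi>" by (auto simp: lift_group_def)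
  have d\<psi>: "diff2 \<psi>" using diff_groupD(1)[OF G(1) \<psi>(1)] .
  have close: "wt 1 1 (Suc k) (subst2 h \<psi> - h)" for h
  proof -
    have "wt 1 1 (Suc ?K) (subst2 (subst2 h ?P) \<chi> - subst2 (subst2 h ?P) id2)"
      by (rule wt_subst2_diff) (use d w in auto)
    also have "subst2 (subst2 h ?P) \<chi> - subst2 (subst2 h ?P) id2 = subst2 (subst2 h \<psi> - h) ?P"
      using \<psi>(2) d d\<psi> \<sigma> by (simp flip: subst2_comp2 add: diff2_fixes0)
    also have "\<dots> = subst2 (subst2 (subst2 h \<psi> - h) (blow_downs ds n)) \<sigma>"
      using \<sigma> by (simp add: subst2_comp2)
    finally have "wt 1 1 ?K (subst2 (subst2 h \<psi> - h) (blow_downs ds n))"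
      using \<sigma> wt_mono by (metis wt_subst2_diff2_iff le_SucI order_refl)
    then show ?thesis by (rule blow_downs_wt)
  qed
  have "\<psi> = id2" using close[of X2] close[of Y2] G(2) \<psi>(1) d\<psi> by (simp add: jet_faithful_def)
  then have "comp2 (blow_downs ds n) (comp2 \<sigma> \<chi>) = comp2 (blow_downs ds n) \<sigma>"
    using \<psi>(2) \<sigma> d by (simp add: comp2_assoc)
  then have "comp2 \<sigma> \<chi> = \<sigma>" using blow_downs_left_cancel diff2_nonzero_pair \<sigma> d by (metis diff2_comp2)
  then have "comp2 (inv2 \<sigma>) (comp2 \<sigma> \<chi>) = id2" using \<sigma> by simp
  then show "\<chi> = id2" using \<sigma> d by (simp flip: comp2_assoc)
qed

section \<open>Infinitely near points of graphs\<close>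

definition graph_shift :: "nat \<Rightarrow> ps2 \<Rightarrow> ps2" where
  "graph_shift k s = mk_ps2 (\<lambda>i j. if j = 0 \<and> 0 < i then coeff2 s (i + k) 0 else 0)"

lemma coeff2_graph_shift: "coeff2 (graph_shift k s) i j = (if j = 0 \<and> 0 < i then coeff2 s (i + k) 0 else 0)"
  by (simp add: graph_shift_def)

lemma xonly_graph_shift [simp]: "xonly (graph_shift k s)"
  by (simp add: xonly_def coeff2_graph_shift)

lemma graph_shift_0: assumes "xonly s" shows "graph_shift 0 s = s"
proof (rule ps2_eqI)
  show "coeff2 (graph_shift 0 s) i j = coeff2 s i j" for i j
    using assms by (cases "j = 0"; cases "i = 0") (auto simp: coeff2_graph_shift xonly_def)
qed

lemma graph_step:
  assumes s: "xonly s"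
  shows "tangent_direction (principal (Y2 - s)) = dline (Some (coeff2 s 1 0))"
    and "strict_transform (principal (Y2 - s)) = principal (Y2 - graph_shift 1 s)"
proof -
  let ?c = "coeff2 s 1 0"
  have p: "fixes0 (dmap (Some ?c))" by simp
  have ss: "subst2 s (dmap (Some ?c)) = s" by (rule subst2_xonly[OF s _ p]) (simp add: dmap_def)
  have A: "subst2 (Y2 - s) (dmap (Some ?c)) = Y2 + const2 ?c * X2 - s"
    using subst2_Y2[OF p] by (simp add: ss) (simp add: dmap_def)
  have "wt 1 1 2 (subst2 (Y2 - s) (dmap (Some ?c)) - const2 1 * Y2 ^ 1)"
    unfolding A by (rule wt_2I) (use s in \<open>auto simp: coeff2_X2 coeff2_Y2 xonly_def\<close>)
  then have pure: "pure (Y2 - s) 1 (Some ?c)" unfolding pure_def by (intro exI[of _ 1]) (simp add: numeral_2_eq_2 One_nat_def)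
  then show "tangent_direction (principal (Y2 - s)) = dline (Some ?c)" by (rule pure_tangent_direction) simp
  have "subst2 (subst2 (Y2 - s) (dmap (Some ?c))) B0 = X2 ^ 1 * (Y2 - graph_shift 1 s)"
    unfolding A
    by (rule ps2_eqI)
      (use s in \<open>auto simp: coeff2_subst2_B0 coeff2_X2_mult coeff2_Y2 coeff2_X2 coeff2_graph_shift xonly_def One_nat_def not_less le_Suc_eq simp del: subst2_diff subst2_add\<close>)
  then show "strict_transform (principal (Y2 - s)) = principal (Y2 - graph_shift 1 s)"
    by (rule pure_strict_transform[OF pure, rotated]) simp
qed

lemma curve_at_graph:
  assumes "xonly s"
  shows "curve_at (principal (Y2 - s)) k = principal (Y2 - graph_shift k s)"
    and "tangent_direction (curve_at (principal (Y2 - s)) k) = dline (Some (coeff2 s (Suc k) 0))"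
proof -
  show *: "curve_at (principal (Y2 - s)) k = principal (Y2 - graph_shift k s)" for k
  proof (induction k)
    case (Suc k)
    have "graph_shift 1 (graph_shift k s) = graph_shift (Suc k) s" by (rule ps2_eqI) (simp add: graph_shift_def add.assoc One_nat_def)
    then show ?case using Suc graph_step(2)[of "graph_shift k s"] by simp
  qed (simp add: graph_shift_0 assms)
  show "tangent_direction (curve_at (principal (Y2 - s)) k) = dline (Some (coeff2 s (Suc k) 0))"
    unfolding * using graph_step(1)[OF xonly_graph_shift, of k s] by (simp add: coeff2_graph_shift plus_1_eq_Suc)
qed

lemma curve_at_add: "curve_at \<gamma> (k + j) = curve_at (curve_at \<gamma> k) j"
  by (induction j) auto

section \<open>Finitely determined groups have discrete orbits\<close>

text \<open>
  Let \<open>\<psi> \<in> G\<close> fix sufficiently many infinitely near points of the curve. At the stage \<open>K\<close> where the strict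
  transform is a graph \<open>y = s\<close>, the lift of \<open>\<psi>\<close> maps it to a graph \<open>y = s'\<close> with the same points, that is, with the same
  coefficients up to order \<open>r\<close>. Straightening \<open>y = s\<close> to the axis by a shear, the lift has contact of order at least \<open>r\<close>
  with the axis, and \<open>contact_bounded\<close> for the group of all lifts shows that it preserves the graph.
\<close>

lemma finitely_determined_separates:
  assumes G: "diff_group G" "jet_faithful k G" and f: "irreducible f" "f \<in> max_ideal"
  shows "\<exists>n. \<forall>\<psi>\<in>G. (\<forall>j<n. tangent_direction (curve_at (principal (subst2 f \<psi>)) j) = tangent_direction (curve_at (principal f) j))
    \<longrightarrow> principal (subst2 f \<psi>) = principal f"
proof -
  obtain fs ms ds where fs0: "fs 0 = f" and b: "blow_seq fs ms ds" using blow_seq_exists[OF f] .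
  obtain K c where K: "ms K = 1" "ds K = Some c" using blow_seq_resolution[OF b] .
  have pK: "pure (fs K) 1 (Some c)" using blow_seqD[OF b, of K] K by (simp add: blow_step_def)
  have "yreg 1 (fs K)" using pure_1_Some(1)[OF pK] blow_seqD[OF b, of K] by (auto simp: yreg_def blow_step_def max_ideal_def less_Suc_eq One_nat_def)
  then obtain s u where s: "xonly s" "fs K = u * (Y2 - s)" "coeff2 u 0 0 \<noteq> 0" using yreg_graph by blast
  define \<sigma> where "\<sigma> = shear s"
  have d\<sigma>: "diff2 \<sigma>" using s(1) by (simp add: \<sigma>_def)
  let ?P = "comp2 (blow_downs ds K) \<sigma>"
  let ?H = "lift_group G ?P"
  have H: "diff_group ?H" using diff_group_lift_group[OF G(1)] d\<sigma> by simp
  obtain r where r: "1 \<le> r" "\<And>\<chi>. \<chi> \<in> ?H \<Longrightarrow> wt 1 r r (snd \<chi>) \<Longrightarrow> wt 0 1 1 (snd \<chi>)"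
    using contact_bounded[OF H jet_faithful_lift_group[OF G d\<sigma>]] by blast
  have tan: "tangent_direction (curve_at (principal f) j) = dline (ds j)" for j
    using blow_step_curve(1)[OF blow_seqD[OF b]] curve_at_blow_seq[OF b] fs0 by simp
  show ?thesis
  proof (intro exI[of _ "K + r"] ballI impI)
    fix \<psi> assume \<psi>: "\<psi> \<in> G" and
      pts: "\<forall>j<K + r. tangent_direction (curve_at (principal (subst2 f \<psi>)) j) = tangent_direction (curve_at (principal f) j)"
    have d\<psi>: "diff2 \<psi>" using diff_groupD(1)[OF G(1) \<psi>] .
    have pts': "tangent_direction (curve_at (principal (subst2 (fs 0) \<psi>)) j) = dline (ds j)" if "j < K + r" for j
      using pts tan that fs0 by simp
    obtain \<psi>1 where \<psi>1: "diff2 \<psi>1" "comp2 \<psi> (blow_downs ds K) = comp2 (blow_downs ds K) \<psi>1"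
      "curve_at (principal (subst2 f \<psi>)) K = principal (subst2 (fs K) \<psi>1)"
      "fs K dvd subst2 (fs K) \<psi>1 \<longrightarrow> f dvd subst2 f \<psi>"
      using lift_to_blow_up[OF b d\<psi> pts', of K] fs0 by auto
    let ?h = "subst2 (fs K) \<psi>1"
    have irr: "irreducible ?h" "?h \<in> max_ideal"
      using blow_seqD[OF b, of K] irreducible_subst2[OF \<psi>1(1)] \<psi>1(1) by (auto simp: blow_step_def max_ideal_def)
    obtain m d where md: "1 \<le> m" "pure ?h m d" using irreducible_pure[OF irr] .
    have "dline d = dline (Some c)"
      using pts'[of K] r(1) pure_tangent_direction[OF md(2,1)] fs0 K by (simp add: \<psi>1(3))
    then have "d = Some c" by (rule dline_inj)
    moreover have "m = 1"
    proof -
      have "wt 1 1 n ?h \<longleftrightarrow> wt 1 1 n (fs K)" for n using wt_subst2_diff2_iff[OF \<psi>1(1)] .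
      then show ?thesis using pure_wt[OF md(2)] pure_wt[OF pK] wt_mono by (metis not_less_eq_eq order_antisym_conv)
    qed
    ultimately have "coeff2 ?h 0 1 \<noteq> 0" using pure_1_Some(1) md(2) by blast
    then have "yreg 1 ?h" using irr(2) by (auto simp: yreg_def max_ideal_def less_Suc_eq One_nat_def)
    then obtain s' u' where s': "xonly s'" "?h = u' * (Y2 - s')" "coeff2 u' 0 0 \<noteq> 0" using yreg_graph by blast
    have cs: "principal (fs K) = principal (Y2 - s)" "principal ?h = principal (Y2 - s')"
      using s s' principal_unit_mult by simp_all
    have eq: "coeff2 s i 0 = coeff2 s' i 0" if "i \<le> r" for i
    proof (cases i)
      case (Suc j)
      have "dline (Some (coeff2 s (Suc j) 0)) = tangent_direction (curve_at (principal f) (K + j))"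
        using curve_at_graph(2)[OF s(1), of j] curve_at_blow_seq[OF b, of K] fs0 cs(1) by (simp add: curve_at_add)
      also have "\<dots> = tangent_direction (curve_at (principal (subst2 f \<psi>)) (K + j))" using pts Suc that by simp
      also have "\<dots> = dline (Some (coeff2 s' (Suc j) 0))"
        using curve_at_graph(2)[OF s'(1), of j] \<psi>1(3) cs(2) by (simp add: curve_at_add)
      finally show ?thesis using dline_inj Suc by blast
    qed (use s(1) s'(1) in \<open>simp add: xonly_def\<close>)
    define \<chi> where "\<chi> = comp2 (inv2 \<sigma>) (comp2 \<psi>1 \<sigma>)"
    have d\<chi>: "diff2 \<chi>" using \<psi>1(1) d\<sigma> by (simp add: \<chi>_def)
    have "comp2 \<psi> ?P = comp2 (comp2 \<psi> (blow_downs ds K)) \<sigma>" using d\<sigma> by (simp add: comp2_assoc)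
    also have "\<dots> = comp2 (blow_downs ds K) (comp2 \<psi>1 \<sigma>)" unfolding \<psi>1(2) using d\<sigma> \<psi>1(1) by (simp add: comp2_assoc)
    also have "comp2 \<psi>1 \<sigma> = comp2 \<sigma> \<chi>" using d\<sigma> \<psi>1(1) by (simp add: \<chi>_def flip: comp2_assoc)
    also have "comp2 (blow_downs ds K) (comp2 \<sigma> \<chi>) = comp2 ?P \<chi>" using d\<sigma> d\<chi> by (simp add: comp2_assoc)
    finally have \<chi>H: "\<chi> \<in> ?H" using \<psi> d\<chi> by (auto simp: lift_group_def)
    have Y\<sigma>: "subst2 (Y2 - s) \<sigma> = Y2" using subst2_shear[OF s(1) xonly_minus[OF s(1)]] by (simp add: \<sigma>_def del: subst2_diff subst2_add)
    have Yinv: "subst2 Y2 (inv2 \<sigma>) = Y2 - s" using subst2_inv2(1)[OF d\<sigma>, of "Y2 - s"] by (simp only: Y\<sigma>)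
    obtain w where w: "u * w = 1" "coeff2 w 0 0 * coeff2 u 0 0 = 1" using ps2_unit_inverse[OF s(3)] .
    have "Y2 - s = w * fs K" using w(1) s(2) by (metis mult.assoc mult.commute mult.left_neutral)
    then have Ys\<psi>: "subst2 (Y2 - s) \<psi>1 = subst2 w \<psi>1 * (u' * (Y2 - s'))" using s'(2) \<psi>1(1) by (metis diff2_fixes0 subst2_mult)
    have snd\<chi>: "snd \<chi> = subst2 (subst2 (Y2 - s) \<psi>1) \<sigma>"
    proof -
      have "snd \<chi> = subst2 Y2 \<chi>" using d\<chi> by simp
      also have "\<dots> = subst2 (subst2 (subst2 Y2 (inv2 \<sigma>)) \<psi>1) \<sigma>" unfolding \<chi>_def using d\<sigma> \<psi>1(1) by (simp add: subst2_comp2 del: subst2_Y2)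
      finally show ?thesis by (simp only: Yinv)
    qed
    have "subst2 (Y2 - s') \<sigma> = Y2 + s - s'"
      using subst2_shear[OF s(1) xonly_minus[OF s'(1)]] by (simp add: \<sigma>_def del: subst2_diff subst2_add)
    then have "snd \<chi> = subst2 (subst2 w \<psi>1 * u') \<sigma> * (Y2 + s - s')"
      unfolding snd\<chi> Ys\<psi> using d\<sigma> by (simp add: mult.assoc del: subst2_diff)
    moreover have "wt 1 r r (Y2 + s - s')" using wt_1r_iff[OF r(1) order_refl] eq by (simp add: coeff2_Y2)
    ultimately have "wt 1 r r (snd \<chi>)" using wt_mult_left by simp
    then have "Y2 dvd snd \<chi>" using r(2)[OF \<chi>H] by (simp add: y_dvd_iff)
    then obtain v where "snd \<chi> = Y2 * v" by (rule dvdE)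
    then have "subst2 (subst2 (subst2 (Y2 - s) \<psi>1) \<sigma>) (inv2 \<sigma>) = subst2 Y2 (inv2 \<sigma>) * subst2 v (inv2 \<sigma>)"
      using snd\<chi> d\<sigma> by (metis diff2_inv2 diff2_fixes0 subst2_mult)
    then have "subst2 (Y2 - s) \<psi>1 = (Y2 - s) * subst2 v (inv2 \<sigma>)" unfolding Yinv using d\<sigma> by simp
    then have "Y2 - s dvd subst2 (Y2 - s) \<psi>1" by (metis dvd_triv_left)
    moreover have "fs K dvd Y2 - s" using \<open>Y2 - s = w * fs K\<close> by simp
    moreover have "subst2 (Y2 - s) \<psi>1 dvd ?h" unfolding s(2) using \<psi>1(1) by simp
    ultimately have "f dvd subst2 f \<psi>" using \<psi>1(4) dvd_trans by blast
    then obtain v' where v': "subst2 f \<psi> = f * v'" by (rule dvdE)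
    have "irreducible (subst2 f \<psi>)" by (rule irreducible_subst2[OF d\<psi> f(1)])
    then have "f dvd 1 \<or> v' dvd 1" using v' unfolding irreducible_def by blast
    then have "coeff2 v' 0 0 \<noteq> 0" using f(1) by (auto simp: irreducible_def ps2_dvd_1_iff)
    then show "principal (subst2 f \<psi>) = principal f" unfolding v' using principal_unit_mult[of v' f] by (simp add: mult.commute)
  qed
qed

section \<open>Discreteness in terms of infinitely near points\<close>

lemma principal_in_formal_curves:
  "irreducible f \<Longrightarrow> f \<in> max_ideal \<Longrightarrow> principal f \<in> formal_curves"
  by (auto simp: formal_curves_def)

lemma curve_at_formal_curves:
  assumes "\<gamma> \<in> formal_curves" shows "curve_at \<gamma> k \<in> formal_curves"
proof -
  obtain f where f: "\<gamma> = principal f" "irreducible f" "f \<in> max_ideal" using assms by (auto simp: formal_curves_def)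
  obtain fs ms ds where fs: "fs 0 = f" "blow_seq fs ms ds" using blow_seq_exists[OF f(2,3)] .
  have "curve_at \<gamma> k = principal (fs k)" using curve_at_blow_seq[OF fs(2)] fs(1) f(1) by simp
  then show ?thesis using blow_seqD[OF fs(2), of k] by (auto simp: blow_step_def intro: principal_in_formal_curves)
qed

lemma tangent_direction_line:
  assumes "\<gamma> \<in> formal_curves" obtains a b where "(a, b) \<noteq> (0, 0)" "tangent_direction \<gamma> = line a b"
proof -
  obtain f where f: "\<gamma> = principal f" "irreducible f" "f \<in> max_ideal" using assms by (auto simp: formal_curves_def)
  obtain m d where md: "1 \<le> m" "pure f m d" using irreducible_pure[OF f(2,3)] .
  have "tangent_direction \<gamma> = dline d" using pure_tangent_direction[OF md(2,1)] f(1) by simp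
  then show ?thesis using that[of 1 0] that[of "- the d" 1] by (cases d) (auto simp: dline_def)
qed

text \<open>A point is the list of the directions that lead to it.\<close>

lemma point_at_eq_iff:
  "(\<forall>k\<le>n. point_at \<delta> k = point_at \<gamma> k) \<longleftrightarrow> (\<forall>j<n. tangent_direction (curve_at \<delta> j) = tangent_direction (curve_at \<gamma> j))"
  by (induction n) (auto simp: le_Suc_eq less_Suc_eq)

lemma inf_near_seq_point_at:
  assumes "\<gamma> \<in> formal_curves" shows "inf_near_seq (point_at \<gamma>) n"
  unfolding inf_near_seq_def exceptional_divisor_def
proof (intro conjI allI impI)
  fix k
  obtain a b where "(a, b) \<noteq> (0, 0)" "tangent_direction (curve_at \<gamma> k) = line a b"
    using tangent_direction_line[OF curve_at_formal_curves[OF assms]] .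
  then show "point_at \<gamma> (Suc k) \<in> {point_at \<gamma> k @ [line a b] |a b. (a, b) \<noteq> (0, 0)}" by auto
qed simp

text \<open>The generating sets form a base, and a basic set containing \<open>\<gamma>\<close> is given by points of \<open>\<gamma>\<close>.\<close>

lemma open_contains_curves_through:
  assumes "openin curve_topology V" "\<gamma> \<in> V" shows "\<exists>n. curves_through (point_at \<gamma>) n \<subseteq> V"
proof -
  have "generate_topology_on {curves_through p n |p n. inf_near_seq p n} V"
    using assms(1) by (simp add: curve_topology_def openin_topology_generated_by_iff)
  then show ?thesis using assms(2)
  proof (induction rule: generate_topology_on.induct)
    case (Int a b)
    then obtain m n where "curves_through (point_at \<gamma>) m \<subseteq> a" "curves_through (point_at \<gamma>) n \<subseteq> b" by blast
    then have "curves_through (point_at \<gamma>) (max m n) \<subseteq> a \<inter> b" by (fastforce simp: curves_through_def)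
    then show ?case ..
  next
    case (UN K)
    then obtain k where k: "k \<in> K" "\<gamma> \<in> k" by blast
    then obtain n where "curves_through (point_at \<gamma>) n \<subseteq> k" using UN.IH by metis
    then have "curves_through (point_at \<gamma>) n \<subseteq> \<Union> K" using k(1) by auto
    then show ?case ..
  next
    case (Basis s)
    then obtain p n where s: "s = curves_through p n" by blast
    then have "curves_through (point_at \<gamma>) n \<subseteq> s" using Basis(2) by (auto simp: curves_through_def)
    then show ?case ..
  qed auto
qed

lemma discrete_iff:
  assumes O: "A \<subseteq> formal_curves"
  shows "subtopology curve_topology A = discrete_topology A \<longleftrightarrow>
    (\<forall>\<gamma>\<in>A. \<exists>n. \<forall>\<delta>\<in>A. (\<forall>j<n. tangent_direction (curve_at \<delta> j) = tangent_direction (curve_at \<gamma> j)) \<longrightarrow> \<delta> = \<gamma>)"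
proof -
  have "openin (subtopology curve_topology A) {\<gamma>} \<longleftrightarrow>
    (\<exists>n. \<forall>\<delta>\<in>A. (\<forall>j<n. tangent_direction (curve_at \<delta> j) = tangent_direction (curve_at \<gamma> j)) \<longrightarrow> \<delta> = \<gamma>)" if \<gamma>: "\<gamma> \<in> A" for \<gamma>
  proof
    assume "openin (subtopology curve_topology A) {\<gamma>}"
    then obtain V where V: "openin curve_topology V" "{\<gamma>} = V \<inter> A" by (auto simp: openin_subtopology)
    then obtain n where "curves_through (point_at \<gamma>) n \<subseteq> V" using open_contains_curves_through by blast
    then have "\<forall>\<delta>\<in>A. (\<forall>k\<le>n. point_at \<delta> k = point_at \<gamma> k) \<longrightarrow> \<delta> = \<gamma>"
      using V(2) O by (auto simp: curves_through_def)
    then show "\<exists>n. \<forall>\<delta>\<in>A. (\<forall>j<n. tangent_direction (curve_at \<delta> j) = tangent_direction (curve_at \<gamma> j)) \<longrightarrow> \<delta> = \<gamma>"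
      unfolding point_at_eq_iff by blast
  next
    assume "\<exists>n. \<forall>\<delta>\<in>A. (\<forall>j<n. tangent_direction (curve_at \<delta> j) = tangent_direction (curve_at \<gamma> j)) \<longrightarrow> \<delta> = \<gamma>"
    then obtain n where "\<forall>\<delta>\<in>A. (\<forall>k\<le>n. point_at \<delta> k = point_at \<gamma> k) \<longrightarrow> \<delta> = \<gamma>"
      unfolding point_at_eq_iff by blast
    then have "{\<gamma>} = curves_through (point_at \<gamma>) n \<inter> A" using \<gamma> O by (auto simp: curves_through_def)
    moreover have "openin curve_topology (curves_through (point_at \<gamma>) n)"
      unfolding curve_topology_def
      using inf_near_seq_point_at[of \<gamma> n] \<gamma> O by (intro topology_generated_by_Basis) blast
    ultimately show "openin (subtopology curve_topology A) {\<gamma>}" by (auto simp: openin_subtopology)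
  qed
  moreover have "topspace (subtopology curve_topology A) = A" using O by auto
  ultimately show ?thesis by (metis discrete_topology_unique)
qed

lemma curve_image_principal:
  assumes "diff2 \<phi>" shows "curve_image \<phi> (principal f) = principal (subst2 f (inv2 \<phi>))"
proof -
  have "(\<lambda>h. subst2 h (inv2 \<phi>)) ` principal f = principal (subst2 f (inv2 \<phi>))"
  proof (intro equalityI subsetI)
    fix h assume "h \<in> (\<lambda>h. subst2 h (inv2 \<phi>)) ` principal f"
    then show "h \<in> principal (subst2 f (inv2 \<phi>))" using assms by (auto simp: principal_def)
  next
    fix h assume "h \<in> principal (subst2 f (inv2 \<phi>))"
    then obtain g where "h = subst2 f (inv2 \<phi>) * g" by (auto simp: principal_def)
    then have "h = subst2 (f * subst2 g \<phi>) (inv2 \<phi>)" using assms by simp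
    then show "h \<in> (\<lambda>h. subst2 h (inv2 \<phi>)) ` principal f" unfolding principal_def by blast
  qed
  then show ?thesis by (simp add: curve_image_def inv2_def)
qed

lemma subgroup_diff_group: assumes "subgroup G formal_Diff" shows "diff_group G"
  unfolding diff_group_def
proof (intro conjI ballI)
  show "id2 \<in> G" using subgroup.one_closed[OF assms] by simp
  fix \<phi> assume \<phi>: "\<phi> \<in> G"
  show "diff2 \<phi>" using subgroup.mem_carrier[OF assms \<phi>] by simp
  show "inv2 \<phi> \<in> G" using subgroup.m_inv_closed[OF assms \<phi>] by (simp add: inv2_def)
  fix \<psi> assume "\<psi> \<in> G"
  then show "comp2 \<phi> \<psi> \<in> G" using subgroup.m_closed[OF assms \<phi>] by simp
qed

lemma curve_orbit_principal:
  assumes G: "diff_group G"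
  shows "curve_orbit G (principal f) = {principal (subst2 f \<psi>) |\<psi>. \<psi> \<in> G}"
proof (intro equalityI subsetI)
  fix \<gamma> assume "\<gamma> \<in> curve_orbit G (principal f)"
  then obtain \<phi> where \<phi>: "\<phi> \<in> G" "\<gamma> = curve_image \<phi> (principal f)" unfolding curve_orbit_def by blast
  then have "\<gamma> = principal (subst2 f (inv2 \<phi>))" using curve_image_principal diff_groupD(1)[OF G] by blast
  then show "\<gamma> \<in> {principal (subst2 f \<psi>) |\<psi>. \<psi> \<in> G}" using diff_groupD(2)[OF G \<phi>(1)] by blast
next
  fix \<gamma> assume "\<gamma> \<in> {principal (subst2 f \<psi>) |\<psi>. \<psi> \<in> G}"
  then obtain \<psi> where \<psi>: "\<psi> \<in> G" "\<gamma> = principal (subst2 f \<psi>)" by blast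
  have "diff2 \<psi>" using diff_groupD(1)[OF G \<psi>(1)] .
  then have "\<gamma> = curve_image (inv2 \<psi>) (principal f)" using curve_image_principal[of "inv2 \<psi>" f] \<psi>(2) by simp
  then show "\<gamma> \<in> curve_orbit G (principal f)" using diff_groupD(2)[OF G \<psi>(1)] unfolding curve_orbit_def by blast
qed

lemma jet_eq_id2_iff:
  assumes "1 \<le> k" shows "jet k \<phi> = id2 \<longleftrightarrow> wt 1 1 (Suc k) (fst \<phi> - X2) \<and> wt 1 1 (Suc k) (snd \<phi> - Y2)"
proof -
  have "trunc2 k f = g \<longleftrightarrow> wt 1 1 (Suc k) (f - g)" if "wt 1 1 (Suc k) (f - g) \<Longrightarrow> trunc2 k g = g" "trunc2 k g = g" for f g
  proof
    assume "trunc2 k f = g"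
    then show "wt 1 1 (Suc k) (f - g)" using wt_trunc2[of k f] by simp
  next
    assume "wt 1 1 (Suc k) (f - g)"
    then have "trunc2 k f = trunc2 k g" by (intro ps2_eqI) (auto simp: trunc2_def wt_def)
    then show "trunc2 k f = g" using that by simp
  qed
  moreover have "trunc2 k X2 = X2" "trunc2 k Y2 = Y2"
    by (rule ps2_eqI; use assms in \<open>auto simp: trunc2_def coeff2_X2 coeff2_Y2\<close>)+
  ultimately show ?thesis by (auto simp: jet_def id2_def)
qed

lemma jet_faithful_mono: "jet_faithful k G \<Longrightarrow> k \<le> l \<Longrightarrow> jet_faithful l G"
  unfolding jet_faithful_def by (meson Suc_le_mono wt_mono)

lemma finitely_determined_iff:
  assumes "diff_group G" shows "finitely_determined G \<longleftrightarrow> (\<exists>k. jet_faithful k G)"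
proof -
  have "{\<phi> \<in> G. jet k \<phi> = id2} = {id2} \<longleftrightarrow> jet_faithful k G" if "1 \<le> k" for k
  proof -
    have "id2 \<in> {\<phi> \<in> G. jet k \<phi> = id2}"
      using diff_groupD(3)[OF assms] by (simp add: jet_eq_id2_iff[OF that])
    then show ?thesis unfolding jet_eq_id2_iff[OF that] jet_faithful_def by blast
  qed
  then have "finitely_determined G \<longleftrightarrow> (\<exists>k\<ge>1. jet_faithful k G)"
    unfolding finitely_determined_def one_formal_Diff by blast
  then show ?thesis using jet_faithful_mono by (metis le_add1 le_add2)
qed

text \<open>
  Any curve of the orbit may play the role of the given one, because \<open>G\<close> is a group.
\<close>

lemma finitely_determined_imp_discrete:
  assumes G: "diff_group G" "jet_faithful k G" and \<gamma>: "\<gamma> \<in> formal_curves"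
  shows "subtopology curve_topology (curve_orbit G \<gamma>) = discrete_topology (curve_orbit G \<gamma>)"
proof -
  obtain f where f: "\<gamma> = principal f" "irreducible f" "f \<in> max_ideal" using \<gamma> by (auto simp: formal_curves_def)
  note orb = curve_orbit_principal[OF G(1), of f]
  have irr: "irreducible (subst2 f \<psi>)" "subst2 f \<psi> \<in> max_ideal" if "\<psi> \<in> G" for \<psi>
    using irreducible_subst2 f diff_groupD(1)[OF G(1) that] by (auto simp: max_ideal_def)
  have sub: "curve_orbit G \<gamma> \<subseteq> formal_curves" unfolding f(1) orb using irr principal_in_formal_curves by blast
  show ?thesis unfolding discrete_iff[OF sub]
  proof
    fix \<delta> assume "\<delta> \<in> curve_orbit G \<gamma>"
    then obtain \<psi> where \<psi>: "\<psi> \<in> G" "\<delta> = principal (subst2 f \<psi>)" unfolding f(1) orb by blast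
    obtain n where n: "\<forall>\<phi>\<in>G. (\<forall>j<n. tangent_direction (curve_at (principal (subst2 (subst2 f \<psi>) \<phi>)) j) = tangent_direction (curve_at \<delta> j))
      \<longrightarrow> principal (subst2 (subst2 f \<psi>) \<phi>) = \<delta>"
      using finitely_determined_separates[OF G irr[OF \<psi>(1)]] \<psi>(2) by blast
    have "\<exists>\<phi>\<in>G. \<delta>' = principal (subst2 (subst2 f \<psi>) \<phi>)" if m: "\<delta>' \<in> curve_orbit G \<gamma>" for \<delta>'
    proof -
      obtain \<psi>' where \<psi>': "\<psi>' \<in> G" "\<delta>' = principal (subst2 f \<psi>')" using m unfolding f(1) orb by blast
      have d: "diff2 \<psi>" "diff2 \<psi>'" using diff_groupD(1)[OF G(1)] \<psi>(1) \<psi>'(1) by auto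
      have "subst2 (subst2 f \<psi>) (comp2 (inv2 \<psi>) \<psi>') = subst2 f \<psi>'" using d by (simp add: subst2_comp2)
      then show ?thesis using \<psi>' diff_groupD(2,4)[OF G(1)] \<psi>(1) by metis
    qed
    then show "\<exists>n. \<forall>\<delta>'\<in>curve_orbit G \<gamma>. (\<forall>j<n. tangent_direction (curve_at \<delta>' j) = tangent_direction (curve_at \<delta> j)) \<longrightarrow> \<delta>' = \<delta>"
      using n by metis
  qed
qed

section \<open>Discrete orbits imply finite determination\<close>

lemma irreducible_order_1:
  assumes "coeff2 f 0 0 = 0" "coeff2 f 1 0 \<noteq> 0 \<or> coeff2 f 0 1 \<noteq> 0" shows "irreducible f"
  unfolding irreducible_def ps2_dvd_1_iff
proof (intro conjI allI impI)
  show "f \<noteq> 0" using assms(2) by auto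
  fix a b assume "f = a * b"
  then show "coeff2 a 0 0 \<noteq> 0 \<or> coeff2 b 0 0 \<noteq> 0" using assms(2) by (auto simp: coeff2_mult_10 coeff2_mult_01)
qed (use assms(1) in simp)

lemma curve_at_Suc_shift: "curve_at \<gamma> (Suc k) = curve_at (strict_transform \<gamma>) k"
  by (induction k) auto

text \<open>
  Series of order one that agree up to order \<open>n + 1\<close> have the same tangent line, and their strict
  transforms agree up to order \<open>n\<close>, since blowing up costs the division by \<open>x\<close>.
\<close>

lemma close_curves_share_points:
  assumes f: "coeff2 f 0 0 = 0" "coeff2 f 1 0 \<noteq> 0 \<or> coeff2 f 0 1 \<noteq> 0" and g: "wt 1 1 (Suc n) (g - f)" and j: "j < n"
  shows "tangent_direction (curve_at (principal g) j) = tangent_direction (curve_at (principal f) j)"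
  using assms
proof (induction n arbitrary: f g j)
  case (Suc n)
  have fm: "f \<in> max_ideal" and irr: "irreducible f" using Suc.prems irreducible_order_1 by (auto simp: max_ideal_def)
  obtain m d f1 where st: "blow_step f m d f1" using blow_step_exists[OF irr fm] .
  have pf: "pure f m d" "1 \<le> m" and f1: "subst2 (subst2 f (dmap d)) B0 = X2 ^ m * f1" using st by (auto simp: blow_step_def)
  have "m = 1"
  proof (rule ccontr)
    assume "m \<noteq> 1"
    then have "wt 1 1 2 f" using pf pure_wt(1) wt_mono[of 1 1 m f 2] by fastforce
    then show False using Suc.prems(2) wtD[of 1 1 2 f 1 0] wtD[of 1 1 2 f 0 1] by simp
  qed
  obtain c where c: "c \<noteq> 0" "wt 1 1 (Suc m) (subst2 f (dmap d) - const2 c * Y2 ^ m)" using pf by (auto simp: pure_def)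
  have w: "wt 1 1 (Suc (Suc n)) (subst2 g (dmap d) - subst2 f (dmap d))"
    using wt_subst2_11[OF _ Suc.prems(3), of "dmap d"] by simp
  have "wt 1 1 (Suc m) ((subst2 g (dmap d) - subst2 f (dmap d)) + (subst2 f (dmap d) - const2 c * Y2 ^ m))"
    using wt_mono[OF w] \<open>m = 1\<close> by (intro wt_add c(2)) (simp add: One_nat_def)
  then have pg: "pure g m d" unfolding pure_def using c(1) by auto
  obtain g1 where g1: "subst2 (subst2 g (dmap d)) B0 = X2 ^ m * g1" using pure_blow_up[OF pg] by metis
  have tan: "tangent_direction (principal g) = tangent_direction (principal f)"
    using pure_tangent_direction[OF pg pf(2)] pure_tangent_direction[OF pf] by simp
  show ?case
  proof (cases j)
    case (Suc i)
    have "X2 ^ m * (g1 - f1) = subst2 (subst2 g (dmap d) - subst2 f (dmap d)) B0"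
      by (simp add: g1 f1 right_diff_distrib)
    then have "coeff2 (g1 - f1) i j = coeff2 (subst2 (subst2 g (dmap d) - subst2 f (dmap d)) B0) (Suc i) j" for i j
      using coeff2_X2_power_mult[of m "g1 - f1" "Suc i" j] \<open>m = 1\<close> by (simp add: One_nat_def)
    then have "wt 1 1 (Suc n) (g1 - f1)"
      using w unfolding coeff2_subst2_B0 by (auto simp: wt_def)
    moreover have "coeff2 f1 0 0 = 0" "coeff2 f1 0 1 \<noteq> 0"
      using blow_step_yreg(1)[OF st] blow_step_next[OF st] \<open>m = 1\<close> by (auto simp: yreg_def max_ideal_def)
    ultimately have "tangent_direction (curve_at (principal g1) i) = tangent_direction (curve_at (principal f1) i)"
      using Suc.IH[of f1 g1 i] Suc.prems(4) Suc by blast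
    then show ?thesis unfolding Suc curve_at_Suc_shift
      using pure_strict_transform[OF pg pf(2) g1] pure_strict_transform[OF pf f1] by simp
  qed (simp add: tan)
qed simp

lemma discrete_imp_stabilized:
  assumes G: "diff_group G" and f: "coeff2 f 0 0 = 0" "coeff2 f 1 0 \<noteq> 0 \<or> coeff2 f 0 1 \<noteq> 0"
    and disc: "subtopology curve_topology (curve_orbit G (principal f)) = discrete_topology (curve_orbit G (principal f))"
  shows "\<exists>k. \<forall>\<phi>\<in>G. wt 1 1 (Suc k) (fst \<phi> - X2) \<longrightarrow> wt 1 1 (Suc k) (snd \<phi> - Y2) \<longrightarrow> f dvd subst2 f \<phi>"
proof -
  note orb = curve_orbit_principal[OF G, of f]
  have irr: "irreducible (subst2 f \<psi>)" "subst2 f \<psi> \<in> max_ideal" if "\<psi> \<in> G" for \<psi>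
    using irreducible_subst2 irreducible_order_1[OF f] f diff_groupD(1)[OF G that] by (auto simp: max_ideal_def)
  have sub: "curve_orbit G (principal f) \<subseteq> formal_curves" unfolding orb using irr principal_in_formal_curves by blast
  have "principal f \<in> curve_orbit G (principal f)" unfolding orb using diff_groupD(3)[OF G] by (metis (mono_tags, lifting) mem_Collect_eq subst2_id2)
  then obtain n where n: "\<And>\<delta>. \<delta> \<in> curve_orbit G (principal f) \<Longrightarrow>
      \<forall>j<n. tangent_direction (curve_at \<delta> j) = tangent_direction (curve_at (principal f) j) \<Longrightarrow> \<delta> = principal f"
    using disc unfolding discrete_iff[OF sub] by metis
  show ?thesis
  proof (intro exI[of _ n] ballI impI)
    fix \<phi> assume \<phi>: "\<phi> \<in> G" "wt 1 1 (Suc n) (fst \<phi> - X2)" "wt 1 1 (Suc n) (snd \<phi> - Y2)"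
    have "wt 1 1 (Suc n) (subst2 f \<phi> - subst2 f id2)"
      by (rule wt_subst2_diff) (use \<phi> diff_groupD(1)[OF G \<phi>(1)] in auto)
    then have "wt 1 1 (Suc n) (subst2 f \<phi> - f)" by simp
    then have "principal (subst2 f \<phi>) = principal f"
      using close_curves_share_points[OF f] n[of "principal (subst2 f \<phi>)"] \<phi>(1) orb by blast
    then show "f dvd subst2 f \<phi>" by (simp add: principal_dvd)
  qed
qed

lemma infinite_roots_coeffs:
  fixes a :: "nat \<Rightarrow> complex"
  assumes "infinite S" "\<And>c. c \<in> S \<Longrightarrow> (\<Sum>b\<le>N. a b * c ^ b) = 0" "b \<le> N" shows "a b = 0"
proof -
  define p where "p = (\<Sum>b\<le>N. monom (a b) b)"
  have "poly p c = (\<Sum>b\<le>N. a b * c ^ b)" for c by (simp add: p_def poly_sum poly_monom)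
  then have "S \<subseteq> {c. poly p c = 0}" using assms(2) by auto
  then have "p = 0" using assms(1) poly_roots_finite finite_subset by blast
  moreover have "coeff p b = a b" using assms(3) by (simp add: p_def coeff_sum if_distrib[of "\<lambda>x. x _"] cong: if_cong)
  ultimately show ?thesis by simp
qed

lemma xonly_parabola: "1 \<le> e \<Longrightarrow> xonly (const2 c * X2 ^ e)"
  by (auto simp: xonly_def coeff2_X2_power)

lemma graph_dvd_restrict:
  assumes s: "xonly s" and d: "Y2 - s dvd h" shows "coeff2 (subst2 h (shear s)) n 0 = 0"
proof -
  have p: "fixes0 (shear s)" using s by simp
  have "subst2 (Y2 - s) (shear s) = Y2" using subst2_shear[OF s xonly_minus[OF s]] by (simp del: subst2_diff subst2_add)
  moreover obtain w where "h = (Y2 - s) * w" using d by (rule dvdE)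
  ultimately have "subst2 h (shear s) = Y2 * subst2 w (shear s)" using p by (metis subst2_mult)
  then show ?thesis by (simp add: coeff2_Y2_mult)
qed

text \<open>A diffeomorphism that fixes infinitely many lines through the origin is \<open>(x u, y u)\<close>, and if it
  also fixes infinitely many of the parabolas \<open>y = c x\<^sup>2\<close> then \<open>u = 1\<close>.\<close>

lemma fixes_lines_and_parabolas:
  assumes \<phi>: "diff2 \<phi>" "coeff2 (fst \<phi>) 1 0 = 1" and S: "infinite S"
    and line: "\<And>c. c \<in> S \<Longrightarrow> Y2 - const2 c * X2 ^ 1 dvd subst2 (Y2 - const2 c * X2 ^ 1) \<phi>"
    and parabola: "\<And>c. c \<in> S \<Longrightarrow> Y2 - const2 c * X2 ^ 2 dvd subst2 (Y2 - const2 c * X2 ^ 2) \<phi>"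
  shows "\<phi> = id2"
proof -
  have p: "fixes0 \<phi>" using \<phi> by simp
  \<comment> \<open>\<open>F b n\<close> is the coefficient of \<open>c\<^sup>b x\<^sup>n\<close> in \<open>\<phi>\<^sub>2(x, c x) - c \<phi>\<^sub>1(x, c x)\<close>, which vanishes if \<open>\<phi>\<close> fixes \<open>y = c x\<close>.\<close>
  define F where "F b n = (if b \<le> n then coeff2 (snd \<phi>) (n - b) b else 0) - (if 1 \<le> b then coeff2 (fst \<phi>) (n - (b - 1)) (b - 1) else 0)" for b n
  have F0: "F b n = 0" if "b \<le> Suc n" for b n
  proof (rule infinite_roots_coeffs[OF S _ that])
    fix c assume c: "c \<in> S"
    have "coeff2 (subst2 (snd \<phi> - const2 c * fst \<phi>) (shear (const2 c * X2 ^ 1))) n 0 = 0"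
      using graph_dvd_restrict[OF xonly_parabola line[OF c]] p by simp
    then have "coeff2 (subst2 (snd \<phi>) (dmap (Some c))) n 0 - c * coeff2 (subst2 (fst \<phi>) (dmap (Some c))) n 0 = 0"
      by (simp add: shear_def dmap_def)
    then have "(\<Sum>b\<le>n. coeff2 (snd \<phi>) (n - b) b * c ^ b) - (\<Sum>b\<le>n. coeff2 (fst \<phi>) (n - b) b * c ^ Suc b) = 0"
      unfolding coeff2_subst2_slope by (simp add: sum_distrib_left mult_ac)
    moreover have "(\<Sum>b\<le>Suc n. (if b \<le> n then coeff2 (snd \<phi>) (n - b) b else 0) * c ^ b) = (\<Sum>b\<le>n. coeff2 (snd \<phi>) (n - b) b * c ^ b)"
      by simp
    moreover have "(\<Sum>b\<le>Suc n. (if 1 \<le> b then coeff2 (fst \<phi>) (n - (b - 1)) (b - 1) else 0) * c ^ b) = (\<Sum>b\<le>n. coeff2 (fst \<phi>) (n - b) b * c ^ Suc b)"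
      unfolding sum.atMost_Suc_shift by (simp add: One_nat_def)
    ultimately show "(\<Sum>b\<le>Suc n. F b n * c ^ b) = 0"
      unfolding F_def left_diff_distrib sum_subtractf by simp
  qed
  define u where "u = mk_ps2 (\<lambda>i j. coeff2 (fst \<phi>) (Suc i) j)"
  have f: "fst \<phi> = X2 * u"
  proof (rule ps2_eqI)
    fix i j
    have "coeff2 (fst \<phi>) 0 j = 0" using F0[of "Suc j" j] by (simp add: F_def)
    then show "coeff2 (fst \<phi>) i j = coeff2 (X2 * u) i j" by (cases i) (auto simp: u_def coeff2_X2_mult One_nat_def)
  qed
  have s: "snd \<phi> = Y2 * u"
  proof (rule ps2_eqI)
    fix i j
    show "coeff2 (snd \<phi>) i j = coeff2 (Y2 * u) i j"
    proof (cases j)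
      case 0
      then show ?thesis using F0[of 0 i] by (simp add: F_def coeff2_Y2_mult)
    next
      case (Suc l)
      then show ?thesis using F0[of "Suc l" "i + Suc l"] by (simp add: F_def coeff2_Y2_mult u_def One_nat_def)
    qed
  qed
  have u00: "coeff2 u 0 0 = 1" using \<phi>(2) by (simp add: f coeff2_mult_10 coeff2_X2)
  have "infinite (S - {0})" using S by simp
  \<comment> \<open>On the parabola \<open>y u = c x\<^sup>2 u\<^sup>2\<close> with \<open>y = c x\<^sup>2\<close>, that is, \<open>u = u\<^sup>2\<close> for the restriction of \<open>u\<close>, a unit.\<close>
  have U: "coeff2 (subst2 u (shear (const2 c * X2 ^ 2))) n 0 = (if n = 0 then 1 else 0)" if c: "c \<in> S - {0}" for c n
  proof -
    let ?T = "shear (const2 c * X2 ^ 2)" let ?v = "subst2 u ?T"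
    have T: "fixes0 ?T" using diff2_shear[OF xonly_parabola, of 2 c] by simp
    have Y: "subst2 Y2 ?T = Y2 + const2 c * X2 ^ 2" "subst2 X2 ?T = X2" using T by (simp_all add: shear_def)
    have "subst2 (subst2 (Y2 - const2 c * X2 ^ 2) \<phi>) ?T = (Y2 + const2 c * X2 ^ 2) * ?v - const2 c * (X2 * ?v) ^ 2"
    proof -
      have "subst2 (Y2 - const2 c * X2 ^ 2) \<phi> = Y2 * u - const2 c * (X2 * u) ^ 2" using p f s by simp
      then show ?thesis
        by (simp only: subst2_diff subst2_scale) (simp only: subst2_diff subst2_mult[OF T] subst2_power[OF T] subst2_const2[OF T] Y)
    qed
    then have "coeff2 ((Y2 + const2 c * X2 ^ 2) * ?v - const2 c * (X2 * ?v) ^ 2) i 0 = 0" for i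
      using graph_dvd_restrict[OF xonly_parabola[of 2 c] parabola[of c], of i] c by simp
    then have "((Y2 + const2 c * X2 ^ 2) * ?v - const2 c * (X2 * ?v) ^ 2) $ 0 = 0" by (intro fps_ext) (simp add: coeff2_def)
    then have "fps_const c * fps_X ^ 2 * (?v $ 0) * (1 - ?v $ 0) = 0"
      by (simp add: fps_power_zeroth X2_def Y2_def const2_def algebra_simps power2_eq_square)
    moreover have "coeff2 ?v 0 0 = 1" using T u00 by simp
    then have "?v $ 0 \<noteq> 0" by (auto simp: coeff2_def)
    ultimately have "?v $ 0 = 1" using c by simp
    then show ?thesis by (simp add: coeff2_def)
  qed
  have "u = 1"
  proof (rule ps2_eqI)
    fix i j
    show "coeff2 u i j = coeff2 1 i j"
    proof (cases "i = 0 \<and> j = 0")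
      case False
      let ?n = "i + 2 * j"
      have "(if 2 * j \<le> ?n then coeff2 u (?n - 2 * j) j else 0) = 0"
      proof (rule infinite_roots_coeffs[OF \<open>infinite (S - {0})\<close>, of "\<lambda>b. if 2 * b \<le> ?n then coeff2 u (?n - 2 * b) b else 0" ?n])
        fix c assume "c \<in> S - {0}"
        then show "(\<Sum>b\<le>?n. (if 2 * b \<le> ?n then coeff2 u (?n - 2 * b) b else 0) * c ^ b) = 0"
          using U[of c ?n] False coeff2_subst2_parabola[of 2 u c ?n] by (auto simp: shear_def)
      qed simp
      then show ?thesis using False by (auto simp: coeff2_1)
    qed (use u00 in \<open>simp add: coeff2_1\<close>)
  qed
  then show ?thesis using f s by (simp add: id2_def prod_eq_iff)
qed

lemma discrete_imp_finitely_determined: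
  assumes G: "diff_group G"
    and disc: "\<And>\<gamma>. \<gamma> \<in> formal_curves \<Longrightarrow> subtopology curve_topology (curve_orbit G \<gamma>) = discrete_topology (curve_orbit G \<gamma>)"
  shows "\<exists>k. jet_faithful k G"
proof -
  let ?near = "\<lambda>k \<phi>. wt 1 1 (Suc k) (fst \<phi> - X2) \<and> wt 1 1 (Suc k) (snd \<phi> - Y2)"
  have ex: "\<exists>k. \<forall>\<phi>\<in>G. ?near k \<phi> \<longrightarrow> Y2 - const2 c * X2 ^ e dvd subst2 (Y2 - const2 c * X2 ^ e) \<phi>" if "1 \<le> e" for c e
  proof -
    let ?f = "Y2 - const2 c * X2 ^ e"
    have f: "coeff2 ?f 0 0 = 0" "coeff2 ?f 1 0 \<noteq> 0 \<or> coeff2 ?f 0 1 \<noteq> 0" using that by (auto simp: coeff2_Y2 coeff2_X2_power)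
    then have "principal ?f \<in> formal_curves" using irreducible_order_1 by (auto simp: formal_curves_def max_ideal_def)
    then show ?thesis using discrete_imp_stabilized[OF G f disc] by blast
  qed
  have "\<forall>c. \<exists>k. \<forall>\<phi>\<in>G. ?near k \<phi> \<longrightarrow> Y2 - const2 c * X2 ^ 1 dvd subst2 (Y2 - const2 c * X2 ^ 1) \<phi>"
    using ex[OF order_refl] by (rule allI)
  then obtain k1 where k1: "\<forall>c. \<forall>\<phi>\<in>G. ?near (k1 c) \<phi> \<longrightarrow> Y2 - const2 c * X2 ^ 1 dvd subst2 (Y2 - const2 c * X2 ^ 1) \<phi>"
    by (rule choice[THEN exE])
  have "\<forall>c. \<exists>k. \<forall>\<phi>\<in>G. ?near k \<phi> \<longrightarrow> Y2 - const2 c * X2 ^ 2 dvd subst2 (Y2 - const2 c * X2 ^ 2) \<phi>"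
    using ex[OF one_le_numeral] by (rule allI)
  then obtain k2 where k2: "\<forall>c. \<forall>\<phi>\<in>G. ?near (k2 c) \<phi> \<longrightarrow> Y2 - const2 c * X2 ^ 2 dvd subst2 (Y2 - const2 c * X2 ^ 2) \<phi>"
    by (rule choice[THEN exE])
  define K where "K c = max 1 (max (k1 c) (k2 c))" for c
  \<comment> \<open>The sets \<open>{c. K c = k}\<close> cover \<open>\<complex>\<close>.\<close>
  have "\<exists>k. infinite {c. K c = k}"
  proof (rule ccontr)
    assume "\<not> ?thesis"
    then have "countable (\<Union>k. {c. K c = k})" by (intro countable_UN) (auto intro: countable_finite)
    moreover have "(\<Union>k. {c. K c = k}) = UNIV" by auto
    ultimately show False using uncountable_UNIV_complex by simp
  qed
  then obtain k where S: "infinite {c. K c = k}" (is "infinite ?S") by blast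
  have "jet_faithful k G"
    unfolding jet_faithful_def
  proof (intro ballI impI)
    fix \<phi> assume \<phi>: "\<phi> \<in> G" "wt 1 1 (Suc k) (fst \<phi> - X2)" "wt 1 1 (Suc k) (snd \<phi> - Y2)"
    have le: "1 \<le> k" using S by (metis (mono_tags, lifting) K_def empty_Collect_eq finite.emptyI max.cobounded1)
    have near: "?near (k1 c) \<phi>" "?near (k2 c) \<phi>" if "c \<in> ?S" for c
    proof -
      have "k1 c \<le> k" "k2 c \<le> k" using that by (auto simp: K_def)
      then show "?near (k1 c) \<phi>" "?near (k2 c) \<phi>" using \<phi>(2,3) by (auto intro: wt_mono)
    qed
    show "\<phi> = id2"
    proof (rule fixes_lines_and_parabolas[OF _ _ S])
      show "diff2 \<phi>" using diff_groupD(1)[OF G \<phi>(1)] .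
      show "coeff2 (fst \<phi>) 1 0 = 1" using wtD[OF \<phi>(2), of 1 0] le by (simp add: coeff2_X2)
    qed (use k1 k2 near \<phi>(1) in blast)+
  qed
  then show ?thesis ..
qed

theorem theorem1p2:
  fixes G :: "(ps2 \<times> ps2) set"
  assumes "subgroup G formal_Diff"
  shows "finitely_determined G \<longleftrightarrow>
    (\<forall>\<gamma>\<in>formal_curves.
       subtopology curve_topology (curve_orbit G \<gamma>) = discrete_topology (curve_orbit G \<gamma>))"
proof -
  have G: "diff_group G" using subgroup_diff_group[OF assms] .
  show ?thesis
    unfolding finitely_determined_iff[OF G]
    using finitely_determined_imp_discrete[OF G] discrete_imp_finitely_determined[OF G] by blast
qed

end
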